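(* Let $d\in\{3,4\}$ and let $X_0,\ldots,X_d$ be independent random points, each uniformly distributed in the unit ball $\mathbb{B}^{d}=\{x\in\mathbb{R}^d\colon \|x\|\leq 1\}$. Let $T=[X_0,\ldots,X_d]$ be the convex hull of $X_0,\ldots,X_d$, and let $s_0(T)$ be the sum of the solid angles of $T$ at its vertices (normalized so that the full solid angle equals $1$). Then $$ \mathbb{E}\, s_0(T) = \begin{cases} \frac {401}{2560}, &\text{ if } d=3,\\ \frac{1692197}{846720 \pi^2}-\frac 16, &\text{ if } d=4. \end{cases} $$
   Context: $\|x\|$ denotes the Euclidean norm on $\mathbb{R}^d$. For a $d$-dimensional convex polytope $P\subset\mathbb{R}^d$ with vertex set $\mathcal{F}_0(P)$, the internal (solid) angle of $P$ at a vertex $x_0$ is $$\beta(x_0,P):=\mathbb{P}[\exists\, \varepsilon>0 \text{ such that } x_0+\varepsilon U\in P],$$ where $U$ is a random vector uniformly distributed on the unit sphere $\mathbb{S}^{d-1}=\{x\in\mathbb{R}^d\colon\|x\|=1\}$. The angle sum at vertices is $s_0(P)=\sum_{x_0\in\mathcal{F}_0(P)}\beta(x_0,P)$. With probability $1$, the random convex hull $T$ is a $d$-dimensional simplex with vertices $X_0,\ldots,X_d$, so $s_0(T)$ is almost surely defined. *)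

theory Defs
  imports "HOL-Probability.Probability"
begin

text \<open>
  Uniform distribution on the unit sphere: the law of \<open>Y / norm Y\<close> for \<open>Y\<close> uniform in the
  unit ball, i.e. the normalised cone (surface) measure. It is concentrated on the sphere and
  invariant under orthogonal maps, which characterises it; see the lemmas below.
\<close>

definition uniform_sphere :: "'a::euclidean_space measure" where
  "uniform_sphere = distr (uniform_measure lborel (cball 0 1)) borel sgn"

text \<open>
  \<open>solid_angle x P\<close> is the probability that a random direction \<open>u\<close> points from \<open>x\<close>
  into \<open>P\<close>. For \<open>P\<close> closed and convex, \<open>x \<in> P\<close>, the event is a Borel set. A polytope of
  dimension less than that of the ambient space has angle 0 at each vertex, so the definition is
  total and agrees with the usual one for full-dimensional polytopes.
\<close>

definition solid_angle :: "'a::euclidean_space \<Rightarrow> 'a set \<Rightarrow> real" where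
  "solid_angle x P = measure uniform_sphere {u. \<exists>\<epsilon>>0. x + \<epsilon> *\<^sub>R u \<in> P}"

definition vertex_angle_sum :: "'a::euclidean_space set \<Rightarrow> real" where
  "vertex_angle_sum P = (\<Sum>x | x extreme_point_of P. solid_angle x P)"

lemma emeasure_cball_unit:
  "emeasure lborel (cball 0 1 :: 'a::euclidean_space set) \<noteq> 0"
  "emeasure lborel (cball 0 1 :: 'a::euclidean_space set) \<noteq> \<infinity>"
proof -
  show "emeasure lborel (cball 0 1 :: 'a set) \<noteq> \<infinity>"
    using emeasure_lborel_cball_finite[of "0::'a" 1] by simp
  have "measure lborel (cball (0::'a) 1) > 0"
    by (rule content_cball_pos) simp
  then show "emeasure lborel (cball 0 1 :: 'a set) \<noteq> 0"
    by (auto simp: measure_def)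
qed

lemma measurable_sgn_uniform:
  "sgn \<in> measurable (uniform_measure lborel (cball 0 1)) (borel :: 'a::euclidean_space measure)"
proof -
  have "(\<lambda>x::'a. x /\<^sub>R norm x) \<in> borel_measurable borel"
    by measurable
  then have "(sgn :: 'a \<Rightarrow> 'a) \<in> borel_measurable borel"
    by (simp add: sgn_div_norm[abs_def])
  then show ?thesis
    by (simp add: measurable_def)
qed

lemma prob_space_uniform_sphere: "prob_space (uniform_sphere :: 'a::euclidean_space measure)"
  unfolding uniform_sphere_def
  by (intro prob_space.prob_space_distr prob_space_uniform_measure emeasure_cball_unit
      measurable_sgn_uniform)

lemma AE_uniform_sphere: "AE u in (uniform_sphere :: 'a::euclidean_space measure). norm u = 1"
proof -
  have "AE x in lborel. x \<noteq> (0::'a)"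
    by (rule AE_lborel_singleton)
  then have "AE x in uniform_measure lborel (cball 0 1). x \<noteq> (0::'a)"
    by (subst AE_uniform_measure) (use emeasure_cball_unit[where 'a='a] in \<open>auto simp: top.not_eq_extremum\<close>)
  then have "AE x in uniform_measure lborel (cball 0 1). norm (sgn x :: 'a) = 1"
    by eventually_elim (simp add: norm_sgn)
  then show ?thesis
    unfolding uniform_sphere_def
    by (subst AE_distr_iff[OF measurable_sgn_uniform]) auto
qed

text \<open>The sort constraint comes from the library's \<open>measure_orthogonal_image\<close>.\<close>

lemma uniform_sphere_orthogonal_invariant:
  fixes f :: "real^'n::{finite,wellorder} \<Rightarrow> real^'n::_"
  assumes f: "orthogonal_transformation f"
  shows "distr uniform_sphere borel f = uniform_sphere"
proof (rule measure_eqI)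
  let ?B = "cball 0 1 :: (real^'n::_) set"
  let ?U = "uniform_measure lborel ?B"
  have lin: "linear f" and nf: "\<And>x. norm (f x) = norm x"
    using f by (auto simp: orthogonal_transformation)
  have bij: "bij f"
    using f by (rule orthogonal_transformation_bij)
  have mf: "f \<in> borel_measurable borel"
    using lin by (intro borel_measurable_continuous_onI linear_continuous_on)
      (simp add: linear_linear)
  have sgnf: "sgn (f x) = f (sgn x)" for x
    using lin by (simp add: sgn_div_norm nf linear_cmul)
  have msgn: "sgn \<in> measurable borel (borel :: (real^'n::_) measure)"
    using measurable_sgn_uniform[where 'a="real^'n::_"] by (simp add: measurable_def)
  show "sets (distr uniform_sphere borel f) = sets uniform_sphere"
    by (simp add: uniform_sphere_def)
  fix A assume "A \<in> sets (distr uniform_sphere borel f)"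
  then have A: "A \<in> sets borel" by simp
  let ?S = "sgn -` A"
  have S: "?S \<in> sets borel"
    using measurable_sets[OF msgn A] by simp
  have fS: "f -` ?S \<in> sets borel"
    using measurable_sets[OF mf S] by simp
  have "?B \<inter> f -` ?S = inv f ` (?B \<inter> ?S)"
  proof (intro set_eqI iffI)
    fix x assume x: "x \<in> ?B \<inter> f -` ?S"
    then have "f x \<in> ?B \<inter> ?S" by (simp add: nf)
    moreover have "x = inv f (f x)" using bij_is_inj[OF bij] by simp
    ultimately show "x \<in> inv f ` (?B \<inter> ?S)" by (rule rev_image_eqI)
  next
    fix x assume "x \<in> inv f ` (?B \<inter> ?S)"
    then obtain y where y: "y \<in> ?B \<inter> ?S" "x = inv f y" by blast
    then have "f x = y" using bij_is_surj[OF bij] by (simp add: surj_f_inv_f)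
    then show "x \<in> ?B \<inter> f -` ?S" using y(1) nf[of x] by simp
  qed
  moreover have "?B \<inter> ?S \<in> lmeasurable"
    by (intro bounded_set_imp_lmeasurable) (use S in \<open>auto intro: bounded_Int\<close>)
  ultimately have "measure lebesgue (?B \<inter> f -` ?S) = measure lebesgue (?B \<inter> ?S)"
    using measure_orthogonal_image[OF orthogonal_transformation_inv[OF f]] by simp
  then have "measure lborel (?B \<inter> f -` ?S) = measure lborel (?B \<inter> ?S)"
    using S fS by (simp add: measure_completion)
  moreover have "emeasure lborel (?B \<inter> C) = ennreal (measure lborel (?B \<inter> C))"
    if "C \<in> sets borel" for C
  proof (rule emeasure_eq_ennreal_measure)
    have "emeasure lborel (?B \<inter> C) \<le> emeasure lborel ?B"
      by (intro emeasure_mono) auto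
    then show "emeasure lborel (?B \<inter> C) \<noteq> top"
      using emeasure_cball_unit(2)[where 'a="real^'n::_"] by (auto simp: top_unique)
  qed
  ultimately have eq: "emeasure lborel (?B \<inter> f -` ?S) = emeasure lborel (?B \<inter> ?S)"
    using S fS by simp
  have v: "sgn -` (f -` A) = f -` ?S"
    by (auto simp: sgnf)
  have fA: "f -` A \<in> sets borel"
    using measurable_sets[OF mf A] by simp
  have "emeasure (distr uniform_sphere borel f) A = emeasure uniform_sphere (f -` A)"
    using mf A by (subst emeasure_distr) (auto simp: uniform_sphere_def measurable_def)
  also have "\<dots> = emeasure ?U (f -` ?S)"
    unfolding uniform_sphere_def
    using fA by (subst emeasure_distr[OF measurable_sgn_uniform]) (auto simp: v)
  also have "\<dots> = emeasure ?U ?S"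
    using S fS by (simp add: eq)
  also have "\<dots> = emeasure uniform_sphere A"
    unfolding uniform_sphere_def
    using A by (subst emeasure_distr[OF measurable_sgn_uniform]) auto
  finally show "emeasure (distr uniform_sphere borel f) A = emeasure uniform_sphere A" .
qed

end

(*
Write a direction v as v = sum_i c_i X_i with sum_i c_i = 0. For almost every v the cones of the
simplex at its vertices cover v once or not at all, according to whether exactly one c_i is
negative; by the symmetry v -> -v the expected angle sum is half the probability that one of the
signs of the c_i is isolated. In dimensions 3 and 4 this event is determined by the number of
pairs {k, l} with c_k c_l < 0, and c_k c_l < 0 means that X_k and X_l lie on the same side of the
hyperplane that is parallel to v and contains the remaining d - 1 points.

By rotation invariance v may be fixed. In coordinates (z, x, w) with v along the w-axis the
hyperplane is z = a . x + b; for fixed x the map (a, b) -> z is linear, and translating and scaling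
x shows that the signed distance h = b / sqrt (1 + |a|^2) has density proportional to
(1 - h^2)^(m/2) with m = 5 for d = 3 and m = 11 for d = 4. The normalising constants never have to
be computed. What remains is the integral of F(h)^2 + (1 - F(h))^2 against this density, where F(h)
is the mass of the ball beyond distance h from the centre.
*)

theory Submission
  imports Defs
begin

subsection \<open>Solid angles of a simplex\<close>

text \<open>Counting pairs suffices because 2 N (d + 1 - N), for 1 <= N <= d, takes only two values
  when d = 3 (6 and 8) or d = 4 (8 and 12), the smaller one exactly at an isolated sign; from d = 5
  on there are at least three values. By linearity only the probability for one pair is needed, and
  it concerns a single hyperplane. As that hyperplane is parallel to the w-axis, w can be integrated
  out: a point enters through its projection (z, x), with density proportional to the length of the
  chord above it. The exponent m comes from rescaling a section at height h, a ball of radius r =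
  sqrt (1 - h^2): the d - 1 points in dimension d - 2 contribute r^((d-1)(d-2)), the Jacobian, a
  (d-2)-dimensional volume, r^(d-2), and the d - 1 chords r^(d-1). Hence m = d^2 - d - 1. Working
  with \<open>ennreal\<close> integrals avoids integrability questions. The price is that the
  proportionality constant might be infinite until it is normalised with the constant function 1,
  and that truncation at 0 calls for separate positivity checks.\<close>

definition edge_matrix :: "('n::finite \<Rightarrow> nat) \<Rightarrow> (nat \<Rightarrow> real^'n) \<Rightarrow> real^'n^'n" where
  "edge_matrix p x = (\<chi> j. x (p j) - x 0)"

definition replace_row :: "real^'n^'n \<Rightarrow> 'n::finite \<Rightarrow> real^'n \<Rightarrow> real^'n^'n" where
  "replace_row A j v = (\<chi> k. if k = j then v else A $ k)"

text \<open>Cramer's numerators: \<open>det (edge_matrix p x) *\<^sub>R v = (\<Sum>i. dircoef p x v i *\<^sub>R x i)\<close> with coefficients of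
  sum \<open>0\<close>, see \<open>sum_dircoef_scaleR\<close>.\<close>

definition dircoef :: "('n::finite \<Rightarrow> nat) \<Rightarrow> (nat \<Rightarrow> real^'n) \<Rightarrow> real^'n \<Rightarrow> nat \<Rightarrow> real" where
  "dircoef p x v i = (if i = 0 then - (\<Sum>j\<in>UNIV. det (replace_row (edge_matrix p x) j v))
     else det (replace_row (edge_matrix p x) (inv p i) v))"

lemma det_replace_row_scale: "det (replace_row A j (c *\<^sub>R v)) = c * det (replace_row A j v)"
  using det_row_mul[of j c "\<lambda>_. v" "\<lambda>k. A $ k"] unfolding replace_row_def scalar_mult_eq_scaleR .

lemma dircoef_scale: "dircoef p x (c *\<^sub>R v) i = c * dircoef p x v i"
  by (simp add: dircoef_def det_replace_row_scale sum_distrib_left)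

lemma dircoef_minus: "dircoef p x (- v) i = - dircoef p x v i"
  using dircoef_scale[of p x "-1" v i] by simp

lemma borel_measurable_det:
  fixes f :: "'a \<Rightarrow> real^'n^'n"
  assumes "\<And>i j. (\<lambda>x. f x $ i $ j) \<in> borel_measurable M"
  shows "(\<lambda>x. det (f x)) \<in> borel_measurable M"
  unfolding det_def
  by (intro borel_measurable_sum borel_measurable_times borel_measurable_const) (intro borel_measurable_prod assms)

lemma row_eq_nth: "row i A = A $ i"
  by (simp add: row_def)

text \<open>\<open>uniform_sphere\<close> is the image of the ball under \<open>sgn\<close>, and
  \<open>sgn\<close> does not affect a condition that is invariant under positive scaling.
  Directions can therefore be drawn from the ball, by the same measure as the vertices.\<close>

lemma measure_uniform_sphere_homogeneous:
  assumes [measurable]: "Measurable.pred borel P" and hom: "\<And>c v. c > 0 \<Longrightarrow> P (c *\<^sub>R v) = P v"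
  shows "measure uniform_sphere {u. P u} = measure (uniform_measure lborel (cball 0 1)) {v :: 'a::euclidean_space. P v}"
proof -
  have "P (sgn v) = P v" for v
    using hom[of "inverse (norm v)" v] by (cases "v = 0") (simp_all add: sgn_div_norm)
  then show ?thesis
    unfolding uniform_sphere_def
    by (subst measure_distr[OF measurable_sgn_uniform]) (simp_all add: vimage_def)
qed

text \<open>The points are numbered 0..d, whereas the rows of a matrix are indexed by the type 'n.
  The bijection \<open>p\<close> matches row \<open>j\<close> with point \<open>p j\<close>; point 0
  is the base of the edges.\<close>

locale simplex_enum =
  fixes p :: "'n::finite \<Rightarrow> nat"
  assumes p: "bij_betw p UNIV {1..CARD('n)}"
begin

lemma inj_p: "inj p"
  using p by (simp add: bij_betw_def)

lemma inv_p [simp]: "inv p (p j) = j"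
  using inj_p by simp

lemma p_neq_0 [simp]: "p j \<noteq> 0"
proof -
  have "p j \<in> {1..CARD('n)}" using p by (auto simp: bij_betw_def)
  then show ?thesis by simp
qed

lemma index_set: "{0..CARD('n)} = insert 0 (p ` UNIV)"
proof -
  have "p ` UNIV = {1..CARD('n)}" using p by (simp add: bij_betw_def)
  then show ?thesis by auto
qed

lemma sum_index: "(\<Sum>i\<in>{0..CARD('n)}. f i) = f 0 + (\<Sum>j\<in>UNIV. f (p j))"
proof -
  have "0 \<notin> range p" using p_neq_0 by (metis rangeE)
  then show ?thesis by (simp add: index_set sum.reindex[OF inj_p] del: p_neq_0)
qed

lemma sum_dircoef: "(\<Sum>i\<in>{0..CARD('n)}. dircoef p x v i) = 0"
  by (simp add: sum_index) (simp add: dircoef_def)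

text \<open>Cramer's rule for v written in the rows of the edge matrix: putting v in row k
  multiplies the determinant by the coefficient of that row. Not dividing by the determinant keeps
  the coefficients polynomial in x and v, hence measurable without exceptions.\<close>

lemma sum_dircoef_scaleR:
  assumes det: "det (edge_matrix p x) \<noteq> 0"
  shows "(\<Sum>i\<in>{0..CARD('n)}. dircoef p x v i *\<^sub>R x i) = det (edge_matrix p x) *\<^sub>R v"
proof -
  let ?A = "edge_matrix p x"
  have "invertible (transpose ?A)" using det by (simp add: invertible_det_nz)
  then obtain c where "transpose ?A *v c = v"
    by (metis invertible_def matrix_vector_mul_assoc matrix_vector_mul_lid)
  then have v: "v = (\<Sum>j\<in>UNIV. c $ j *s row j ?A)"
    by (simp add: matrix_mult_sum)
  have "det (replace_row ?A k v) = c $ k * det ?A" for k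
    using cramer_lemma_transpose[of k c ?A, folded v, unfolded row_eq_nth] by (simp only: replace_row_def)
  then have d: "dircoef p x v (p k) = c $ k * det ?A" for k
    by (simp add: dircoef_def)
  have "(\<Sum>i\<in>{0..CARD('n)}. dircoef p x v i *\<^sub>R x i)
      = (\<Sum>i\<in>{0..CARD('n)}. dircoef p x v i *\<^sub>R (x i - x 0)) + (\<Sum>i\<in>{0..CARD('n)}. dircoef p x v i) *\<^sub>R x 0"
    by (simp add: scaleR_diff_right sum_subtractf scaleR_sum_left)
  also have "\<dots> = (\<Sum>k\<in>UNIV. (c $ k * det ?A) *\<^sub>R (?A $ k))"
    by (simp add: sum_dircoef) (simp add: sum_index d edge_matrix_def)
  also have "\<dots> = det ?A *\<^sub>R v"
    by (subst v) (simp add: scaleR_sum_right row_eq_nth scalar_mult_eq_scaleR mult.commute)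
  finally show ?thesis .
qed

lemma simplex_independent:
  assumes det: "det (edge_matrix p x) \<noteq> 0"
    and s: "(\<Sum>i\<in>{0..CARD('n)}. a i) = 0" "(\<Sum>i\<in>{0..CARD('n)}. a i *\<^sub>R x i) = 0"
    and i: "i \<in> {0..CARD('n)}"
  shows "a i = 0"
proof -
  let ?A = "edge_matrix p x"
  have "(\<Sum>j\<in>UNIV. a (p j) *s row j ?A) = (\<Sum>i\<in>{0..CARD('n)}. a i *\<^sub>R (x i - x 0))"
    by (simp add: sum_index row_eq_nth scalar_mult_eq_scaleR edge_matrix_def)
  also have "\<dots> = 0"
    using s by (simp add: scaleR_diff_right sum_subtractf scaleR_sum_left[symmetric])
  finally have "(\<Sum>j\<in>UNIV. a (p j) *s row j ?A) = 0" .
  moreover have "\<exists>B. ?A ** B = mat 1" using det by (metis invertible_det_nz invertible_def)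
  ultimately have *: "a (p j) = 0" for j
    using matrix_right_invertible_independent_rows[of ?A] by metis
  with s(1) have "a 0 = 0" by (simp add: sum_index)
  with * i show ?thesis by (auto simp: index_set)
qed

lemma simplex_inj:
  assumes det: "det (edge_matrix p x) \<noteq> 0"
  shows "inj_on x {0..CARD('n)}"
proof (rule inj_onI, rule ccontr)
  fix i j assume ij: "i \<in> {0..CARD('n)}" "j \<in> {0..CARD('n)}" "x i = x j" "i \<noteq> j"
  let ?a = "\<lambda>k. (if k = i then 1 else 0) - (if k = j then 1 else 0) :: real"
  have "(\<Sum>k\<in>{0..CARD('n)}. ?a k *\<^sub>R x k)
     = (\<Sum>k\<in>{0..CARD('n)}. (if k = i then x k else 0) - (if k = j then x k else 0))"
    using ij by (intro sum.cong) auto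
  then have "(\<Sum>k\<in>{0..CARD('n)}. ?a k *\<^sub>R x k) = 0"
    using ij by (simp add: sum_subtractf)
  moreover have "(\<Sum>k\<in>{0..CARD('n)}. ?a k) = 0"
    using ij by (simp add: sum_subtractf)
  ultimately have "?a i = 0"
    using simplex_independent[OF det _ _ ij(1), of ?a] by blast
  then show False using ij by simp
qed

lemma simplex_affine_independent:
  assumes det: "det (edge_matrix p x) \<noteq> 0"
  shows "\<not> affine_dependent (x ` {0..CARD('n)})"
proof
  assume "affine_dependent (x ` {0..CARD('n)})"
  then obtain u where u: "sum u (x ` {0..CARD('n)}) = 0" "\<exists>v\<in>x ` {0..CARD('n)}. u v \<noteq> 0"
      "(\<Sum>v\<in>x ` {0..CARD('n)}. u v *\<^sub>R v) = 0"
    by (subst (asm) affine_dependent_explicit_finite) auto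
  then have "u (x i) = 0" if "i \<in> {0..CARD('n)}" for i
    using simplex_independent[OF det _ _ that, of "\<lambda>i. u (x i)"]
    by (simp add: sum.reindex[OF simplex_inj[OF det]])
  then show False using u(2) by blast
qed

text \<open>The expressions on the right are the barycentric coordinates of the point: vertex i has
  the coordinates of a unit vector, and moving along v adds a multiple of \<open>dircoef\<close>
  over the determinant. Affine independence makes these coordinates unique.\<close>

lemma mem_simplex_iff:
  assumes det: "det (edge_matrix p x) \<noteq> 0" and i: "i \<in> {0..CARD('n)}"
  shows "x i + \<epsilon> *\<^sub>R v \<in> convex hull (x ` {0..CARD('n)}) \<longleftrightarrow>
    (\<forall>j\<in>{0..CARD('n)}. 0 \<le> (if j = i then 1 else 0) + \<epsilon> * (dircoef p x v j / det (edge_matrix p x)))"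
    (is "_ \<longleftrightarrow> (\<forall>j\<in>?I. 0 \<le> ?w j)")
proof -
  let ?D = "det (edge_matrix p x)"
  note inj = simplex_inj[OF det]
  have s1: "(\<Sum>j\<in>?I. ?w j) = 1"
    using i by (simp add: sum.distrib sum_distrib_left[symmetric] sum_divide_distrib[symmetric] sum_dircoef)
  have "(\<Sum>j\<in>?I. ?w j *\<^sub>R x j) = (\<Sum>j\<in>?I. (if j = i then x j else 0) + (\<epsilon> / ?D) *\<^sub>R (dircoef p x v j *\<^sub>R x j))"
    by (intro sum.cong) (auto simp: scaleR_add_left)
  also have "\<dots> = x i + \<epsilon> *\<^sub>R v"
    unfolding sum.distrib scaleR_sum_right[symmetric] sum_dircoef_scaleR[OF det] using i det by simp
  finally have s2: "(\<Sum>j\<in>?I. ?w j *\<^sub>R x j) = x i + \<epsilon> *\<^sub>R v" .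
  show ?thesis
  proof
    assume "x i + \<epsilon> *\<^sub>R v \<in> convex hull (x ` ?I)"
    then obtain u where u: "\<forall>y\<in>x ` ?I. 0 \<le> u y" "sum u (x ` ?I) = 1" "(\<Sum>y\<in>x ` ?I. u y *\<^sub>R y) = x i + \<epsilon> *\<^sub>R v"
      by (auto simp: convex_hull_finite)
    show "\<forall>j\<in>?I. 0 \<le> ?w j"
    proof
      fix j assume j: "j \<in> ?I"
      have "u (x j) - ?w j = 0"
        by (rule simplex_independent[OF det _ _ j, of "\<lambda>j. u (x j) - ?w j"])
          (use u(2,3) s1 s2 in \<open>simp_all add: sum.reindex[OF inj] sum_subtractf scaleR_diff_left\<close>)
      moreover have "0 \<le> u (x j)" using u(1) j by blast
      ultimately show "0 \<le> ?w j" by linarith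
    qed
  next
    assume w: "\<forall>j\<in>?I. 0 \<le> ?w j"
    have "(\<Sum>j\<in>?I. ?w j *\<^sub>R x j) \<in> convex hull (x ` ?I)"
      using w s1 by (intro convex_sum) (auto intro: hull_inc)
    then show "x i + \<epsilon> *\<^sub>R v \<in> convex hull (x ` ?I)" by (simp only: s2)
  qed
qed

text \<open>For j different from i the barycentric coordinate starts at 0, so the sign of its slope
  decides. Coordinate i starts at 1 and survives a short move whatever its slope.\<close>

lemma simplex_cone_iff:
  assumes det: "det (edge_matrix p x) \<noteq> 0" and i: "i \<in> {0..CARD('n)}"
  shows "(\<exists>\<epsilon>>0. x i + \<epsilon> *\<^sub>R v \<in> convex hull (x ` {0..CARD('n)})) \<longleftrightarrow>
    (\<forall>j\<in>{0..CARD('n)} - {i}. 0 \<le> dircoef p x v j * det (edge_matrix p x))"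
proof -
  let ?D = "det (edge_matrix p x)"
  \<comment> \<open>Only signs matter, so division by the determinant is traded for
    multiplication.\<close>
  have sgn: "0 \<le> c * ?D \<longleftrightarrow> 0 \<le> c / ?D" for c
    by (simp add: zero_le_mult_iff zero_le_divide_iff)
  show ?thesis
  proof
    assume "\<exists>\<epsilon>>0. x i + \<epsilon> *\<^sub>R v \<in> convex hull (x ` {0..CARD('n)})"
    then obtain \<epsilon> where e: "\<epsilon> > 0" "x i + \<epsilon> *\<^sub>R v \<in> convex hull (x ` {0..CARD('n)})" by blast
    show "\<forall>j\<in>{0..CARD('n)} - {i}. 0 \<le> dircoef p x v j * ?D"
    proof
      fix j assume j: "j \<in> {0..CARD('n)} - {i}"
      then have "0 \<le> \<epsilon> * (dircoef p x v j / ?D)"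
        using bspec[OF e(2)[unfolded mem_simplex_iff[OF det i]], of j] by simp
      then show "0 \<le> dircoef p x v j * ?D"
        unfolding sgn using e(1) zero_le_mult_iff[of \<epsilon> "dircoef p x v j / ?D"] by simp
    qed
  next
    assume h: "\<forall>j\<in>{0..CARD('n)} - {i}. 0 \<le> dircoef p x v j * ?D"
    define c where "c = dircoef p x v i / ?D"
    \<comment> \<open>This step length keeps coordinate i, that is 1 + \<epsilon> c, nonnegative for
      either sign of c.\<close>
    define \<epsilon> where "\<epsilon> = 1 / (1 + \<bar>c\<bar>)"
    have e: "\<epsilon> > 0" by (simp add: \<epsilon>_def add_pos_nonneg)
    have "- (\<epsilon> * c) \<le> \<epsilon> * \<bar>c\<bar>" using mult_left_mono[of "- c" "\<bar>c\<bar>" \<epsilon>] e by simp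
    also have "\<dots> \<le> 1" by (simp add: \<epsilon>_def field_simps)
    finally have "0 \<le> 1 + \<epsilon> * c" by simp
    then have "x i + \<epsilon> *\<^sub>R v \<in> convex hull (x ` {0..CARD('n)})"
      unfolding mem_simplex_iff[OF det i] using h e sgn by (auto simp: c_def simp del: times_divide_eq_right)
    with e show "\<exists>\<epsilon>>0. x i + \<epsilon> *\<^sub>R v \<in> convex hull (x ` {0..CARD('n)})" by blast
  qed
qed

lemma measurable_dircoef:
  assumes [measurable]: "\<And>i. i \<in> {0..CARD('n)} \<Longrightarrow> (\<lambda>y. f y i) \<in> borel_measurable M" "g \<in> borel_measurable M"
    and i: "i \<in> {0..CARD('n)}"
  shows "(\<lambda>y. dircoef p (f y) (g y) i) \<in> borel_measurable M"
    and "(\<lambda>y. det (edge_matrix p (f y))) \<in> borel_measurable M"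
proof -
  have [measurable]: "(\<lambda>y. f y (p j)) \<in> borel_measurable M" "(\<lambda>y. f y 0) \<in> borel_measurable M" for j
    using assms(1) by (auto simp: index_set)
  have *: "(\<lambda>y. (h y :: real^'n) $ k) \<in> borel_measurable M" if [measurable]: "h \<in> borel_measurable M" for h k
    by (rule measurable_compose[OF that]) (intro borel_measurable_continuous_onI continuous_intros)
  show "(\<lambda>y. det (edge_matrix p (f y))) \<in> borel_measurable M"
    by (rule borel_measurable_det) (simp add: edge_matrix_def * del: vector_minus_component)
  have "(\<lambda>y. det (replace_row (edge_matrix p (f y)) j (g y))) \<in> borel_measurable M" for j
  proof (rule borel_measurable_det)
    fix k l
    show "(\<lambda>y. replace_row (edge_matrix p (f y)) j (g y) $ k $ l) \<in> borel_measurable M"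
      by (cases "k = j") (simp_all add: replace_row_def edge_matrix_def * del: vector_minus_component)
  qed
  then show "(\<lambda>y. dircoef p (f y) (g y) i) \<in> borel_measurable M"
    unfolding dircoef_def by simp
qed

lemma solid_angle_simplex:
  assumes det: "det (edge_matrix p x) \<noteq> 0" and i: "i \<in> {0..CARD('n)}"
  shows "solid_angle (x i) (convex hull (x ` {0..CARD('n)})) =
    measure (uniform_measure lborel (cball 0 1))
      {v. \<forall>j\<in>{0..CARD('n)} - {i}. 0 \<le> dircoef p x v j * det (edge_matrix p x)}"
proof -
  have [measurable]: "(\<lambda>v. dircoef p x v j) \<in> borel_measurable borel" if "j \<in> {0..CARD('n)} - {i}" for j
    by (rule measurable_dircoef(1)) (use that in auto)
  show ?thesis
    unfolding solid_angle_def simplex_cone_iff[OF det i]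
    by (rule measure_uniform_sphere_homogeneous)
      (simp_all add: dircoef_scale mult.assoc zero_le_mult_iff)
qed

text \<open>A set inside a hyperplane with normal w is met only in directions orthogonal to w, and
  these form a null set.\<close>

lemma solid_angle_degenerate:
  fixes P :: "(real^'n) set"
  assumes w: "w \<noteq> 0" and P: "\<And>y z. y \<in> P \<Longrightarrow> z \<in> P \<Longrightarrow> w \<bullet> (y - z) = 0" and y: "y \<in> P"
  shows "solid_angle y P = 0"
proof -
  let ?S = "{u. \<exists>\<epsilon>>0. y + \<epsilon> *\<^sub>R u \<in> P}" and ?H = "{u. w \<bullet> u = 0}"
  have sub: "?S \<subseteq> ?H"
  proof safe
    fix u and \<epsilon> :: real assume "\<epsilon> > 0" "y + \<epsilon> *\<^sub>R u \<in> P"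
    then show "w \<bullet> u = 0" using P[of "y + \<epsilon> *\<^sub>R u" y] y by simp
  qed
  have H: "?H \<in> sets borel" by (simp add: closed_hyperplane)
  have "emeasure lborel ?H = 0"
    using negligible_hyperplane[of w 0] w H by (simp add: negligible_iff_emeasure0 )
  then have "emeasure (uniform_measure lborel (cball 0 1)) ?H = 0"
    using H emeasure_mono[of "cball 0 1 \<inter> ?H" ?H lborel] by simp
  then have "measure (uniform_measure lborel (cball 0 1)) ?H = 0"
    by (simp only: measure_def enn2real_0)
  then have "measure uniform_sphere ?H = 0"
    by (subst measure_uniform_sphere_homogeneous) auto
  interpret S: prob_space "uniform_sphere :: (real^'n) measure" by (rule prob_space_uniform_sphere)
  have "measure uniform_sphere ?S \<le> measure uniform_sphere ?H"
    by (rule S.finite_measure_mono[OF sub]) (simp add: uniform_sphere_def H)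
  then show ?thesis using \<open>measure uniform_sphere ?H = 0\<close> by (simp add: solid_angle_def order.antisym)
qed

text \<open>Degenerate configurations are included with value 0, so the angle sum has an explicit
  formula at every x and its measurability can be read off without exceptional sets.\<close>

lemma vertex_angle_sum_simplex:
  "vertex_angle_sum (convex hull (x ` {0..CARD('n)})) =
    (if det (edge_matrix p x) = 0 then 0 else
     \<Sum>i\<in>{0..CARD('n)}. measure (uniform_measure lborel (cball 0 1))
      {v. \<forall>j\<in>{0..CARD('n)} - {i}. 0 \<le> dircoef p x v j * det (edge_matrix p x)})"
proof (cases "det (edge_matrix p x) = 0")
  case True
  have "\<not> invertible (edge_matrix p x)" using True by (simp add: invertible_det_nz)
  then have "\<not> (\<exists>B. B ** edge_matrix p x = mat 1)" by (simp add: invertible_left_inverse)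
  \<comment> \<open>A kernel vector of the edge matrix is orthogonal to every edge, so all points
    lie in one hyperplane with normal w.\<close>
  then obtain w where w: "w \<noteq> 0" "edge_matrix p x *v w = 0"
    by (auto simp: matrix_left_invertible_ker)
  have "w \<bullet> x i = w \<bullet> x 0" if "i \<in> {0..CARD('n)}" for i
  proof -
    have "w \<bullet> (x (p j) - x 0) = 0" for j
    proof -
      have "(edge_matrix p x *v w) $ j = 0" by (simp add: w)
      then show ?thesis by (simp add: edge_matrix_def matrix_vector_mul_component inner_commute)
    qed
    then show ?thesis using that by (auto simp: index_set inner_diff_right)
  qed
  then have "x ` {0..CARD('n)} \<subseteq> {y. w \<bullet> y = w \<bullet> x 0}"
    by blast
  then have sub: "convex hull (x ` {0..CARD('n)}) \<subseteq> {y. w \<bullet> y = w \<bullet> x 0}"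
    by (rule hull_minimal) (rule convex_hyperplane)
  have "solid_angle y (convex hull (x ` {0..CARD('n)})) = 0" if "y \<in> convex hull (x ` {0..CARD('n)})" for y
  proof (rule solid_angle_degenerate[OF w(1) _ that])
    fix a b assume "a \<in> convex hull (x ` {0..CARD('n)})" "b \<in> convex hull (x ` {0..CARD('n)})"
    then have "w \<bullet> a = w \<bullet> x 0" "w \<bullet> b = w \<bullet> x 0" using sub by blast+
    then show "w \<bullet> (a - b) = 0" by (simp add: inner_diff_right)
  qed
  then show ?thesis
    using True by (auto simp: vertex_angle_sum_def extreme_point_of_def intro!: sum.neutral)
next
  case False
  have "{y. y extreme_point_of (convex hull (x ` {0..CARD('n)}))} = x ` {0..CARD('n)}"
    using extreme_point_of_convex_hull_affine_independent[OF simplex_affine_independent[OF False]] by auto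
  then show ?thesis
    using False by (simp add: vertex_angle_sum_def sum.reindex[OF simplex_inj[OF False]] solid_angle_simplex)
qed

end

abbreviation weight :: "nat \<Rightarrow> real \<Rightarrow> ennreal" where
  "weight m h \<equiv> ennreal (indicator {-1<..<1} h * sqrt (1 - h\<^sup>2) ^ m)"

text \<open>This is 8 times the integral of (1 - t^2)^(3/2) from 0 to h. Its increase over [-1, 1]
  is 3 pi, so dividing by 3 pi gives the mass of the 4-ball between the heights 0 and h.\<close>

abbreviation cap_excess :: "real \<Rightarrow> real" where
  "cap_excess h \<equiv> h * (5 - 2 * h\<^sup>2) * sqrt (1 - h\<^sup>2) + 3 * arcsin h"

subsection \<open>Isometries and the uniform distribution on the ball\<close>

text \<open>Uniqueness of Haar measure by double counting: the integral of 1_C(x) 1_B(x + y) against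
  \<open>lborel\<close> in x and \<mu> in y is computed in both orders. The unit ball C, on which
  both measures agree, fixes the constant.\<close>

lemma translation_invariant_eq_lborel:
  fixes \<mu> :: "'a::euclidean_space measure"
  assumes "sigma_finite_measure \<mu>" and sets[measurable_cong]: "sets \<mu> = sets borel"
    and trans: "\<And>t A. A \<in> sets borel \<Longrightarrow> emeasure \<mu> {x. t + x \<in> A} = emeasure \<mu> A"
    and ball: "emeasure \<mu> (cball 0 1) = emeasure lborel (cball (0::'a) 1)"
  shows "\<mu> = lborel"
proof (rule measure_eqI)
  interpret \<mu>: sigma_finite_measure \<mu> by fact
  interpret pair_sigma_finite lborel \<mu> ..
  fix B assume "B \<in> sets \<mu>"
  then have B[measurable]: "B \<in> sets borel" by (simp add: sets)
  let ?C = "cball (0::'a) 1"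
  have C[measurable]: "?C \<in> sets borel" by simp
  have S: "sets (lborel \<Otimes>\<^sub>M \<mu>) = sets (borel \<Otimes>\<^sub>M (borel :: 'a measure))"
    by (intro sets_pair_measure_cong) (simp_all add: sets)
  have [simp]: "space \<mu> = UNIV" using sets_eq_imp_space_eq[OF sets] by simp
  have ind: "(\<integral>\<^sup>+ y. indicator A (t + y) \<partial>\<mu>) = emeasure \<mu> A" if [measurable]: "A \<in> sets borel" for A t
  proof -
    have "(\<integral>\<^sup>+ y. indicator A (t + y) \<partial>\<mu>) = (\<integral>\<^sup>+ y. indicator {x. t + x \<in> A} y \<partial>\<mu>)"
      by (intro nn_integral_cong) (auto simp: indicator_def)
    also have "\<dots> = emeasure \<mu> {x. t + x \<in> A}"
      by (rule nn_integral_indicator) (simp add: sets)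
    finally show ?thesis by (simp add: trans)
  qed
  have "emeasure lborel ?C * emeasure \<mu> B = (\<integral>\<^sup>+ x. indicator ?C x * emeasure \<mu> B \<partial>lborel)"
    by (subst nn_integral_multc) (auto intro!: borel_measurable_indicator)
  also have "\<dots> = (\<integral>\<^sup>+ x. \<integral>\<^sup>+ y. indicator ?C x * indicator B (x + y) \<partial>\<mu> \<partial>lborel)"
    by (subst nn_integral_cmult) (simp_all add: ind)
  also have "\<dots> = (\<integral>\<^sup>+ y. \<integral>\<^sup>+ x. indicator ?C x * indicator B (x + y) \<partial>lborel \<partial>\<mu>)"
    by (rule Fubini'[symmetric]) (subst measurable_cong_sets[OF S refl], measurable)
  also have "\<dots> = (\<integral>\<^sup>+ y. \<integral>\<^sup>+ x. indicator ?C (x - y) * indicator B x \<partial>lborel \<partial>\<mu>)"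
  proof (rule nn_integral_cong)
    fix y
    have "(\<integral>\<^sup>+ x. indicator ?C x * indicator B (x + y) \<partial>lborel)
      = (\<integral>\<^sup>+ x. indicator ?C x * indicator B (x + y) \<partial>distr lborel borel ((+) (-y)))"
      by (simp add: lborel_distr_plus)
    also have "\<dots> = (\<integral>\<^sup>+ x. indicator ?C (x - y) * indicator B x \<partial>lborel)"
      by (subst nn_integral_distr) auto
    finally show "(\<integral>\<^sup>+ x. indicator ?C x * indicator B (x + y) \<partial>lborel)
      = (\<integral>\<^sup>+ x. indicator ?C (x - y) * indicator B x \<partial>lborel)" .
  qed
  also have "\<dots> = (\<integral>\<^sup>+ x. \<integral>\<^sup>+ y. indicator ?C (x - y) * indicator B x \<partial>\<mu> \<partial>lborel)"
    by (rule Fubini') (subst measurable_cong_sets[OF S refl], measurable)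
  \<comment> \<open>The ball is symmetric, so x - y may be replaced by - x + y; now y is translated
    and the invariance of \<mu> applies once more.\<close>
  also have "\<dots> = (\<integral>\<^sup>+ x. \<integral>\<^sup>+ y. indicator B x * indicator ?C (- x + y) \<partial>\<mu> \<partial>lborel)"
    by (intro nn_integral_cong) (auto simp: indicator_def norm_minus_commute)
  also have "\<dots> = (\<integral>\<^sup>+ x. indicator B x * emeasure \<mu> ?C \<partial>lborel)"
    by (intro nn_integral_cong, subst nn_integral_cmult) (simp_all add: ind[OF C] del: uminus_add_conv_diff)
  also have "\<dots> = emeasure lborel B * emeasure \<mu> ?C"
    by (subst nn_integral_multc) simp_all
  finally have "emeasure lborel ?C * emeasure \<mu> B = emeasure lborel ?C * emeasure lborel B"
    by (simp add: ball mult.commute)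
  then show "emeasure \<mu> B = emeasure lborel B"
    using emeasure_cball_unit[where 'a='a] by (simp add: ennreal_mult_cancel_left)
qed (simp add: sets)

lemma borel_measurable_linear:
  fixes g :: "'c::euclidean_space \<Rightarrow> 'a::euclidean_space"
  shows "linear g \<Longrightarrow> g \<in> borel_measurable borel"
  by (simp add: linear_continuous_on linear_conv_bounded_linear borel_measurable_continuous_onI)

text \<open>An isometry is onto by equality of dimensions, so every translation of the target comes
  from one of the source, and balls correspond to balls. This carries Lebesgue measure between
  different types of equal dimension, such as \<open>real^'n\<close> and nested products, and
  permits regrouping of tuples.\<close>

lemma distr_lborel_isometry:
  fixes g :: "'c::euclidean_space \<Rightarrow> 'a::euclidean_space"
  assumes lin: "linear g" and iso: "\<And>x. norm (g x) = norm x" and dim: "DIM('c) = DIM('a)"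
  shows "distr lborel borel g = lborel"
proof (rule translation_invariant_eq_lborel)
  have inj: "inj g"
    using lin iso by (metis linear_injective_0 norm_eq_zero)
  then have surj: "surj g"
    using lin dim by (metis dim_UNIV linear_surjective_imp_injective dim_image_eq dim_eq_full inj_on_subset subset_UNIV
       linear_span_image span_UNIV)
  have [measurable]: "g \<in> borel_measurable borel"
    by (rule borel_measurable_linear[OF lin])
  have ball: "g -` cball 0 r = cball 0 r" for r by (auto simp: iso)
  show "sigma_finite_measure (distr lborel borel g)"
  proof
    have "cball (0::'a) (real n) \<in> sets borel" for n by simp
    then have "emeasure (distr lborel borel g) (cball 0 (real n)) \<noteq> \<infinity>" for n
      using emeasure_lborel_cball_finite[of "0::'c" "real n"] by (simp add: emeasure_distr ball)
    moreover have "\<Union> (range (\<lambda>n. cball (0::'a) (real n))) = UNIV"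
      by (auto intro: real_arch_simple)
    ultimately show "\<exists>A. countable A \<and> A \<subseteq> sets (distr lborel borel g) \<and> \<Union> A = space (distr lborel borel g)
        \<and> (\<forall>a\<in>A. emeasure (distr lborel borel g) a \<noteq> \<infinity>)"
      by (intro exI[of _ "range (\<lambda>n. cball 0 (real n))"]) auto
  qed
  show "emeasure (distr lborel borel g) (cball 0 1) = emeasure lborel (cball (0::'a) 1)"
    by (simp add: emeasure_distr ball emeasure_cball dim)
  fix t and A :: "'a set" assume [measurable]: "A \<in> sets borel"
  obtain s where s: "t = g s" using surj by (metis surjD)
  have "emeasure (distr lborel borel g) {x. t + x \<in> A} = emeasure lborel {x. t + g x \<in> A}"
    by (subst emeasure_distr) (auto simp: vimage_def)
  also have "\<dots> = emeasure lborel ((+) s -` (g -` A))"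
    by (simp add: s linear_add[OF lin] vimage_def)
  also have "\<dots> = emeasure (distr lborel borel ((+) s)) (g -` A)"
    by (subst emeasure_distr) (auto intro!: measurable_sets_borel[of g borel])
  also have "\<dots> = emeasure (distr lborel borel g) A"
    by (simp add: lborel_distr_plus emeasure_distr)
  finally show "emeasure (distr lborel borel g) {x. t + x \<in> A} = emeasure (distr lborel borel g) A" .
qed simp

text \<open>The Householder reflection along u - v exchanges two vectors of equal norm.\<close>

lemma reflection_exists:
  fixes u v :: "'a::euclidean_space"
  assumes uv: "norm u = norm v"
  obtains h :: "'a \<Rightarrow> 'a" where "linear h" "\<And>x. norm (h x) = norm x" "h u = v"
proof (cases "u = v")
  case True
  then show ?thesis using that[of id] by (simp add: linear_id)
next
  case False
  define w where "w = u - v"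
  define h where "h x = x - (2 * (x \<bullet> w) / (w \<bullet> w)) *\<^sub>R w" for x
  have w: "w \<bullet> w \<noteq> 0" using False by (simp add: w_def)
  have "linear h"
    by (rule linearI) (simp_all add: h_def inner_simps algebra_simps add_divide_distrib)
  moreover have "norm (h x) = norm x" for x
  proof -
    have "h x \<bullet> h x = x \<bullet> x"
      using w by (simp add: h_def inner_simps field_simps inner_commute power2_eq_square)
    then show ?thesis by (simp add: norm_eq_sqrt_inner)
  qed
  moreover have "h u = v"
  proof -
    have "u \<bullet> u = v \<bullet> v" using uv by (simp add: norm_eq)
    then have "2 * (u \<bullet> w) = w \<bullet> w" by (simp add: w_def inner_simps inner_commute)
    then show ?thesis using w by (simp add: h_def w_def)
  qed
  ultimately show ?thesis using that by blast
qed

text \<open>Any isometry between the two spaces is corrected by a reflection that moves the image of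
  u to v.\<close>

lemma isometry_exists:
  fixes u :: "'c::euclidean_space" and v :: "'a::euclidean_space"
  assumes dim: "DIM('c) = DIM('a)" and uv: "norm u = norm v"
  obtains g :: "'c \<Rightarrow> 'a" where "linear g" "\<And>x. norm (g x) = norm x" "surj g" "g u = v"
proof -
  obtain f :: "'c \<Rightarrow> 'a" and f' where f: "linear f" "\<And>x. norm (f x) = norm x" "range f = UNIV"
    using isometries_subspaces[of "UNIV :: 'c set" "UNIV :: 'a set"] dim by (metis dim_UNIV subspace_UNIV UNIV_I)
  obtain h :: "'a \<Rightarrow> 'a" where h: "linear h" "\<And>x. norm (h x) = norm x" "h (f u) = v"
    using reflection_exists[of "f u" v] uv f(2) by metis
  have "inj h" using h(1,2) by (metis linear_injective_0 norm_eq_zero)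
  then have "surj h" using h(1) linear_injective_imp_surjective by blast
  show ?thesis
  proof (rule that[of "h \<circ> f"])
    show "linear (h \<circ> f)" using f(1) h(1) linear_compose by blast
    show "surj (h \<circ> f)" using \<open>surj h\<close> f(3) comp_surj by blast
  qed (simp_all add: f h)
qed

lemma distr_uniform_ball_isometry:
  fixes g :: "'c::euclidean_space \<Rightarrow> 'a::euclidean_space"
  assumes lin: "linear g" and iso: "\<And>x. norm (g x) = norm x" and dim: "DIM('c) = DIM('a)"
  shows "distr (uniform_measure lborel (cball 0 1)) borel g = uniform_measure lborel (cball 0 1)"
proof (rule measure_eqI)
  have [measurable]: "g \<in> borel_measurable borel"
    by (rule borel_measurable_linear[OF lin])
  have d: "distr lborel borel g = lborel" by (rule distr_lborel_isometry[OF assms])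
  fix A assume "A \<in> sets (distr (uniform_measure lborel (cball 0 1)) borel g)"
  then have [measurable]: "A \<in> sets borel" by simp
  have [simp]: "g -` A \<in> sets borel" by (auto intro!: measurable_sets_borel[of g borel])
  have b: "cball 0 1 \<inter> g -` A = g -` (cball 0 1 \<inter> A)" by (auto simp: iso)
  have "emeasure lborel (cball 0 1 \<inter> g -` A) = emeasure (distr lborel borel g) (cball 0 1 \<inter> A)"
    by (simp add: emeasure_distr b)
  then show "emeasure (distr (uniform_measure lborel (cball 0 1)) borel g) A = emeasure (uniform_measure lborel (cball 0 1)) A"
    by (simp add: emeasure_distr d emeasure_cball dim)
qed simp

section \<open>Uniform points of the ball in the coordinates (z, x, w)\<close>

type_synonym 'b coords = "real \<times> 'b \<times> real"

abbreviation unif_ball :: "'a::euclidean_space measure" where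
  "unif_ball \<equiv> uniform_measure lborel (cball 0 1)"

lemma borel_measurable_fst_snd [measurable]:
  "fst \<in> borel_measurable (borel :: ('a::topological_space \<times> 'b::topological_space) measure)"
  "snd \<in> borel_measurable (borel :: ('a::topological_space \<times> 'b::topological_space) measure)"
  by (auto intro!: borel_measurable_continuous_onI continuous_intros)

lemma nn_integral_lborel_pair:
  fixes f :: "'a::euclidean_space \<times> 'b::euclidean_space \<Rightarrow> ennreal"
  assumes [measurable]: "f \<in> borel_measurable borel"
  shows "(\<integral>\<^sup>+y. f y \<partial>lborel) = (\<integral>\<^sup>+x. \<integral>\<^sup>+y. f (x, y) \<partial>lborel \<partial>lborel)"
proof -
  have "f \<in> borel_measurable (lborel \<Otimes>\<^sub>M lborel)" by (simp add: lborel_prod)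
  from lborel.nn_integral_fst[OF this] show ?thesis by (simp add: lborel_prod)
qed

text \<open>Half the length of the chord of the unit ball over \<open>t\<close>. Since \<open>sqrt\<close> is odd, the argument of
  \<open>ennreal\<close> is negative and the value \<open>0\<close> when \<open>t\<close> is outside the ball.\<close>

definition slab :: "real \<times> 'b::euclidean_space \<Rightarrow> ennreal" where
  "slab t = ennreal (sqrt (1 - (norm t)\<^sup>2))"

lemma slab_measurable [measurable]: "slab \<in> borel_measurable borel"
  unfolding slab_def[abs_def] by measurable

text \<open>Integrating out w leaves the chord of the ball above (z, x), whose length is twice
  \<open>slab\<close>.\<close>

lemma nn_integral_uniform_slab:
  fixes f :: "real \<times> 'b::euclidean_space \<Rightarrow> ennreal"
  assumes [measurable]: "f \<in> borel_measurable borel"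
  shows "(\<integral>\<^sup>+y. f (fst y, fst (snd y)) \<partial>(unif_ball :: ('b coords) measure)) =
     2 / emeasure lborel (cball 0 1 :: ('b coords) set) * (\<integral>\<^sup>+t. f t * slab t \<partial>lborel)"
proof -
  let ?B = "cball 0 1 :: ('b coords) set"
  \<comment> \<open>When (z, x) has norm greater than 1 the square root is negative and the interval
    is empty.\<close>
  have ind: "indicator ?B (z, x, w) = (indicator {- sqrt (1 - (norm (z, x))\<^sup>2) .. sqrt (1 - (norm (z, x))\<^sup>2)} w :: ennreal)"
    for z w :: real and x :: 'b
  proof -
    have "norm (z, x, w) \<le> 1 \<longleftrightarrow> w\<^sup>2 \<le> 1 - (norm (z, x))\<^sup>2"
      by (simp add: norm_prod_def algebra_simps)
    also have "\<dots> \<longleftrightarrow> \<bar>w\<bar> \<le> sqrt (1 - (norm (z, x))\<^sup>2)"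
      by (metis real_sqrt_abs real_sqrt_le_iff)
    finally show ?thesis by (auto simp: indicator_def abs_le_iff)
  qed
  have inner: "(\<integral>\<^sup>+w. indicator ?B (z, x, w) \<partial>lborel) = 2 * slab (z, x)" for z :: real and x :: 'b
  proof (cases "sqrt (1 - (norm (z, x))\<^sup>2) \<ge> 0")
    case True
    then show ?thesis
      by (simp add: ind slab_def) (simp add: ennreal_mult'[symmetric] flip: ennreal_numeral)
  next
    case False
    then show ?thesis by (simp add: ind slab_def ennreal_neg)
  qed
  have "(\<integral>\<^sup>+y. f (fst y, fst (snd y)) * indicator ?B y \<partial>lborel)
    = (\<integral>\<^sup>+z. \<integral>\<^sup>+u. f (z, fst u) * indicator ?B (z, u) \<partial>lborel \<partial>lborel)"
    by (subst nn_integral_lborel_pair) (measurable, simp_all)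
  also have "\<dots> = (\<integral>\<^sup>+z. \<integral>\<^sup>+x. \<integral>\<^sup>+w. f (z, x) * indicator ?B (z, x, w) \<partial>lborel \<partial>lborel \<partial>lborel)"
    by (rule nn_integral_cong, subst nn_integral_lborel_pair) (measurable, simp_all)
  also have "\<dots> = (\<integral>\<^sup>+z. \<integral>\<^sup>+x. 2 * (f (z, x) * slab (z, x)) \<partial>lborel \<partial>lborel)"
    by (intro nn_integral_cong, subst nn_integral_cmult) (measurable, simp_all add: inner mult_ac)
  also have "\<dots> = (\<integral>\<^sup>+t. 2 * (f t * slab t) \<partial>lborel)"
    by (subst nn_integral_lborel_pair) simp_all
  also have "\<dots> = 2 * (\<integral>\<^sup>+t. f t * slab t \<partial>lborel)"
    by (rule nn_integral_cmult) simp
  finally show ?thesis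
    by (subst nn_integral_uniform_measure) (measurable, simp_all add: divide_ennreal_def mult_ac)
qed

lemma isometry_inner:
  assumes "linear g" "\<And>x. norm (g x) = norm x"
  shows "g x \<bullet> g y = x \<bullet> y"
  using assms by (simp add: dot_norm linear_add[symmetric])

lemma nn_integral_lborel_scale:
  fixes f :: "'a::euclidean_space \<Rightarrow> ennreal"
  assumes [measurable]: "f \<in> borel_measurable borel" and r: "r > 0"
  shows "(\<integral>\<^sup>+x. f x \<partial>lborel) = ennreal (r ^ DIM('a)) * (\<integral>\<^sup>+x. f (t + r *\<^sub>R x) \<partial>lborel)"
  using r by (subst lborel_affine[of r t])
     (simp_all add: nn_integral_density nn_integral_distr nn_integral_cmult ennreal_power)

text \<open>The hyperplane z = a . x + b has squared distance b^2 / (1 + a . a) from the origin, so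
  here it misses the open ball. The estimate is Cauchy-Schwarz for the normal (1, -a), written out
  in coordinates.\<close>

lemma slab_section_eq_0:
  assumes "1 + a \<bullet> a \<le> b\<^sup>2"
  shows "slab (a \<bullet> x + b, x) = 0"
proof -
  have "b\<^sup>2 \<le> (1 + a \<bullet> a) * ((a \<bullet> x + b)\<^sup>2 + x \<bullet> x)"
  proof -
    have cs: "(a \<bullet> x)\<^sup>2 \<le> (a \<bullet> a) * (x \<bullet> x)" by (rule Cauchy_Schwarz_ineq)
    let ?c = "a \<bullet> x + b"
    have "b\<^sup>2 = ?c\<^sup>2 - 2 * ?c * (a \<bullet> x) + (a \<bullet> x)\<^sup>2" by (simp add: power2_eq_square algebra_simps)
    also have "\<dots> \<le> ?c\<^sup>2 + ((a \<bullet> a) * ?c\<^sup>2 + x \<bullet> x) + (a \<bullet> a) * (x \<bullet> x)"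
    proof -
      have "0 \<le> (?c *\<^sub>R a + x) \<bullet> (?c *\<^sub>R a + x)" by simp
      also have "\<dots> = (a \<bullet> a) * ?c\<^sup>2 + 2 * ?c * (a \<bullet> x) + x \<bullet> x"
        by (simp add: inner_add inner_commute power2_eq_square algebra_simps)
      finally show ?thesis using cs by linarith
    qed
    also have "\<dots> = (1 + a \<bullet> a) * (?c\<^sup>2 + x \<bullet> x)" by (simp add: algebra_simps)
    finally show ?thesis .
  qed
  then have "(1 + a \<bullet> a) * 1 \<le> (1 + a \<bullet> a) * ((a \<bullet> x + b)\<^sup>2 + x \<bullet> x)"
    using assms by simp
  then have "1 \<le> (a \<bullet> x + b)\<^sup>2 + x \<bullet> x"
    by (rule mult_left_le_imp_le) (simp add: add_pos_nonneg)
  then show ?thesis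
    by (simp add: slab_def norm_prod_def dot_square_norm ennreal_neg)
qed

text \<open>The foot of the perpendicular from the origin to the hyperplane is b / (1 + a . a) times
  (1, -a); its x-part is the centre of the substitution. By Pythagoras the section is a ball of
  radius r around the foot, and half-chords over it shrink by r.\<close>

lemma slab_section_scale:
  fixes a x :: "'b::euclidean_space"
  assumes b: "b\<^sup>2 < 1 + a \<bullet> a"
  defines "r \<equiv> sqrt (1 - b\<^sup>2 / (1 + a \<bullet> a))"
  shows "slab (a \<bullet> (- (b / (1 + a \<bullet> a)) *\<^sub>R a + r *\<^sub>R x) + b, - (b / (1 + a \<bullet> a)) *\<^sub>R a + r *\<^sub>R x)
     = ennreal r * slab (a \<bullet> x, x)" and "r > 0"
proof -
  define q where "q = 1 + a \<bullet> a"
  have q: "q > 0" by (simp add: q_def add_pos_nonneg)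
  have aa: "a \<bullet> a = q - 1" by (simp add: q_def)
  have pos: "1 - b\<^sup>2 / q > 0" using b q by (simp add: q_def[symmetric])
  then show r: "r > 0" by (simp add: r_def q_def)
  have r2: "r\<^sup>2 = 1 - b\<^sup>2 / q" using pos by (simp add: r_def q_def)
  let ?y = "- (b / q) *\<^sub>R a + r *\<^sub>R x"
  have ay: "a \<bullet> ?y + b = b / q + r * (a \<bullet> x)"
    using q by (simp add: inner_add_right inner_diff_right aa) (simp add: field_simps)
  have "(c *\<^sub>R a + r *\<^sub>R x) \<bullet> (c *\<^sub>R a + r *\<^sub>R x) = c\<^sup>2 * (q - 1) + 2 * c * r * (a \<bullet> x) + r\<^sup>2 * (x \<bullet> x)" for c
    by (simp add: inner_add inner_commute aa power2_eq_square algebra_simps)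
  from this[of "- (b / q)"] have yy: "?y \<bullet> ?y = (b / q)\<^sup>2 * (q - 1) - 2 * (b / q) * r * (a \<bullet> x) + r\<^sup>2 * (x \<bullet> x)"
    by (simp only: power2_minus mult_minus_left mult_minus_right add_uminus_conv_diff)
  \<comment> \<open>Pythagoras: the mixed terms cancel because the displacement within the
    hyperplane is orthogonal to the foot.\<close>
  have "(a \<bullet> ?y + b)\<^sup>2 + ?y \<bullet> ?y = (b / q)\<^sup>2 * q + r\<^sup>2 * ((a \<bullet> x)\<^sup>2 + x \<bullet> x)"
  proof -
    have "(c + r * t)\<^sup>2 + (c\<^sup>2 * (q - 1) - 2 * c * r * t + r\<^sup>2 * y) = c\<^sup>2 * q + r\<^sup>2 * (t\<^sup>2 + y)" for c t y
      by (simp add: power2_eq_square algebra_simps)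
    then show ?thesis unfolding ay yy .
  qed
  also have "(b / q)\<^sup>2 * q = 1 - r\<^sup>2" unfolding r2 using q by (simp add: power2_eq_square field_simps)
  finally have "1 - ((a \<bullet> ?y + b)\<^sup>2 + ?y \<bullet> ?y) = r\<^sup>2 * (1 - ((a \<bullet> x)\<^sup>2 + x \<bullet> x))"
    by (simp add: algebra_simps)
  then have "slab (a \<bullet> ?y + b, ?y) = ennreal (sqrt (r\<^sup>2 * (1 - ((a \<bullet> x)\<^sup>2 + x \<bullet> x))))"
    by (simp add: slab_def norm_prod_def dot_square_norm)
  also have "\<dots> = ennreal (r * sqrt (1 - ((a \<bullet> x)\<^sup>2 + x \<bullet> x)))"
    using r by (simp add: real_sqrt_mult)
  also have "\<dots> = ennreal r * slab (a \<bullet> x, x)"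
    using r by (simp add: slab_def norm_prod_def dot_square_norm ennreal_mult')
  finally show "slab (a \<bullet> (- (b / (1 + a \<bullet> a)) *\<^sub>R a + r *\<^sub>R x) + b, - (b / (1 + a \<bullet> a)) *\<^sub>R a + r *\<^sub>R x)
     = ennreal r * slab (a \<bullet> x, x)" by (simp add: q_def)
qed

lemma AE_unif_ballI:
  assumes "Measurable.pred borel P" "AE y in lborel. y \<in> cball 0 1 \<longrightarrow> P y"
  shows "AE y in unif_ball. P (y :: 'a::euclidean_space)"
  using assms emeasure_cball_unit[where 'a='a]
  by (subst AE_uniform_measure) (auto simp: top.not_eq_extremum)

lemma emeasure_halfspace_rotate:
  fixes \<nu> \<nu>' :: "'a::euclidean_space"
  assumes "norm \<nu> = norm \<nu>'"
  shows "emeasure unif_ball {y. \<nu> \<bullet> y > h} = emeasure unif_ball {y. \<nu>' \<bullet> y > h}"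
proof -
  obtain g :: "'a \<Rightarrow> 'a" where g: "linear g" "\<And>x. norm (g x) = norm x" "g \<nu>' = \<nu>"
    using isometry_exists[of \<nu>' \<nu>] assms by auto
  have [measurable]: "g \<in> borel_measurable borel"
    by (rule borel_measurable_linear[OF g(1)])
  have "emeasure unif_ball {y. \<nu> \<bullet> y > h} = emeasure (distr unif_ball borel g) {y. \<nu> \<bullet> y > h}"
    using distr_uniform_ball_isometry[OF g(1,2)] by simp
  also have "\<dots> = emeasure unif_ball {y. \<nu> \<bullet> g y > h}"
    by (subst emeasure_distr) (simp_all add: vimage_def)
  also have "\<dots> = emeasure unif_ball {y. \<nu>' \<bullet> y > h}"
    using isometry_inner[OF g(1,2), of \<nu>'] by (simp add: g(3))
  finally show ?thesis .
qed

text \<open>After rotating the normal to the first axis, the slice at height z is a ball of radius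
  sqrt (1 - z^2) in dimension \<open>DIM('b) + 1\<close>, one less than that of the space.\<close>

lemma emeasure_halfspace_unif_ball:
  fixes \<nu> :: "'b::euclidean_space coords"
  assumes \<nu>: "norm \<nu> = 1" and h: "-1 \<le> h" "h \<le> 1"
  shows "emeasure unif_ball {y. \<nu> \<bullet> y > h} =
     ennreal (unit_ball_vol (DIM('b) + 1)) / emeasure lborel (cball 0 1 :: ('b coords) set) *
     (\<integral>\<^sup>+z. ennreal (indicator {h<..<1} z * sqrt (1 - z\<^sup>2) ^ (DIM('b) + 1)) \<partial>lborel)"
proof -
  let ?e = "(1, 0) :: 'b coords"
  let ?B = "cball 0 1 :: ('b coords) set"
  have "emeasure unif_ball {y. \<nu> \<bullet> y > h} = emeasure unif_ball {y :: 'b coords. fst y > h}"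
    using emeasure_halfspace_rotate[of \<nu> ?e h] \<nu> by (simp add: inner_prod_def)
  also have "\<dots> = emeasure lborel (?B \<inter> {y. fst y > h}) / emeasure lborel ?B"
    by (rule emeasure_uniform_measure) simp_all
  also have "emeasure lborel (?B \<inter> {y. fst y > h}) = (\<integral>\<^sup>+y. indicator (?B \<inter> {y. fst y > h}) y \<partial>lborel)"
    by simp
  also have "\<dots> = (\<integral>\<^sup>+z. \<integral>\<^sup>+u. indicator (?B \<inter> {y. fst y > h}) (z, u) \<partial>lborel \<partial>lborel)"
    by (subst nn_integral_lborel_pair) (measurable, simp_all)
  also have "\<dots> = (\<integral>\<^sup>+z. ennreal (unit_ball_vol (DIM('b) + 1)) *
       ennreal (indicator {h<..<1} z * sqrt (1 - z\<^sup>2) ^ (DIM('b) + 1)) \<partial>lborel)"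
  proof (rule nn_integral_cong)
    fix z :: real
    show "(\<integral>\<^sup>+u. indicator (?B \<inter> {y. fst y > h}) (z, u) \<partial>lborel) =
      ennreal (unit_ball_vol (DIM('b) + 1)) * ennreal (indicator {h<..<1} z * sqrt (1 - z\<^sup>2) ^ (DIM('b) + 1))"
    proof (cases "h < z \<and> z \<le> 1")
      case True
      then have z: "\<bar>z\<bar> \<le> 1" using h by auto
      then have z2: "0 \<le> sqrt (1 - z\<^sup>2)" using abs_square_le_1[of z] by simp
      have "norm (z, u) \<le> 1 \<longleftrightarrow> norm u \<le> sqrt (1 - z\<^sup>2)" for u :: "'b \<times> real"
      proof -
        have "norm (z, u) \<le> 1 \<longleftrightarrow> (norm u)\<^sup>2 \<le> 1 - z\<^sup>2"
          by (simp add: norm_prod_def algebra_simps)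
        also have "\<dots> \<longleftrightarrow> norm u \<le> sqrt (1 - z\<^sup>2)"
          by (metis real_sqrt_abs real_sqrt_le_iff abs_norm_cancel)
        finally show ?thesis .
      qed
      then have "(\<lambda>u. indicator (?B \<inter> {y. fst y > h}) (z, u) :: ennreal) = indicator (cball 0 (sqrt (1 - z\<^sup>2)))"
        using True by (auto simp: fun_eq_iff indicator_def)
      then have "(\<integral>\<^sup>+u. indicator (?B \<inter> {y. fst y > h}) (z, u) \<partial>lborel) = emeasure lborel (cball (0 :: 'b \<times> real) (sqrt (1 - z\<^sup>2)))"
        by simp
      also have "\<dots> = ennreal (unit_ball_vol (DIM('b) + 1) * sqrt (1 - z\<^sup>2) ^ (DIM('b) + 1))"
        by (subst emeasure_cball[OF z2]) (simp add: add.commute)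
      \<comment> \<open>At z = 1 the slice has radius 0, which agrees with the open upper end of the
        indicator.\<close>
      finally show ?thesis using True z2
        by (cases "z = 1") (simp_all add: ennreal_mult)
    next
      case False
      then have "(\<lambda>u. indicator (?B \<inter> {y. fst y > h}) (z, u) :: ennreal) = (\<lambda>_. 0)"
        using norm_fst_le[of "(z, _)"] by (fastforce simp: fun_eq_iff indicator_def dest: order_trans[OF norm_fst_le])
      moreover have "indicator {h<..<1} z = (0::real)" using False by (auto simp: indicator_def)
      ultimately show ?thesis by (simp only: nn_integral_const mult_zero_left mult_zero_right ennreal_0)
    qed
  qed
  also have "\<dots> = ennreal (unit_ball_vol (DIM('b) + 1)) *
     (\<integral>\<^sup>+z. ennreal (indicator {h<..<1} z * sqrt (1 - z\<^sup>2) ^ (DIM('b) + 1)) \<partial>lborel)"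
    by (rule nn_integral_cmult) measurable
  finally show ?thesis by (simp add: divide_ennreal_def mult_ac)
qed

lemma nn_integral_section_height:
  fixes a :: "'b::euclidean_space" and \<phi> :: "real \<Rightarrow> ennreal"
  assumes [measurable]: "\<phi> \<in> borel_measurable borel"
  shows "(\<integral>\<^sup>+b. \<phi> (b / sqrt (1 + a \<bullet> a)) \<partial>lborel) = ennreal (sqrt (1 + a \<bullet> a)) * (\<integral>\<^sup>+h. \<phi> h \<partial>lborel)"
proof -
  have q: "sqrt (1 + a \<bullet> a) > 0" by (simp add: add_pos_nonneg)
  then show ?thesis
    by (subst nn_integral_real_affine[where t = 0 and c = "sqrt (1 + a \<bullet> a)"]) auto
qed

subsection \<open>Antiderivatives\<close>

text \<open>Differentiability is required only in the open interval, since
  \<open>sqrt (1 - x\<^sup>2)\<close> and \<open>arcsin\<close> are continuous but not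
  differentiable at the ends.\<close>

lemma nn_integral_open_interval_FTC:
  fixes f F :: "real \<Rightarrow> real"
  assumes f: "continuous_on {a<..<b} f"
    and "a \<le> b" and cont: "continuous_on {a..b} F"
    and der: "\<And>x. a < x \<Longrightarrow> x < b \<Longrightarrow> (F has_real_derivative f x) (at x)"
    and nonneg: "\<And>x. a < x \<Longrightarrow> x < b \<Longrightarrow> 0 \<le> f x"
  shows "(\<integral>\<^sup>+x. ennreal (indicator {a<..<b} x * f x) \<partial>lborel) = ennreal (F b - F a)"
proof -
  have "(f has_integral (F b - F a)) {a..b}"
    using assms(2) cont der
    by (intro fundamental_theorem_of_calculus_interior) (auto simp: has_real_derivative_iff_has_vector_derivative)
  then have "(f has_integral (F b - F a)) {a<..<b}"
    using has_integral_open_interval[of f "F b - F a" a b] by (simp add: box_real)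
  then have "((\<lambda>x. indicator {a<..<b} x * f x) has_integral (F b - F a)) UNIV"
    by (subst (asm) has_integral_restrict_UNIV[symmetric])
       (erule has_integral_eq[rotated], auto simp: indicator_def)
  moreover have "(\<lambda>x. indicator {a<..<b} x * f x) \<in> borel_measurable borel"
    using borel_measurable_continuous_on_indicator[OF _ f] by simp
  ultimately show ?thesis
    by (intro nn_integral_has_integral_lborel) (auto simp: indicator_def nonneg)
qed

lemma DERIV_sqrt_1_minus_square:
  "\<bar>x\<bar> < 1 \<Longrightarrow> ((\<lambda>x. sqrt (1 - x\<^sup>2)) has_real_derivative - x / sqrt (1 - x\<^sup>2)) (at x)"
  using abs_square_less_1[of x] by (auto intro!: derivative_eq_intros simp: field_simps)

lemma DERIV_arcsin_sqrt:
  "\<bar>x\<bar> < 1 \<Longrightarrow> (arcsin has_real_derivative 1 / sqrt (1 - x\<^sup>2)) (at x)"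
  using DERIV_arcsin[of x] by (auto simp: field_simps abs_if split: if_splits)

text \<open>With w = sqrt (1 - x^2), w has derivative -x / w and arcsin has derivative 1 / w. This
  ansatz is therefore closed: multiplied by w, its derivative is a polynomial combination of 1, w
  arcsin and arcsin^2, the shape of every integrand with a square root below, including the square
  of \<open>cap_excess\<close> times a power of w.\<close>

lemma DERIV_sqrt_arcsin_form:
  fixes P P' Q Q' R R' c :: "real \<Rightarrow> real" and e x :: real
  assumes x: "\<bar>x\<bar> < 1"
    and P: "(P has_real_derivative P' x) (at x)"
    and Q: "(Q has_real_derivative Q' x) (at x)"
    and R: "(R has_real_derivative R' x) (at x)"
  shows "((\<lambda>x. P x * sqrt (1 - x\<^sup>2) + Q x * arcsin x + R x * sqrt (1 - x\<^sup>2) * (arcsin x)\<^sup>2 + e * arcsin x ^ 3)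
    has_real_derivative
      ((P' x * (1 - x\<^sup>2) - P x * x + Q x) + (Q' x + 2 * R x) * sqrt (1 - x\<^sup>2) * arcsin x
        + (R' x * (1 - x\<^sup>2) - R x * x + 3 * e) * (arcsin x)\<^sup>2) / sqrt (1 - x\<^sup>2)) (at x)"
proof -
  define w t where "w = sqrt (1 - x\<^sup>2)" and "t = arcsin x"
  have pos: "1 - x\<^sup>2 > 0" using x by (simp add: abs_square_less_1)
  then have w: "w > 0" and w2: "1 - x\<^sup>2 = w * w" by (auto simp: w_def)
  have eq: "P' x * w + P x * (- x / w) + (Q' x * t + Q x * (1 / w))
      + ((R' x * w + R x * (- x / w)) * t\<^sup>2 + R x * w * (2 * t * (1 / w))) + e * (3 * t\<^sup>2 * (1 / w))
    = ((P' x * (w * w) - P x * x + Q x) + (Q' x + 2 * R x) * w * t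
        + (R' x * (w * w) - R x * x + 3 * e) * t\<^sup>2) / w"
    using w by (simp add: field_simps)
  note S = DERIV_sqrt_1_minus_square[OF x, folded w_def] and A = DERIV_arcsin_sqrt[OF x, folded w_def]
  have A2: "((\<lambda>x. (arcsin x)\<^sup>2) has_real_derivative 2 * t * (1 / w)) (at x)"
    and A3: "((\<lambda>x. arcsin x ^ 3) has_real_derivative 3 * t\<^sup>2 * (1 / w)) (at x)"
    using DERIV_power[OF A, of 2] DERIV_power[OF A, of 3] by (simp_all add: t_def mult_ac)
  have "((\<lambda>x. P x * sqrt (1 - x\<^sup>2) + Q x * arcsin x + R x * sqrt (1 - x\<^sup>2) * (arcsin x)\<^sup>2 + e * arcsin x ^ 3)
    has_real_derivative
      P' x * w + P x * (- x / w) + (Q' x * t + Q x * (1 / w))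
      + ((R' x * w + R x * (- x / w)) * t\<^sup>2 + R x * w * (2 * t * (1 / w))) + e * (3 * t\<^sup>2 * (1 / w))) (at x)"
    using DERIV_add[OF DERIV_add[OF DERIV_add[OF DERIV_mult[OF P S] DERIV_mult[OF Q A]]
       DERIV_mult[OF DERIV_mult[OF R S] A2]] DERIV_cmult[OF A3, of e]]
    unfolding w_def t_def by (simp only: mult.commute add.commute add.left_commute)
  then show ?thesis
    unfolding eq w2[symmetric] unfolding w_def t_def .
qed

text \<open>Encoding P, Q, R as \<open>poly\<close> reduces the verification of an antiderivative to
  three polynomial identities. In the value, the terms with the square root vanish at x = 1, where
  arcsin is pi / 2.\<close>

lemma nn_integral_sqrt_arcsin_form:
  fixes P Q R A B C :: "real poly" and f :: "real \<Rightarrow> real" and a e :: real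
  assumes cont_f: "continuous_on {- 1<..<1} f" and a: "- 1 \<le> a" "a \<le> 1"
    and nonneg: "\<And>x. 0 \<le> sqrt (1 - x\<^sup>2) \<Longrightarrow> 0 \<le> f x"
    and f: "\<And>x w. w = sqrt (1 - x\<^sup>2) \<Longrightarrow> w * w = 1 - x * x \<Longrightarrow>
      f x * w = poly A x + poly B x * w * arcsin x + poly C x * (arcsin x)\<^sup>2"
    and A: "A = pderiv P * [:1, 0, -1:] - P * [:0, 1:] + Q"
    and B: "B = pderiv Q + smult 2 R"
    and C: "C = pderiv R * [:1, 0, -1:] - R * [:0, 1:] + [:3 * e:]"
  shows "(\<integral>\<^sup>+x. ennreal (indicator {a<..<1} x * f x) \<partial>lborel) =
    ennreal (poly Q 1 * (pi / 2) + e * (pi / 2) ^ 3 - (poly P a * sqrt (1 - a\<^sup>2) + poly Q a * arcsin a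
       + poly R a * sqrt (1 - a\<^sup>2) * (arcsin a)\<^sup>2 + e * arcsin a ^ 3))"
proof -
  let ?F = "\<lambda>x. poly P x * sqrt (1 - x\<^sup>2) + poly Q x * arcsin x + poly R x * sqrt (1 - x\<^sup>2) * (arcsin x)\<^sup>2
    + e * arcsin x ^ 3"
  have cont: "continuous_on {a..1} ?F"
    using a by (intro continuous_intros) auto
  have der: "(?F has_real_derivative f x) (at x)" if "a < x" "x < 1" for x
  proof -
    have x: "\<bar>x\<bar> < 1" using that a by auto
    then have "x\<^sup>2 < 1" by (simp add: abs_square_less_1)
    then have w: "sqrt (1 - x\<^sup>2) > 0" and w2: "sqrt (1 - x\<^sup>2) * sqrt (1 - x\<^sup>2) = 1 - x * x"
      by (simp_all add: power2_eq_square)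
    have "(?F has_real_derivative f x * sqrt (1 - x\<^sup>2) / sqrt (1 - x\<^sup>2)) (at x)"
      using DERIV_sqrt_arcsin_form[where P = "poly P" and P' = "poly (pderiv P)" and Q = "poly Q" and Q' = "poly (pderiv Q)"
          and R = "poly R" and R' = "poly (pderiv R)" and e = e, OF x poly_DERIV poly_DERIV poly_DERIV]
      by (simp only: f[OF refl w2] A B C) (simp add: algebra_simps power2_eq_square)
    then show ?thesis using w by simp
  qed
  have "0 \<le> f x" if "a < x" "x < 1" for x
    using that a abs_square_le_1[of x] by (intro nonneg) (simp add: abs_le_iff)
  then have "(\<integral>\<^sup>+x. ennreal (indicator {a<..<1} x * f x) \<partial>lborel) = ennreal (?F 1 - ?F a)"
    using a der cont continuous_on_subset[OF cont_f, of "{a<..<1}"]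
    by (intro nn_integral_open_interval_FTC) (auto simp: subset_eq)
  then show ?thesis by simp
qed

text \<open>Multiplying by w turns the integrand into w^6, which is A. Comparing coefficients in A =
  P' (1 - x^2) - P x + Q gives P and a constant Q; the integral over (-1, 1) is pi times that
  constant. The other pure powers of w are handled in the same way.\<close>

lemma nn_integral_weight_5:
  "(\<integral>\<^sup>+x. ennreal (indicator {-1<..<1} x * (sqrt (1 - x\<^sup>2) ^ 5)) \<partial>lborel) = ennreal (5 * pi / 16)"
proof (subst nn_integral_sqrt_arcsin_form[where e = "0" and A = "[:1, 0, -1:] ^ 3" and B = "0" and C = "0"
    and P = "[:0, 11 / 16, 0, -13 / 24, 0, 1 / 6:]"
    and Q = "[:5 / 16:]"
    and R = "0"], goal_cases)
  \<comment> \<open>Goal 5 is the identity for \<open>f x * w\<close>, goal 1 the continuity, goal 9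
    the evaluation at the ends. Folding the square root into \<open>w\<close> leaves an algebraic
    identity modulo \<open>w * w = 1 - x * x\<close>.\<close>
  case (5 x w)
  show ?case unfolding 5(1)[symmetric] using 5(2) by (simp add: power2_eq_square) algebra
next
  case 1 show ?case by (auto intro!: continuous_intros)
next
  case 9 show ?case by (rule arg_cong[where f = ennreal]) (simp add: field_simps power2_eq_square power3_eq_cube)
qed (simp_all add: pderiv_pCons eval_nat_numeral)

lemma nn_integral_weight_11:
  "(\<integral>\<^sup>+x. ennreal (indicator {-1<..<1} x * (sqrt (1 - x\<^sup>2) ^ 11)) \<partial>lborel) = ennreal (231 * pi / 1024)"
proof (subst nn_integral_sqrt_arcsin_form[where e = "0" and A = "[:1, 0, -1:] ^ 6" and B = "0" and C = "0"
    and P = "[:0, 793 / 1024, 0, -2279 / 1536, 0, 3481 / 1920, 0, -417 / 320, 0, 61 / 120, 0, -1 / 12:]"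
    and Q = "[:231 / 1024:]"
    and R = "0"], goal_cases)
  case (5 x w)
  show ?case unfolding 5(1)[symmetric] using 5(2) by (simp add: power2_eq_square) algebra
next
  case 1 show ?case by (auto intro!: continuous_intros)
next
  case 9 show ?case by (rule arg_cong[where f = ennreal]) (simp add: field_simps power2_eq_square power3_eq_cube)
qed (simp_all add: pderiv_pCons eval_nat_numeral)

lemma nn_integral_same_side_5:
  "(\<integral>\<^sup>+x. ennreal (indicator {-1<..<1} x * ((1 / 2 + 2 * ((3 * x - x ^ 3) / 4)\<^sup>2) * sqrt (1 - x\<^sup>2) ^ 5)) \<partial>lborel) = ennreal (1573 * pi / 8192)"
proof (subst nn_integral_sqrt_arcsin_form[where e = "0" and A = "([:1 / 2:] + smult 2 ([:0, 3 / 4, 0, -1 / 4:]\<^sup>2)) * [:1, 0, -1:] ^ 3" and B = "0" and C = "0"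
    and P = "[:0, 2523 / 8192, 0, 329 / 4096, 0, -2359 / 5120, 0, 909 / 2560, 0, -97 / 960, 0, 1 / 96:]"
    and Q = "[:1573 / 8192:]"
    and R = "0"], goal_cases)
  case (5 x w)
  show ?case unfolding 5(1)[symmetric] using 5(2) by (simp add: power2_eq_square) algebra
next
  case 1 show ?case by (auto intro!: continuous_intros)
next
  case 9 show ?case by (rule arg_cong[where f = ennreal]) (simp add: field_simps power2_eq_square power3_eq_cube)
qed (simp_all add: pderiv_pCons eval_nat_numeral)

text \<open>Expanding the square and multiplying by w gives A, B, C with factors 1, 6, 9. The
  equation for C is 9 times the one solved in \<open>nn_integral_weight_11\<close>, so R is 9 times
  the P found there and 3 e is 9 * 231 / 1024. Then Q is an antiderivative of B - 2 R, and its
  constant term is the one for which the equation for A has a polynomial solution P.\<close>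

lemma nn_integral_cap_excess_square:
  "(\<integral>\<^sup>+x. ennreal (indicator {-1<..<1} x * ((cap_excess x)\<^sup>2 * sqrt (1 - x\<^sup>2) ^ 11)) \<partial>lborel) = ennreal (-18614167 / 22937600 * pi + 693 / 4096 * pi ^ 3)"
proof (subst nn_integral_sqrt_arcsin_form[where e = "693 / 1024" and A = "[:0, 5, 0, -2:]\<^sup>2 * [:1, 0, -1:] ^ 7" and B = "smult 6 ([:0, 5, 0, -2:] * [:1, 0, -1:] ^ 6)" and C = "smult 9 ([:1, 0, -1:] ^ 6)"
    and P = "[:0, -17037417 / 22937600, 0, 177584983 / 34406400, 0, -1144281017 / 43008000, 0, 3066482183 / 50176000, 0, -4638243517 / 56448000, 0, 15789649 / 225792, 0, -717851 / 18816, 0, 37171 / 2880, 0, -221 / 90, 0, 1 / 5:]"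
    and Q = "[:17037417 / 22937600, 0, 8223 / 1024, 0, -42315 / 1024, 0, 52199 / 640, 0, -121047 / 1280, 0, 13617 / 200, 0, -239 / 8, 0, 51 / 7, 0, -3 / 4:]"
    and R = "[:0, 7137 / 1024, 0, -6837 / 512, 0, 10443 / 640, 0, -3753 / 320, 0, 183 / 40, 0, -3 / 4:]"], goal_cases)
  case (5 x w)
  show ?case unfolding 5(1)[symmetric] using 5(2) by (simp add: power2_eq_square) algebra
next
  case 1 show ?case by (auto intro!: continuous_intros)
next
  case 9 show ?case by (rule arg_cong[where f = ennreal]) (simp add: field_simps power2_eq_square power3_eq_cube)
qed (simp_all add: pderiv_pCons eval_nat_numeral)

text \<open>One coordinate of a uniform point of the d-ball has density proportional to sqrt (1 -
  x^2)^(d-1); the tails are computed here for d = 3 and in the next lemma for d = 4.\<close>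

lemma nn_integral_marginal_2:
  assumes "- 1 \<le> a" "a \<le> 1"
  shows "(\<integral>\<^sup>+x. ennreal (indicator {a<..<1} x * (sqrt (1 - x\<^sup>2))\<^sup>2) \<partial>lborel) = ennreal (2 / 3 - (a - a ^ 3 / 3))"
proof -
  have "(\<integral>\<^sup>+x. ennreal (indicator {a<..<1} x * (sqrt (1 - x\<^sup>2))\<^sup>2) \<partial>lborel) = ennreal ((1 - 1 ^ 3 / 3) - (a - a ^ 3 / 3))"
  proof (rule nn_integral_open_interval_FTC)
    fix x assume "a < x" "x < 1"
    then have "\<bar>x\<bar> < 1" using assms by auto
    then have "sqrt (1 - x\<^sup>2) ^ 2 = 1 - x\<^sup>2" using abs_square_less_1[of x] by simp
    then show "((\<lambda>x. x - x ^ 3 / 3) has_real_derivative (sqrt (1 - x\<^sup>2))\<^sup>2) (at x)"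
      by (auto intro!: derivative_eq_intros)
  qed (use assms in \<open>auto intro!: continuous_intros\<close>)
  then show ?thesis by simp
qed

lemma nn_integral_marginal_3:
  assumes "- 1 \<le> a" "a \<le> 1"
  shows  "(\<integral>\<^sup>+x. ennreal (indicator {a<..<1} x * (sqrt (1 - x\<^sup>2) ^ 3)) \<partial>lborel) = ennreal (3 * pi / 16 - cap_excess a / 8)"
proof (subst nn_integral_sqrt_arcsin_form[where e = "0" and A = "[:1, 0, -1:]\<^sup>2" and B = "0" and C = "0"
    and P = "[:0, 5 / 8, 0, -1 / 4:]"
    and Q = "[:3 / 8:]"
    and R = "0"], goal_cases)
  case (5 x w)
  show ?case unfolding 5(1)[symmetric] using 5(2) by (simp add: power2_eq_square) algebra
next
  case 1 show ?case by (auto intro!: continuous_intros)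
next
  case 9 show ?case by (rule arg_cong[where f = ennreal]) (use assms in \<open>simp add: field_simps power2_eq_square power3_eq_cube\<close>)
qed (use assms in \<open>simp_all add: pderiv_pCons eval_nat_numeral\<close>)

subsection \<open>The Blaschke--Petkantschin formula for graphs of affine functions\<close>

text \<open>With \<open>h = b / sqrt (1 + a \<bullet> a)\<close>, the substitution \<open>x = - (b / (1 + a \<bullet> a)) *\<^sub>R a + sqrt (1 - h\<^sup>2) *\<^sub>R y\<close>
  maps the section of the ball by the hyperplane \<open>z = a \<bullet> x + b\<close> to the central parallel one.\<close>

lemma section_integral:
  fixes pt :: "nat \<Rightarrow> 'p::euclidean_space \<Rightarrow> 'b::euclidean_space" and W :: "'p \<Rightarrow> ennreal"
  assumes pt: "\<And>j x r y. pt j (diag x + r *\<^sub>R y) = x + r *\<^sub>R pt j y"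
    and W: "\<And>x r y. r > 0 \<Longrightarrow> W (diag x + r *\<^sub>R y) = ennreal (r ^ k) * W y"
    and [measurable]: "\<And>j. pt j \<in> borel_measurable borel" "W \<in> borel_measurable borel"
    and n: "n > 0"
  shows "(\<integral>\<^sup>+y. W y * (\<Prod>j<n. slab (a \<bullet> pt j y + b, pt j y)) \<partial>lborel) =
    ennreal (indicator {-1<..<1} (b / sqrt (1 + a \<bullet> a)) * sqrt (1 - (b / sqrt (1 + a \<bullet> a))\<^sup>2) ^ (DIM('p) + k + n)) *
    (\<integral>\<^sup>+y. W y * (\<Prod>j<n. slab (a \<bullet> pt j y, pt j y)) \<partial>lborel)"
proof -
  define q where "q = 1 + a \<bullet> a"
  have q: "q > 0" by (simp add: q_def add_pos_nonneg)
  have h2: "(b / sqrt q)\<^sup>2 = b\<^sup>2 / q" using q by (simp add: power_divide)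
  have ind: "b / sqrt q \<in> {-1<..<1} \<longleftrightarrow> b\<^sup>2 < q"
  proof -
    have "t \<in> {-1<..<1} \<longleftrightarrow> \<bar>t\<bar> < 1" for t :: real by auto
    then have "b / sqrt q \<in> {-1<..<1} \<longleftrightarrow> \<bar>b / sqrt q\<bar> < 1" .
    also have "\<dots> \<longleftrightarrow> b\<^sup>2 / q < 1" by (simp only: abs_square_less_1[symmetric] h2)
    finally show ?thesis using q by simp
  qed
  show ?thesis
  proof (cases "b\<^sup>2 < q")
    case True
    define r where "r = sqrt (1 - b\<^sup>2 / q)"
    define x0 where "x0 = - (b / q) *\<^sub>R a"
    have b: "b\<^sup>2 < 1 + a \<bullet> a" using True by (simp add: q_def)
    have r: "r > 0" using slab_section_scale(2)[OF b] by (simp add: r_def q_def)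
    have sc: "slab (a \<bullet> (x0 + r *\<^sub>R x) + b, x0 + r *\<^sub>R x) = ennreal r * slab (a \<bullet> x, x)" for x
      using slab_section_scale(1)[OF b, of x] by (simp add: r_def x0_def q_def)
    have "(\<integral>\<^sup>+y. W y * (\<Prod>j<n. slab (a \<bullet> pt j y + b, pt j y)) \<partial>lborel)
      = ennreal (r ^ DIM('p)) * (\<integral>\<^sup>+y. W (diag x0 + r *\<^sub>R y) *
          (\<Prod>j<n. slab (a \<bullet> pt j (diag x0 + r *\<^sub>R y) + b, pt j (diag x0 + r *\<^sub>R y))) \<partial>lborel)"
      by (rule nn_integral_lborel_scale[OF _ r]) measurable
    \<comment> \<open>The volume element gives the exponent \<open>DIM('p)\<close>, the homogeneous
      Jacobian \<open>W\<close> gives \<open>k\<close>, and each of the \<open>n\<close> chords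
      gives 1.\<close>
    also have "\<dots> = ennreal (r ^ DIM('p)) * (\<integral>\<^sup>+y. ennreal (r ^ (k + n)) * (W y * (\<Prod>j<n. slab (a \<bullet> pt j y, pt j y))) \<partial>lborel)"
      using r by (simp add: pt sc W[OF r] prod.distrib ennreal_power ennreal_mult power_add mult_ac)
    also have "\<dots> = ennreal (r ^ (DIM('p) + k + n)) * (\<integral>\<^sup>+y. W y * (\<Prod>j<n. slab (a \<bullet> pt j y, pt j y)) \<partial>lborel)"
      using r by (subst nn_integral_cmult) (measurable, simp add: power_add ennreal_mult mult_ac)
    finally show ?thesis
      using True ind by (simp add: h2[symmetric] q_def[symmetric] r_def)
  next
    case False
    then have "slab (a \<bullet> pt j y + b, pt j y) = 0" for j y
      by (intro slab_section_eq_0) (simp add: q_def)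
    then have "(\<integral>\<^sup>+y. W y * (\<Prod>j<n. slab (a \<bullet> pt j y + b, pt j y)) \<partial>lborel) = 0"
      using n by (simp add: power_0_left)
    then show ?thesis using False ind by (simp add: q_def[symmetric])
  qed
qed

text \<open>The points \<open>(zc j z, pt j y)\<close>, \<open>j < n\<close>, span the hyperplane; \<open>W\<close> is the Jacobian of the linear
  map \<open>(a, b) \<mapsto> z\<close>.\<close>

lemma hyperplane_height_law:
  fixes pt :: "nat \<Rightarrow> 'p::euclidean_space \<Rightarrow> 'b::euclidean_space" and W :: "'p \<Rightarrow> ennreal"
    and zc :: "nat \<Rightarrow> 'q::euclidean_space \<Rightarrow> real" and zv :: "'b \<Rightarrow> real \<Rightarrow> 'p \<Rightarrow> 'q"
  assumes pt: "\<And>j x r y. pt j (diag x + r *\<^sub>R y) = x + r *\<^sub>R pt j y"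
    and W: "\<And>x r y. r > 0 \<Longrightarrow> W (diag x + r *\<^sub>R y) = ennreal (r ^ k) * W y"
    and [measurable]: "\<And>j. pt j \<in> borel_measurable borel" "W \<in> borel_measurable borel"
      "\<And>j. zc j \<in> borel_measurable borel" "(\<lambda>(y, z). hgt y z) \<in> borel_measurable borel"
      "\<phi> \<in> borel_measurable borel"
    and n: "n > 0"
    and zc: "\<And>j a b y. j < n \<Longrightarrow> zc j (zv a b y) = a \<bullet> pt j y + b"
    and cv: "AE y in lborel. (\<forall>\<Phi>\<in>borel_measurable borel.
        (\<integral>\<^sup>+z. \<Phi> z \<partial>lborel) = W y * (\<integral>\<^sup>+a. \<integral>\<^sup>+b. \<Phi> (zv a b y) \<partial>lborel \<partial>lborel)) \<and>
        (\<forall>a b. hgt y (zv a b y) = b / sqrt (1 + a \<bullet> a))"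
  shows "(\<integral>\<^sup>+y. \<integral>\<^sup>+z. \<phi> (hgt y z) * (\<Prod>j<n. slab (zc j z, pt j y)) \<partial>lborel \<partial>lborel) =
    (\<integral>\<^sup>+a. ennreal (sqrt (1 + a \<bullet> a)) * (\<integral>\<^sup>+y. W y * (\<Prod>j<n. slab (a \<bullet> pt j y, pt j y)) \<partial>lborel) \<partial>lborel) *
    (\<integral>\<^sup>+h. \<phi> h * weight (DIM('p) + k + n) h \<partial>lborel)"
proof -
  let ?h = "\<lambda>a b. b / sqrt (1 + a \<bullet> a) :: real"
  let ?w = "\<lambda>h. weight (DIM('p) + k + n) h"
  let ?I = "\<lambda>a. \<integral>\<^sup>+y. W y * (\<Prod>j<n. slab (a \<bullet> pt j y, pt j y)) \<partial>lborel"
  let ?S = "\<lambda>a b y. \<Prod>j<n. slab (a \<bullet> pt j y + b, pt j y)"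
  have [measurable]: "(\<lambda>z. hgt y z) \<in> borel_measurable borel" for y
  proof -
    have "(\<lambda>z. (y, z)) \<in> borel_measurable (borel :: 'q measure)" by measurable
    from measurable_compose[OF this, of "\<lambda>(y, z). hgt y z" borel] show ?thesis by simp
  qed
  have "(\<integral>\<^sup>+y. \<integral>\<^sup>+z. \<phi> (hgt y z) * (\<Prod>j<n. slab (zc j z, pt j y)) \<partial>lborel \<partial>lborel)
    = (\<integral>\<^sup>+y. W y * (\<integral>\<^sup>+a. \<integral>\<^sup>+b. \<phi> (?h a b) * ?S a b y \<partial>lborel \<partial>lborel) \<partial>lborel)"
  proof (rule nn_integral_cong_AE)
    show "AE y in lborel. (\<integral>\<^sup>+z. \<phi> (hgt y z) * (\<Prod>j<n. slab (zc j z, pt j y)) \<partial>lborel)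
      = W y * (\<integral>\<^sup>+a. \<integral>\<^sup>+b. \<phi> (?h a b) * ?S a b y \<partial>lborel \<partial>lborel)"
      using cv
    proof eventually_elim
      case (elim y)
      have "(\<lambda>z. \<phi> (hgt y z) * (\<Prod>j<n. slab (zc j z, pt j y))) \<in> borel_measurable borel"
        by measurable
      then have "(\<integral>\<^sup>+z. \<phi> (hgt y z) * (\<Prod>j<n. slab (zc j z, pt j y)) \<partial>lborel)
        = W y * (\<integral>\<^sup>+a. \<integral>\<^sup>+b. \<phi> (hgt y (zv a b y)) * (\<Prod>j<n. slab (zc j (zv a b y), pt j y)) \<partial>lborel \<partial>lborel)"
        using elim by blast
      then show ?case using elim zc by simp
    qed
  qed
  also have "\<dots> = (\<integral>\<^sup>+y. \<integral>\<^sup>+t. W y * (\<phi> (?h (fst t) (snd t)) * ?S (fst t) (snd t) y) \<partial>lborel \<partial>lborel)"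
  proof (rule nn_integral_cong)
    fix y :: 'p
    have [measurable]: "(\<lambda>t. \<phi> (?h (fst t) (snd t)) * ?S (fst t) (snd t) y) \<in> borel_measurable borel"
      by measurable
    have "(\<integral>\<^sup>+t. \<phi> (?h (fst t) (snd t)) * ?S (fst t) (snd t) y \<partial>lborel)
      = (\<integral>\<^sup>+a. \<integral>\<^sup>+b. \<phi> (?h a b) * ?S a b y \<partial>lborel \<partial>lborel)"
      by (subst nn_integral_lborel_pair) simp_all
    then show "W y * (\<integral>\<^sup>+a. \<integral>\<^sup>+b. \<phi> (?h a b) * ?S a b y \<partial>lborel \<partial>lborel)
      = (\<integral>\<^sup>+t. W y * (\<phi> (?h (fst t) (snd t)) * ?S (fst t) (snd t) y) \<partial>lborel)"
      by (subst nn_integral_cmult) simp_all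
  qed
  \<comment> \<open>With (a, b) on the outside, the hyperplane is fixed while the points vary in it,
    and the inner integral depends on b only through the weight of the height.\<close>
  also have "\<dots> = (\<integral>\<^sup>+t. \<integral>\<^sup>+y. W y * (\<phi> (?h (fst t) (snd t)) * ?S (fst t) (snd t) y) \<partial>lborel \<partial>lborel)"
    by (rule lborel_pair.Fubini') measurable
  also have "\<dots> = (\<integral>\<^sup>+t. \<phi> (?h (fst t) (snd t)) * (?w (?h (fst t) (snd t)) * ?I (fst t)) \<partial>lborel)"
  proof (rule nn_integral_cong)
    fix t :: "'b \<times> real"
    have "(\<integral>\<^sup>+y. W y * (\<phi> (?h (fst t) (snd t)) * ?S (fst t) (snd t) y) \<partial>lborel)
      = \<phi> (?h (fst t) (snd t)) * (\<integral>\<^sup>+y. W y * ?S (fst t) (snd t) y \<partial>lborel)"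
      by (subst nn_integral_cmult[symmetric]) (measurable, simp add: mult_ac)
    then show "(\<integral>\<^sup>+y. W y * (\<phi> (?h (fst t) (snd t)) * ?S (fst t) (snd t) y) \<partial>lborel)
      = \<phi> (?h (fst t) (snd t)) * (?w (?h (fst t) (snd t)) * ?I (fst t))"
      by (subst (asm) section_integral[where k = k and diag = diag, OF pt W]) (use n in simp_all)
  qed
  also have "\<dots> = (\<integral>\<^sup>+a. \<integral>\<^sup>+b. (\<phi> (?h a b) * ?w (?h a b)) * ?I a \<partial>lborel \<partial>lborel)"
    by (subst nn_integral_lborel_pair) (measurable, simp add: mult_ac)
  \<comment> \<open>Substituting b = h sqrt (1 + a . a) separates the height from the slope;
    everything that still involves a goes into the constant.\<close>
  also have "\<dots> = (\<integral>\<^sup>+a. (ennreal (sqrt (1 + a \<bullet> a)) * (\<integral>\<^sup>+h. \<phi> h * ?w h \<partial>lborel)) * ?I a \<partial>lborel)"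
  proof (rule nn_integral_cong)
    fix a :: 'b
    have "(\<integral>\<^sup>+b. (\<phi> (?h a b) * ?w (?h a b)) * ?I a \<partial>lborel) = (\<integral>\<^sup>+b. \<phi> (?h a b) * ?w (?h a b) \<partial>lborel) * ?I a"
      by (rule nn_integral_multc) measurable
    also have "(\<integral>\<^sup>+b. \<phi> (?h a b) * ?w (?h a b) \<partial>lborel) = ennreal (sqrt (1 + a \<bullet> a)) * (\<integral>\<^sup>+h. \<phi> h * ?w h \<partial>lborel)"
      by (rule nn_integral_section_height[of "\<lambda>h. \<phi> h * ?w h"]) measurable
    finally show "(\<integral>\<^sup>+b. (\<phi> (?h a b) * ?w (?h a b)) * ?I a \<partial>lborel)
      = (ennreal (sqrt (1 + a \<bullet> a)) * (\<integral>\<^sup>+h. \<phi> h * ?w h \<partial>lborel)) * ?I a" .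
  qed
  also have "\<dots> = (\<integral>\<^sup>+a. ennreal (sqrt (1 + a \<bullet> a)) * ?I a \<partial>lborel) * (\<integral>\<^sup>+h. \<phi> h * ?w h \<partial>lborel)"
    by (subst nn_integral_multc[symmetric]) (measurable, simp add: mult_ac)
  finally show ?thesis .
qed

section \<open>Lines (d = 3) and planes (d = 4) through random points\<close>

lemma AE_lborel_pair:
  fixes P :: "'a::euclidean_space \<times> 'b::euclidean_space \<Rightarrow> bool"
  assumes [measurable]: "Measurable.pred borel P" and "AE x in lborel. AE y in lborel. P (x, y)"
  shows "AE z in lborel. P z"
proof -
  have "{z \<in> space (lborel \<Otimes>\<^sub>M lborel). P z} \<in> sets (lborel \<Otimes>\<^sub>M lborel)"
    unfolding lborel_prod by measurable
  from lborel_pair.AE_pair_measure[OF this assms(2)] show ?thesis unfolding lborel_prod .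
qed

text \<open>The linear map from (a, b) to the values at x and x + u is a shear in b followed by
  scaling a by u, so one-dimensional substitutions and Fubini suffice.\<close>

lemma nn_integral_line_coordinates:
  fixes \<Phi> :: "real \<times> real \<Rightarrow> ennreal"
  assumes [measurable]: "\<Phi> \<in> borel_measurable borel" and u: "u \<noteq> 0"
  shows "(\<integral>\<^sup>+z. \<Phi> z \<partial>lborel) = ennreal \<bar>u\<bar> * (\<integral>\<^sup>+a. \<integral>\<^sup>+b. \<Phi> (a * x + b, a * (x + u) + b) \<partial>lborel \<partial>lborel)"
proof -
  have "(\<integral>\<^sup>+a. \<integral>\<^sup>+b. \<Phi> (a * x + b, a * (x + u) + b) \<partial>lborel \<partial>lborel)
     = (\<integral>\<^sup>+a. \<integral>\<^sup>+z. \<Phi> (z, z + u * a) \<partial>lborel \<partial>lborel)"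
  proof (rule nn_integral_cong)
    fix a :: real
    show "(\<integral>\<^sup>+b. \<Phi> (a * x + b, a * (x + u) + b) \<partial>lborel) = (\<integral>\<^sup>+z. \<Phi> (z, z + u * a) \<partial>lborel)"
      by (subst (2) nn_integral_real_affine[where c = 1 and t = "a * x"]) (simp_all add: algebra_simps)
  qed
  also have "\<dots> = (\<integral>\<^sup>+z. \<integral>\<^sup>+a. \<Phi> (z, z + u * a) \<partial>lborel \<partial>lborel)"
    by (rule lborel_pair.Fubini') measurable
  finally have "ennreal \<bar>u\<bar> * (\<integral>\<^sup>+a. \<integral>\<^sup>+b. \<Phi> (a * x + b, a * (x + u) + b) \<partial>lborel \<partial>lborel)
     = (\<integral>\<^sup>+z. ennreal \<bar>u\<bar> * (\<integral>\<^sup>+a. \<Phi> (z, z + u * a) \<partial>lborel) \<partial>lborel)"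
    by (simp add: nn_integral_cmult)
  also have "\<dots> = (\<integral>\<^sup>+z. \<integral>\<^sup>+z'. \<Phi> (z, z') \<partial>lborel \<partial>lborel)"
    using u by (intro nn_integral_cong, subst (2) nn_integral_real_affine[where c = u]) simp_all
  also have "\<dots> = (\<integral>\<^sup>+z. \<Phi> z \<partial>lborel)"
    by (rule nn_integral_lborel_pair[symmetric]) measurable
  finally show ?thesis ..
qed

text \<open>Gaussian elimination with pivot u: eliminating the first unknown contributes 1 / |u| and
  the remaining triangular step |D / u|.\<close>

lemma nn_integral_linear_2:
  fixes \<Psi> :: "real \<times> real \<Rightarrow> ennreal"
  assumes [measurable]: "\<Psi> \<in> borel_measurable borel" and u: "u \<noteq> 0" and D: "u * w' - u' * w \<noteq> 0"
  shows "(\<integral>\<^sup>+s. \<Psi> s \<partial>lborel) = ennreal \<bar>u * w' - u' * w\<bar> *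
    (\<integral>\<^sup>+a. \<Psi> (fst a * u + snd a * w, fst a * u' + snd a * w') \<partial>lborel)"
proof -
  let ?D = "u * w' - u' * w"
  have "(\<integral>\<^sup>+a. \<Psi> (fst a * u + snd a * w, fst a * u' + snd a * w') \<partial>lborel)
    = (\<integral>\<^sup>+a. \<integral>\<^sup>+a'. \<Psi> (a * u + a' * w, a * u' + a' * w') \<partial>lborel \<partial>lborel)"
    by (subst nn_integral_lborel_pair) simp_all
  also have "\<dots> = (\<integral>\<^sup>+a'. \<integral>\<^sup>+a. \<Psi> (a * u + a' * w, a * u' + a' * w') \<partial>lborel \<partial>lborel)"
    by (rule lborel_pair.Fubini') measurable
  also have "\<dots> = (\<integral>\<^sup>+a'. ennreal (1 / \<bar>u\<bar>) * (\<integral>\<^sup>+s. \<Psi> (s, s * u' / u + a' * (?D / u)) \<partial>lborel) \<partial>lborel)"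
  proof (rule nn_integral_cong)
    fix a' :: real
    have "(a' * (- w / u) + 1 / u * s) * u + a' * w = s" for s
      using u by (simp add: field_simps)
    moreover have "(a' * (- w / u) + 1 / u * s) * u' + a' * w' = s * u' / u + a' * (?D / u)" for s
      using u by (simp add: field_simps)
    ultimately show "(\<integral>\<^sup>+a. \<Psi> (a * u + a' * w, a * u' + a' * w') \<partial>lborel)
       = ennreal (1 / \<bar>u\<bar>) * (\<integral>\<^sup>+s. \<Psi> (s, s * u' / u + a' * (?D / u)) \<partial>lborel)"
      using u by (subst nn_integral_real_affine[where c = "1 / u" and t = "a' * (- w / u)"]) simp_all
  qed
  also have "\<dots> = ennreal (1 / \<bar>u\<bar>) * (\<integral>\<^sup>+a'. \<integral>\<^sup>+s. \<Psi> (s, s * u' / u + a' * (?D / u)) \<partial>lborel \<partial>lborel)"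
    by (rule nn_integral_cmult) measurable
  also have "(\<integral>\<^sup>+a'. \<integral>\<^sup>+s. \<Psi> (s, s * u' / u + a' * (?D / u)) \<partial>lborel \<partial>lborel)
     = (\<integral>\<^sup>+s. \<integral>\<^sup>+a'. \<Psi> (s, s * u' / u + a' * (?D / u)) \<partial>lborel \<partial>lborel)"
    by (rule lborel_pair.Fubini') measurable
  finally have "ennreal \<bar>?D\<bar> * (\<integral>\<^sup>+a. \<Psi> (fst a * u + snd a * w, fst a * u' + snd a * w') \<partial>lborel)
     = ennreal \<bar>?D / u\<bar> * (\<integral>\<^sup>+s. \<integral>\<^sup>+a'. \<Psi> (s, s * u' / u + a' * (?D / u)) \<partial>lborel \<partial>lborel)"
    by (simp add: mult.assoc[symmetric] ennreal_mult'[symmetric] abs_divide)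
  also have "\<dots> = (\<integral>\<^sup>+s. ennreal \<bar>?D / u\<bar> * (\<integral>\<^sup>+a'. \<Psi> (s, s * u' / u + a' * (?D / u)) \<partial>lborel) \<partial>lborel)"
    by (rule nn_integral_cmult[symmetric]) measurable
  also have "\<dots> = (\<integral>\<^sup>+s. \<integral>\<^sup>+t. \<Psi> (s, t) \<partial>lborel \<partial>lborel)"
  proof (rule nn_integral_cong)
    fix s :: real
    show "ennreal \<bar>?D / u\<bar> * (\<integral>\<^sup>+a'. \<Psi> (s, s * u' / u + a' * (?D / u)) \<partial>lborel) = (\<integral>\<^sup>+t. \<Psi> (s, t) \<partial>lborel)"
      using u D by (subst (2) nn_integral_real_affine[where c = "?D / u" and t = "s * u' / u"]) (simp_all add: mult.commute)
  qed
  also have "\<dots> = (\<integral>\<^sup>+s. \<Psi> s \<partial>lborel)"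
    by (rule nn_integral_lborel_pair[symmetric]) measurable
  finally show ?thesis ..
qed

text \<open>Shifting b makes the value at x a free variable; the differences to the other two values
  are linear in a with determinant D.\<close>

lemma nn_integral_plane_coordinates:
  fixes \<Phi> :: "real \<times> real \<times> real \<Rightarrow> ennreal" and x u u' :: "real \<times> real"
  defines "D \<equiv> fst u * snd u' - fst u' * snd u"
  assumes [measurable]: "\<Phi> \<in> borel_measurable borel" and u: "fst u \<noteq> 0" and D: "D \<noteq> 0"
  shows "(\<integral>\<^sup>+z. \<Phi> z \<partial>lborel) = ennreal \<bar>D\<bar> *
    (\<integral>\<^sup>+a. \<integral>\<^sup>+b. \<Phi> (a \<bullet> x + b, a \<bullet> (x + u) + b, a \<bullet> (x + u') + b) \<partial>lborel \<partial>lborel)"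
proof -
  have "(\<integral>\<^sup>+a. \<integral>\<^sup>+b. \<Phi> (a \<bullet> x + b, a \<bullet> (x + u) + b, a \<bullet> (x + u') + b) \<partial>lborel \<partial>lborel)
     = (\<integral>\<^sup>+a. \<integral>\<^sup>+z. \<Phi> (z, z + a \<bullet> u, z + a \<bullet> u') \<partial>lborel \<partial>lborel)"
  proof (rule nn_integral_cong)
    fix a :: "real \<times> real"
    show "(\<integral>\<^sup>+b. \<Phi> (a \<bullet> x + b, a \<bullet> (x + u) + b, a \<bullet> (x + u') + b) \<partial>lborel)
      = (\<integral>\<^sup>+z. \<Phi> (z, z + a \<bullet> u, z + a \<bullet> u') \<partial>lborel)"
      by (subst (2) nn_integral_real_affine[where c = 1 and t = "a \<bullet> x"]) (simp_all add: inner_add_right add_ac)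
  qed
  also have "\<dots> = (\<integral>\<^sup>+z. \<integral>\<^sup>+a. \<Phi> (z, z + a \<bullet> u, z + a \<bullet> u') \<partial>lborel \<partial>lborel)"
    by (rule lborel_pair.Fubini') measurable
  finally have "ennreal \<bar>D\<bar> * (\<integral>\<^sup>+a. \<integral>\<^sup>+b. \<Phi> (a \<bullet> x + b, a \<bullet> (x + u) + b, a \<bullet> (x + u') + b) \<partial>lborel \<partial>lborel)
     = (\<integral>\<^sup>+z. ennreal \<bar>D\<bar> * (\<integral>\<^sup>+a. \<Phi> (z, z + a \<bullet> u, z + a \<bullet> u') \<partial>lborel) \<partial>lborel)"
    by (simp add: nn_integral_cmult)
  also have "\<dots> = (\<integral>\<^sup>+z. \<integral>\<^sup>+s. \<Phi> (z, s) \<partial>lborel \<partial>lborel)"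
  proof (rule nn_integral_cong)
    fix z :: real
    have "(\<integral>\<^sup>+s. \<Phi> (z, s) \<partial>lborel) = (\<integral>\<^sup>+s. \<Phi> (z, (z, z) + s) \<partial>lborel)"
      by (subst nn_integral_lborel_scale[where t = "(z, z)" and r = 1]) simp_all
    also have "\<dots> = ennreal \<bar>D\<bar> * (\<integral>\<^sup>+a. \<Phi> (z, (z, z) + (fst a * fst u + snd a * snd u, fst a * fst u' + snd a * snd u')) \<partial>lborel)"
      unfolding D_def using u D by (intro nn_integral_linear_2[of "\<lambda>s. \<Phi> (z, (z, z) + s)"]) (simp_all add: D_def)
    finally show "ennreal \<bar>D\<bar> * (\<integral>\<^sup>+a. \<Phi> (z, z + a \<bullet> u, z + a \<bullet> u') \<partial>lborel) = (\<integral>\<^sup>+s. \<Phi> (z, s) \<partial>lborel)"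
      by (simp add: inner_prod_def)
  qed
  also have "\<dots> = (\<integral>\<^sup>+z. \<Phi> z \<partial>lborel)"
    by (rule nn_integral_lborel_pair[symmetric]) measurable
  finally show ?thesis ..
qed

lemma AE_lborel_linear_neq:
  assumes "u \<noteq> (0::real)"
  shows "AE x in lborel. u * (x - c) \<noteq> d"
proof -
  have "AE x in lborel. x \<noteq> c + d / u" by (rule AE_lborel_singleton)
  then show ?thesis by eventually_elim (use assms in \<open>auto simp: field_simps\<close>)
qed

text \<open>The pair \<open>(a, b)\<close> such that the affine function \<open>x \<mapsto> a \<bullet> x + b\<close> takes the values \<open>z\<close> at the points \<open>x\<close>
  (junk if these are affinely dependent).\<close>

definition line_coeffs :: "real \<times> real \<Rightarrow> real \<times> real \<Rightarrow> real \<times> real" where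
  "line_coeffs x z = (let a = (snd z - fst z) / (snd x - fst x) in (a, fst z - a * fst x))"

text \<open>Twice the signed area of the triangle with these corners. It serves both as Jacobian of
  the map from (a, b) to the three values and as denominator in Cramer's rule.\<close>

definition det3 :: "(real \<times> real) \<times> (real \<times> real) \<times> (real \<times> real) \<Rightarrow> real" where
  "det3 x = fst (fst (snd x) - fst x) * snd (snd (snd x) - fst x) - fst (snd (snd x) - fst x) * snd (fst (snd x) - fst x)"

definition plane_coeffs :: "(real \<times> real) \<times> (real \<times> real) \<times> (real \<times> real) \<Rightarrow> real \<times> real \<times> real \<Rightarrow> (real \<times> real) \<times> real" where
  "plane_coeffs x z = (let u = fst (snd x) - fst x; u' = snd (snd x) - fst x; s = fst (snd z) - fst z; t = snd (snd z) - fst z;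
     a = ((s * snd u' - t * snd u) / det3 x, (fst u * t - fst u' * s) / det3 x) in (a, fst z - a \<bullet> fst x))"

lemma det3_measurable [measurable]: "det3 \<in> borel_measurable borel"
  unfolding det3_def[abs_def] by (intro borel_measurable_continuous_onI continuous_intros)

lemma AE_pair_distinct: "AE x in lborel. fst x \<noteq> (snd x :: real)"
proof (rule AE_lborel_pair)
  show "AE x in lborel. AE y in lborel. fst (x, y) \<noteq> (snd (x, y) :: real)"
  proof (rule AE_I2)
    fix x :: real
    show "AE y in lborel. fst (x, y) \<noteq> snd (x, y)"
      using AE_lborel_singleton[of x] by eventually_elim auto
  qed
qed measurable

text \<open>With two corners of distinct first coordinates fixed, \<open>det3\<close> is affine in
  the second coordinate of the third corner with nonzero slope, so it vanishes for at most one
  value.\<close>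

lemma AE_triple_generic: "AE x in lborel. fst (fst (snd x) - fst x) \<noteq> 0 \<and> det3 x \<noteq> 0"
proof (rule AE_lborel_pair)
  show "Measurable.pred borel (\<lambda>x. fst (fst (snd x) - fst x) \<noteq> 0 \<and> det3 x \<noteq> 0)"
    by measurable
  show "AE x1 in lborel. AE y in lborel. fst (fst (snd (x1, y)) - fst (x1, y)) \<noteq> 0 \<and> det3 (x1, y) \<noteq> 0"
  proof (rule AE_I2, rule AE_lborel_pair)
    fix x1 :: "real \<times> real"
    show "Measurable.pred borel (\<lambda>y. fst (fst (snd (x1, y)) - fst (x1, y)) \<noteq> 0 \<and> det3 (x1, y) \<noteq> 0)"
      by measurable
    have "AE x2 in (lborel :: (real \<times> real) measure). fst x2 \<noteq> fst x1"
    proof (rule AE_lborel_pair)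
      show "AE a in lborel. AE b in (lborel :: real measure). fst (a, b) \<noteq> fst x1"
        using AE_lborel_singleton[of "fst x1"] by eventually_elim simp
    qed measurable
    then show "AE x2 in lborel. AE x3 in lborel. fst (fst (snd (x1, x2, x3)) - fst (x1, x2, x3)) \<noteq> 0 \<and> det3 (x1, x2, x3) \<noteq> 0"
    proof eventually_elim
      case (elim x2)
      show ?case
      proof (rule AE_lborel_pair)
        show "Measurable.pred borel (\<lambda>x3. fst (fst (snd (x1, x2, x3)) - fst (x1, x2, x3)) \<noteq> 0 \<and> det3 (x1, x2, x3) \<noteq> 0)"
          by measurable
        show "AE a in lborel. AE b in lborel. fst (fst (snd (x1, x2, a, b)) - fst (x1, x2, a, b)) \<noteq> 0 \<and> det3 (x1, x2, a, b) \<noteq> 0"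
          using AE_lborel_linear_neq[of "fst x2 - fst x1"] elim by (auto simp: det3_def)
      qed
    qed
  qed
qed

abbreviation drop_last :: "'b coords \<Rightarrow> real \<times> 'b" where
  "drop_last y \<equiv> (fst y, fst (snd y))"

abbreviation slab_const :: "'b::euclidean_space itself \<Rightarrow> ennreal" where
  "slab_const _ \<equiv> 2 / emeasure lborel (cball 0 1 :: ('b coords) set)"

text \<open>After both w are integrated out, the coordinates are regrouped so that the x-parts are
  outside and the z-parts inside. The regrouping \<sigma> only permutes coordinates, hence is an
  isometry and preserves Lebesgue measure.\<close>

lemma nn_integral_uniform_slab2:
  fixes f :: "(real \<times> 'b::euclidean_space) \<times> (real \<times> 'b) \<Rightarrow> ennreal"
  assumes [measurable]: "f \<in> borel_measurable borel"
  shows "(\<integral>\<^sup>+y1. \<integral>\<^sup>+y2. f (drop_last y1, drop_last y2) \<partial>unif_ball \<partial>unif_ball) = (slab_const TYPE('b))\<^sup>2 *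
    (\<integral>\<^sup>+x. \<integral>\<^sup>+z. f ((fst z, fst x), (snd z, snd x)) * (slab (fst z, fst x) * slab (snd z, snd x)) \<partial>lborel \<partial>lborel)"
proof -
  let ?k = "slab_const TYPE('b)"
  let ?g = "\<lambda>t. f t * (slab (fst t) * slab (snd t))"
  define \<sigma> where "\<sigma> p = ((fst (snd p), fst (fst p)), (snd (snd p), snd (fst p)))" for p :: "('b \<times> 'b) \<times> (real \<times> real)"
  have lin: "linear \<sigma>" by (rule linearI) (auto simp: \<sigma>_def)
  have nrm: "norm (\<sigma> p) = norm p" for p by (simp add: \<sigma>_def norm_prod_def algebra_simps)
  have [measurable]: "\<sigma> \<in> borel_measurable borel"
    by (rule borel_measurable_linear[OF lin])
  have "(\<integral>\<^sup>+y1. \<integral>\<^sup>+y2. f (drop_last y1, drop_last y2) \<partial>(unif_ball :: ('b coords) measure) \<partial>(unif_ball :: ('b coords) measure))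
    = (\<integral>\<^sup>+y1. ?k * (\<integral>\<^sup>+t2. f (drop_last y1, t2) * slab t2 \<partial>lborel) \<partial>(unif_ball :: ('b coords) measure))"
    by (intro nn_integral_cong, rule nn_integral_uniform_slab) measurable
  also have "\<dots> = ?k * (\<integral>\<^sup>+t1. ?k * (\<integral>\<^sup>+t2. f (t1, t2) * slab t2 \<partial>lborel) * slab t1 \<partial>lborel)"
    by (rule nn_integral_uniform_slab[of "\<lambda>t1. ?k * (\<integral>\<^sup>+t2. f (t1, t2) * slab t2 \<partial>lborel)"]) measurable
  also have "\<dots> = ?k * (\<integral>\<^sup>+t1. ?k * (\<integral>\<^sup>+t2. ?g (t1, t2) \<partial>lborel) \<partial>lborel)"
    by (simp add: nn_integral_cmult mult_ac)
  also have "\<dots> = ?k\<^sup>2 * (\<integral>\<^sup>+t. ?g t \<partial>lborel)"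
    by (subst nn_integral_cmult, measurable, subst nn_integral_lborel_pair[of ?g], measurable)
      (simp add: power2_eq_square mult.assoc)
  also have "(\<integral>\<^sup>+t. ?g t \<partial>lborel) = (\<integral>\<^sup>+t. ?g t \<partial>distr lborel borel \<sigma>)"
    by (subst distr_lborel_isometry[OF lin nrm]) simp_all
  also have "\<dots> = (\<integral>\<^sup>+p. ?g (\<sigma> p) \<partial>lborel)"
    by (rule nn_integral_distr) measurable
  also have "\<dots> = (\<integral>\<^sup>+x. \<integral>\<^sup>+z. ?g (\<sigma> (x, z)) \<partial>lborel \<partial>lborel)"
    by (rule nn_integral_lborel_pair) measurable
  finally show ?thesis by (simp add: \<sigma>_def)
qed

lemma nn_integral_uniform_slab3:
  fixes f :: "(real \<times> 'b::euclidean_space) \<times> (real \<times> 'b) \<times> (real \<times> 'b) \<Rightarrow> ennreal"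
  assumes [measurable]: "f \<in> borel_measurable borel"
  shows "(\<integral>\<^sup>+y1. \<integral>\<^sup>+y2. \<integral>\<^sup>+y3. f (drop_last y1, drop_last y2, drop_last y3) \<partial>unif_ball \<partial>unif_ball \<partial>unif_ball) = (slab_const TYPE('b)) ^ 3 *
    (\<integral>\<^sup>+x. \<integral>\<^sup>+z. f ((fst z, fst x), (fst (snd z), fst (snd x)), (snd (snd z), snd (snd x))) *
      (slab (fst z, fst x) * slab (fst (snd z), fst (snd x)) * slab (snd (snd z), snd (snd x))) \<partial>lborel \<partial>lborel)"
proof -
  let ?k = "slab_const TYPE('b)" and ?U = "unif_ball :: ('b coords) measure"
  let ?g = "\<lambda>t. f t * (slab (fst t) * slab (fst (snd t)) * slab (snd (snd t)))"
  define \<sigma> where "\<sigma> p = ((fst (snd p), fst (fst p)), (fst (snd (snd p)), fst (snd (fst p))), (snd (snd (snd p)), snd (snd (fst p))))"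
    for p :: "('b \<times> 'b \<times> 'b) \<times> (real \<times> real \<times> real)"
  have lin: "linear \<sigma>" by (rule linearI) (auto simp: \<sigma>_def)
  have nrm: "norm (\<sigma> p) = norm p" for p by (simp add: \<sigma>_def norm_prod_def algebra_simps)
  have [measurable]: "\<sigma> \<in> borel_measurable borel"
    by (rule borel_measurable_linear[OF lin])
  have "(\<integral>\<^sup>+y1. \<integral>\<^sup>+y2. \<integral>\<^sup>+y3. f (drop_last y1, drop_last y2, drop_last y3) \<partial>?U \<partial>?U \<partial>?U)
    = (\<integral>\<^sup>+y1. \<integral>\<^sup>+y2. ?k * (\<integral>\<^sup>+t3. f (drop_last y1, drop_last y2, t3) * slab t3 \<partial>lborel) \<partial>?U \<partial>?U)"
    by (intro nn_integral_cong, rule nn_integral_uniform_slab) measurable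
  also have "\<dots> = (\<integral>\<^sup>+y1. ?k * (\<integral>\<^sup>+t2. ?k * (\<integral>\<^sup>+t3. f (drop_last y1, t2, t3) * slab t3 \<partial>lborel) * slab t2 \<partial>lborel) \<partial>?U)"
    by (intro nn_integral_cong, rule nn_integral_uniform_slab[of "\<lambda>t2. ?k * (\<integral>\<^sup>+t3. f (drop_last _, t2, t3) * slab t3 \<partial>lborel)"]) measurable
  also have "\<dots> = ?k * (\<integral>\<^sup>+t1. ?k * (\<integral>\<^sup>+t2. ?k * (\<integral>\<^sup>+t3. f (t1, t2, t3) * slab t3 \<partial>lborel) * slab t2 \<partial>lborel) * slab t1 \<partial>lborel)"
    by (rule nn_integral_uniform_slab[of "\<lambda>t1. ?k * (\<integral>\<^sup>+t2. ?k * (\<integral>\<^sup>+t3. f (t1, t2, t3) * slab t3 \<partial>lborel) * slab t2 \<partial>lborel)"]) measurable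
  also have "\<dots> = ?k * (\<integral>\<^sup>+t1. ?k * (\<integral>\<^sup>+t2. ?k * (\<integral>\<^sup>+t3. ?g (t1, t2, t3) \<partial>lborel) \<partial>lborel) \<partial>lborel)"
    by (simp add: nn_integral_cmult mult_ac)
  also have "\<dots> = ?k ^ 3 * (\<integral>\<^sup>+t1. \<integral>\<^sup>+t2. \<integral>\<^sup>+t3. ?g (t1, t2, t3) \<partial>lborel \<partial>lborel \<partial>lborel)"
    by (simp add: nn_integral_cmult power3_eq_cube mult.assoc)
  also have "(\<integral>\<^sup>+t1. \<integral>\<^sup>+t2. \<integral>\<^sup>+t3. ?g (t1, t2, t3) \<partial>lborel \<partial>lborel \<partial>lborel) = (\<integral>\<^sup>+t1. \<integral>\<^sup>+t2. ?g (t1, t2) \<partial>lborel \<partial>lborel)"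
    by (intro nn_integral_cong, subst nn_integral_lborel_pair) simp_all
  also have "\<dots> = (\<integral>\<^sup>+t. ?g t \<partial>lborel)"
    by (rule nn_integral_lborel_pair[symmetric]) measurable
  also have "(\<integral>\<^sup>+t. ?g t \<partial>lborel) = (\<integral>\<^sup>+t. ?g t \<partial>distr lborel borel \<sigma>)"
    by (subst distr_lborel_isometry[OF lin nrm]) simp_all
  also have "\<dots> = (\<integral>\<^sup>+p. ?g (\<sigma> p) \<partial>lborel)"
    by (rule nn_integral_distr) measurable
  also have "\<dots> = (\<integral>\<^sup>+x. \<integral>\<^sup>+z. ?g (\<sigma> (x, z)) \<partial>lborel \<partial>lborel)"
    by (rule nn_integral_lborel_pair) measurable
  finally show ?thesis by (simp add: \<sigma>_def)
qed

abbreviation signed_distance :: "'b::euclidean_space \<times> real \<Rightarrow> real" where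
  "signed_distance p \<equiv> snd p / sqrt (1 + fst p \<bullet> fst p)"

abbreviation ball3 :: "(real \<times> real \<times> real) measure" where "ball3 \<equiv> unif_ball"
abbreviation ball4 :: "((real \<times> real) coords) measure" where "ball4 \<equiv> unif_ball"

abbreviation line_through :: "real \<times> real \<times> real \<Rightarrow> real \<times> real \<times> real \<Rightarrow> real \<times> real" where
  "line_through y1 y2 \<equiv> line_coeffs (fst (snd y1), fst (snd y2)) (fst y1, fst y2)"

abbreviation plane_through ::
  "(real \<times> real) coords \<Rightarrow> (real \<times> real) coords \<Rightarrow> (real \<times> real) coords \<Rightarrow> (real \<times> real) \<times> real" where
  "plane_through y1 y2 y3 \<equiv> plane_coeffs (fst (snd y1), fst (snd y2), fst (snd y3)) (fst y1, fst y2, fst y3)"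

text \<open>The constant \<open>K\<close> collects ball volumes and the integral over slopes, and at
  this stage it could be infinite. As it does not depend on \<phi>, the constant function 1
  determines it later.\<close>

lemma height_law_2:
  obtains K :: ennreal where "\<And>\<phi>. \<phi> \<in> borel_measurable borel \<Longrightarrow>
    (\<integral>\<^sup>+y1. \<integral>\<^sup>+y2. \<phi> (signed_distance (line_through y1 y2)) \<partial>ball3 \<partial>ball3)
    = K * (\<integral>\<^sup>+h. \<phi> h * weight 5 h \<partial>lborel)"
proof -
  let ?pt = "\<lambda>j::nat. \<lambda>x :: real \<times> real. if j = 0 then fst x else snd x"
  let ?W = "\<lambda>x :: real \<times> real. ennreal \<bar>snd x - fst x\<bar>"
  let ?I = "\<lambda>a. \<integral>\<^sup>+y. ?W y * (\<Prod>j<2. slab (a \<bullet> ?pt j y, ?pt j y)) \<partial>lborel"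
  let ?K = "(slab_const TYPE(real))\<^sup>2 * (\<integral>\<^sup>+a. ennreal (sqrt (1 + a \<bullet> a)) * ?I a \<partial>lborel)"
  have mh[measurable]: "(\<lambda>p. signed_distance (line_coeffs (fst p) (snd p))) \<in> borel_measurable borel"
    unfolding line_coeffs_def Let_def by measurable
  \<comment> \<open>Exponent 5: two points x in dimension 1, the Jacobian |x2 - x1| of degree 1, and
    two chords.\<close>
  have d: "DIM(real \<times> real) + 1 + 2 = 5" by simp
  have pt: "?pt j ((x, x) + r *\<^sub>R y) = x + r *\<^sub>R ?pt j y" for j x r y by simp
  have W: "?W ((x, x) + r *\<^sub>R y) = ennreal (r ^ 1) * ?W y" if "r > 0" for x r y
    using that by (simp add: ennreal_mult'[symmetric] abs_mult flip: right_diff_distrib)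
  show ?thesis
  proof (rule that[of ?K])
    fix \<phi> :: "real \<Rightarrow> ennreal" assume phi[measurable]: "\<phi> \<in> borel_measurable borel"
    let ?h = "\<lambda>x z. signed_distance (line_coeffs x z)"
    let ?lhs = "\<integral>\<^sup>+y1. \<integral>\<^sup>+y2. \<phi> (?h (fst (snd y1), fst (snd y2)) (fst y1, fst y2)) \<partial>ball3 \<partial>ball3"
    let ?slabs = "\<integral>\<^sup>+x. \<integral>\<^sup>+z. \<phi> (?h x z) * (slab (fst z, fst x) * slab (snd z, snd x)) \<partial>lborel \<partial>lborel"
    have "?lhs
      = (slab_const TYPE(real))\<^sup>2 * ?slabs"
    proof -
      have "(\<lambda>t. ((snd (fst t), snd (snd t)), (fst (fst t), fst (snd t))) :: (real \<times> real) \<times> (real \<times> real)) \<in> borel_measurable borel"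
        by measurable
      from nn_integral_uniform_slab2[OF measurable_compose[OF measurable_compose[OF this mh] phi]]
      show ?thesis by simp
    qed
    also have "?slabs
      = (\<integral>\<^sup>+x. \<integral>\<^sup>+z. \<phi> (?h x z) * (\<Prod>j<2. slab (?pt j z, ?pt j x)) \<partial>lborel \<partial>lborel)"
      by (simp add: numeral_2_eq_2)
    also have "\<dots> = (\<integral>\<^sup>+a. ennreal (sqrt (1 + a \<bullet> a)) * ?I a \<partial>lborel) *
       (\<integral>\<^sup>+h. \<phi> h * weight (DIM(real \<times> real) + 1 + 2) h \<partial>lborel)"
    proof (rule hyperplane_height_law[where zc = ?pt and hgt = ?h and diag = "\<lambda>x. (x, x)"
         and zv = "\<lambda>a b x. (a * fst x + b, a * snd x + b)", OF pt W])
      show "AE x in lborel. (\<forall>\<Phi>\<in>borel_measurable borel. (\<integral>\<^sup>+z. \<Phi> z \<partial>lborel) = ?W x *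
          (\<integral>\<^sup>+a. \<integral>\<^sup>+b. \<Phi> (a * fst x + b, a * snd x + b) \<partial>lborel \<partial>lborel)) \<and>
          (\<forall>a b. ?h x (a * fst x + b, a * snd x + b) = b / sqrt (1 + a \<bullet> a))"
        using AE_pair_distinct
      proof eventually_elim
        case (elim x)
        have "line_coeffs x (a * fst x + b, a * snd x + b) = (a, b)" for a b
        proof -
          have "a * snd x + b - (a * fst x + b) = a * (snd x - fst x)" by (simp add: algebra_simps)
          then show ?thesis using elim by (simp add: line_coeffs_def Let_def)
        qed
        moreover have "(\<integral>\<^sup>+z. \<Phi> z \<partial>lborel) = ?W x * (\<integral>\<^sup>+a. \<integral>\<^sup>+b. \<Phi> (a * fst x + b, a * snd x + b) \<partial>lborel \<partial>lborel)"
          if "\<Phi> \<in> borel_measurable borel" for \<Phi> :: "real \<times> real \<Rightarrow> ennreal"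
          using nn_integral_line_coordinates[OF that, of "snd x - fst x" "fst x"] elim by simp
        ultimately show ?case by simp
      qed
    qed (use mh in \<open>simp_all add: split_beta\<close>)
    finally show "?lhs
      = ?K * (\<integral>\<^sup>+h. \<phi> h * weight 5 h \<partial>lborel)"
      by (simp only: d mult.assoc)
  qed
qed

lemma height_law_3:
  obtains K :: ennreal where "\<And>\<phi>. \<phi> \<in> borel_measurable borel \<Longrightarrow>
    (\<integral>\<^sup>+y1. \<integral>\<^sup>+y2. \<integral>\<^sup>+y3. \<phi> (signed_distance (plane_through y1 y2 y3))
      \<partial>ball4 \<partial>ball4 \<partial>ball4)
    = K * (\<integral>\<^sup>+h. \<phi> h * weight 11 h \<partial>lborel)"
proof -
  let ?pt = "\<lambda>j::nat. \<lambda>x :: (real \<times> real) \<times> (real \<times> real) \<times> (real \<times> real). if j = 0 then fst x else if j = 1 then fst (snd x) else snd (snd x)"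
  let ?zc = "\<lambda>j::nat. \<lambda>x :: real \<times> real \<times> real. if j = 0 then fst x else if j = 1 then fst (snd x) else snd (snd x)"
  let ?W = "\<lambda>x. ennreal \<bar>det3 x\<bar>"
  let ?I = "\<lambda>a. \<integral>\<^sup>+y. ?W y * (\<Prod>j<3. slab (a \<bullet> ?pt j y, ?pt j y)) \<partial>lborel"
  let ?K = "(slab_const TYPE(real \<times> real)) ^ 3 * (\<integral>\<^sup>+a. ennreal (sqrt (1 + a \<bullet> a)) * ?I a \<partial>lborel)"
  have mh[measurable]: "(\<lambda>p. signed_distance (plane_coeffs (fst p) (snd p))) \<in> borel_measurable borel"
    unfolding plane_coeffs_def Let_def by measurable
  \<comment> \<open>Exponent 11: three points x in dimension 2, the Jacobian \<open>det3\<close> of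
    degree 2, and three chords.\<close>
  have d: "DIM((real \<times> real) \<times> (real \<times> real) \<times> (real \<times> real)) + 2 + 3 = 11" by simp
  have pt: "?pt j ((x, x, x) + r *\<^sub>R y) = x + r *\<^sub>R ?pt j y" for j x r y by simp
  have W: "?W ((x, x, x) + r *\<^sub>R y) = ennreal (r ^ 2) * ?W y" if "r > 0" for x r y
  proof -
    have "det3 ((x, x, x) + r *\<^sub>R y) = r ^ 2 * det3 y"
      by (simp add: det3_def algebra_simps power2_eq_square)
    then show ?thesis by (simp add: ennreal_mult'[symmetric] abs_mult)
  qed
  show ?thesis
  proof (rule that[of ?K])
    fix \<phi> :: "real \<Rightarrow> ennreal" assume phi[measurable]: "\<phi> \<in> borel_measurable borel"
    let ?h = "\<lambda>x z. signed_distance (plane_coeffs x z)"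
    let ?lhs = "\<integral>\<^sup>+y1. \<integral>\<^sup>+y2. \<integral>\<^sup>+y3. \<phi> (?h (fst (snd y1), fst (snd y2), fst (snd y3)) (fst y1, fst y2, fst y3)) \<partial>ball4 \<partial>ball4 \<partial>ball4"
    let ?slabs = "\<integral>\<^sup>+x. \<integral>\<^sup>+z. \<phi> (?h x z) *
        (slab (fst z, fst x) * slab (fst (snd z), fst (snd x)) * slab (snd (snd z), snd (snd x))) \<partial>lborel \<partial>lborel"
    have "?lhs
      = (slab_const TYPE(real \<times> real)) ^ 3 * ?slabs"
    proof -
      have "(\<lambda>t. ((snd (fst t), snd (fst (snd t)), snd (snd (snd t))), (fst (fst t), fst (fst (snd t)), fst (snd (snd t))))
          :: ((real \<times> real) \<times> (real \<times> real) \<times> (real \<times> real)) \<times> (real \<times> real \<times> real)) \<in> borel_measurable borel"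
        by measurable
      from nn_integral_uniform_slab3[OF measurable_compose[OF measurable_compose[OF this mh] phi]]
      show ?thesis by simp
    qed
    also have "?slabs
      = (\<integral>\<^sup>+x. \<integral>\<^sup>+z. \<phi> (?h x z) * (\<Prod>j<3. slab (?zc j z, ?pt j x)) \<partial>lborel \<partial>lborel)"
      by (simp add: numeral_3_eq_3)
    also have "\<dots> = (\<integral>\<^sup>+a. ennreal (sqrt (1 + a \<bullet> a)) * ?I a \<partial>lborel) *
       (\<integral>\<^sup>+h. \<phi> h * weight (DIM((real \<times> real) \<times> (real \<times> real) \<times> (real \<times> real)) + 2 + 3) h \<partial>lborel)"
    proof (rule hyperplane_height_law[where zc = ?zc and hgt = ?h and diag = "\<lambda>x. (x, x, x)"
         and zv = "\<lambda>a b x. (a \<bullet> fst x + b, a \<bullet> fst (snd x) + b, a \<bullet> snd (snd x) + b)", OF pt W])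
      show "AE x in lborel. (\<forall>\<Phi>\<in>borel_measurable borel. (\<integral>\<^sup>+z. \<Phi> z \<partial>lborel) = ?W x *
          (\<integral>\<^sup>+a. \<integral>\<^sup>+b. \<Phi> (a \<bullet> fst x + b, a \<bullet> fst (snd x) + b, a \<bullet> snd (snd x) + b) \<partial>lborel \<partial>lborel)) \<and>
          (\<forall>a b. ?h x (a \<bullet> fst x + b, a \<bullet> fst (snd x) + b, a \<bullet> snd (snd x) + b) = b / sqrt (1 + a \<bullet> a))"
        using AE_triple_generic
      proof eventually_elim
        case (elim x)
        have "plane_coeffs x (a \<bullet> fst x + b, a \<bullet> fst (snd x) + b, a \<bullet> snd (snd x) + b) = (a, b)" for a b
        proof -
          let ?u = "fst (snd x) - fst x" and ?u' = "snd (snd x) - fst x"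
          let ?s = "fst a * fst ?u + snd a * snd ?u" and ?t = "fst a * fst ?u' + snd a * snd ?u'"
          have s: "a \<bullet> fst (snd x) + b - (a \<bullet> fst x + b) = ?s" "a \<bullet> snd (snd x) + b - (a \<bullet> fst x + b) = ?t"
            by (simp_all add: inner_prod_def algebra_simps)
          have "?s * snd ?u' - ?t * snd ?u = fst a * det3 x" "fst ?u * ?t - fst ?u' * ?s = snd a * det3 x"
            unfolding det3_def by algebra+
          then have "((?s * snd ?u' - ?t * snd ?u) / det3 x, (fst ?u * ?t - fst ?u' * ?s) / det3 x) = a"
            using elim by (simp only: nonzero_mult_div_cancel_right not_False_eq_True prod.collapse)
          then show ?thesis
            by (simp only: plane_coeffs_def Let_def fst_conv snd_conv s) simp
        qed
        moreover have "(\<integral>\<^sup>+z. \<Phi> z \<partial>lborel) = ?W x * (\<integral>\<^sup>+a. \<integral>\<^sup>+b. \<Phi> (a \<bullet> fst x + b, a \<bullet> fst (snd x) + b, a \<bullet> snd (snd x) + b) \<partial>lborel \<partial>lborel)"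
          if "\<Phi> \<in> borel_measurable borel" for \<Phi> :: "real \<times> real \<times> real \<Rightarrow> ennreal"
          using nn_integral_plane_coordinates[OF that, of "fst (snd x) - fst x" "snd (snd x) - fst x" "fst x"] elim
          by (simp add: det3_def)
        ultimately show ?case by simp
      qed
    qed (use mh in \<open>simp_all add: split_beta\<close>)
    finally show "?lhs
      = ?K * (\<integral>\<^sup>+h. \<phi> h * weight 11 h \<partial>lborel)"
      by (simp only: d mult.assoc)
  qed
qed

subsection \<open>Two points on the same side of a random hyperplane\<close>

declare emeasure_uniform_measure [simp del]

lemma prob_space_unif_ball: "prob_space (unif_ball :: 'a::euclidean_space measure)"
  by (intro prob_space_uniform_measure emeasure_cball_unit)

lemma AE_unif_ball_hyperplane:
  fixes \<nu> :: "'a::euclidean_space"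
  assumes "\<nu> \<noteq> 0"
  shows "AE y in unif_ball. \<nu> \<bullet> y \<noteq> \<beta>"
proof -
  have "{y. \<nu> \<bullet> y = \<beta>} \<in> null_sets lebesgue"
    using negligible_hyperplane[of \<nu> \<beta>] assms by (simp add: negligible_iff_null_sets)
  then have "AE y in lebesgue. \<nu> \<bullet> y \<noteq> \<beta>"
    using AE_not_in[of "{y. \<nu> \<bullet> y = \<beta>}" lebesgue] by simp
  then have "AE y in lborel. \<nu> \<bullet> y \<noteq> \<beta>"
    by (simp add: AE_completion_iff)
  then show ?thesis by (intro AE_unif_ballI) auto
qed

text \<open>The unknown volume factor c is the same for all h. At h = -1 the halfspace contains
  almost all of the ball, so c is 1 / I(-1).\<close>

lemma emeasure_halfspace_ratio:
  fixes \<nu> :: "'b::euclidean_space coords" and I :: "real \<Rightarrow> real"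
  assumes \<nu>: "norm \<nu> = 1" and h: "-1 \<le> h" "h \<le> 1"
    and I: "\<And>h. -1 \<le> h \<Longrightarrow> h \<le> 1 \<Longrightarrow>
      (\<integral>\<^sup>+z. ennreal (indicator {h<..<1} z * sqrt (1 - z\<^sup>2) ^ (DIM('b) + 1)) \<partial>lborel) = ennreal (I h)"
    and pos: "I (-1) > 0"
  shows "emeasure unif_ball {y. \<nu> \<bullet> y > h} = ennreal (I h / I (-1))"
proof -
  interpret prob_space "unif_ball :: ('b coords) measure" by (rule prob_space_unif_ball)
  define c where "c = ennreal (unit_ball_vol (DIM('b) + 1)) / emeasure lborel (cball 0 1 :: ('b coords) set)"
  have c: "emeasure unif_ball {y. \<nu> \<bullet> y > h} = c * ennreal (I h)" if "-1 \<le> h" "h \<le> 1" for h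
    unfolding c_def emeasure_halfspace_unif_ball[OF \<nu> that] I[OF that] ..
  have "AE y in unif_ball. \<nu> \<bullet> y > -1"
  proof -
    have "AE y in (unif_ball :: ('b coords) measure). y \<in> cball 0 1"
      by (intro AE_unif_ballI) auto
    moreover have "AE y in unif_ball. \<nu> \<bullet> y \<noteq> -1"
      using \<nu> by (intro AE_unif_ball_hyperplane) auto
    ultimately show ?thesis
    proof eventually_elim
      case (elim y)
      have "\<bar>\<nu> \<bullet> y\<bar> \<le> norm \<nu> * norm y" by (rule Cauchy_Schwarz_ineq2)
      with elim \<nu> show ?case by simp
    qed
  qed
  then have "emeasure unif_ball {y. \<nu> \<bullet> y > -1} = 1"
    by (intro emeasure_eq_1_AE) simp_all
  then have "c * ennreal (I (-1)) = 1" using c[of "-1"] by simp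
  have "c = c * ennreal (I (-1)) * ennreal (1 / I (-1))"
    using pos by (simp add: mult.assoc ennreal_mult'[symmetric])
  then have "c = ennreal (1 / I (-1))" by (simp only: \<open>c * ennreal (I (-1)) = 1\<close> mult_1)
  then show ?thesis using c[OF h] pos by (simp add: ennreal_mult''[symmetric] ennreal_mult'[symmetric])
qed

lemma emeasure_halfspace_ball3:
  fixes \<nu> :: "real \<times> real \<times> real"
  assumes \<nu>: "norm \<nu> = 1" and h: "-1 \<le> h" "h \<le> 1"
  shows "emeasure ball3 {y. \<nu> \<bullet> y > h} = ennreal (1 / 2 - (3 * h - h ^ 3) / 4)"
proof -
  have "emeasure ball3 {y. \<nu> \<bullet> y > h} = ennreal ((2 / 3 - (h - h ^ 3 / 3)) / (2 / 3 - (-1 - (-1) ^ 3 / 3)))"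
  proof (rule emeasure_halfspace_ratio[OF \<nu> h, of "\<lambda>h. 2 / 3 - (h - h ^ 3 / 3)"])
    fix h :: real assume "-1 \<le> h" "h \<le> 1"
    then show "(\<integral>\<^sup>+z. ennreal (indicator {h<..<1} z * sqrt (1 - z\<^sup>2) ^ (DIM(real) + 1)) \<partial>lborel) = ennreal (2 / 3 - (h - h ^ 3 / 3))"
      using nn_integral_marginal_2 by (simp only: DIM_real one_add_one)
  qed (simp add: power3_eq_cube)
  also have "(2 / 3 - (h - h ^ 3 / 3)) / (2 / 3 - (-1 - (-1) ^ 3 / 3)) = 1 / 2 - (3 * h - h ^ 3) / 4"
    by (simp add: field_simps)
  finally show ?thesis .
qed

lemma emeasure_halfspace_ball4:
  fixes \<nu> :: "(real \<times> real) coords"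
  assumes \<nu>: "norm \<nu> = 1" and h: "-1 \<le> h" "h \<le> 1"
  shows "emeasure ball4 {y. \<nu> \<bullet> y > h} = ennreal (1 / 2 - cap_excess h / (3 * pi))"
proof -
  let ?I = "\<lambda>h. 3 * pi / 16 - cap_excess h / 8"
  have "emeasure ball4 {y. \<nu> \<bullet> y > h} = ennreal (?I h / ?I (-1))"
  proof (rule emeasure_halfspace_ratio[OF \<nu> h, of ?I])
    have d: "DIM(real \<times> real) + 1 = 3" by simp
    fix h :: real assume "-1 \<le> h" "h \<le> 1"
    then show "(\<integral>\<^sup>+z. ennreal (indicator {h<..<1} z * sqrt (1 - z\<^sup>2) ^ (DIM(real \<times> real) + 1)) \<partial>lborel) = ennreal (?I h)"
      using nn_integral_marginal_3 by (simp only: d)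
  qed simp
  also have "?I h / ?I (-1) = 1 / 2 - cap_excess h / (3 * pi)"
    by (simp add: field_simps)
  finally show ?thesis .
qed

text \<open>An unnormalised signed distance from the hyperplane z = a . x + b. The coordinate w does
  not enter because the hyperplane contains the w-direction.\<close>

definition side :: "'b::euclidean_space \<times> real \<Rightarrow> 'b coords \<Rightarrow> real" where
  "side P y = fst y - fst P \<bullet> fst (snd y) - snd P"

text \<open>The mass below height h is expressed as the mass above -h by reflection; by rotation
  invariance the first axis can stand for every unit normal.\<close>

definition same_side :: "'b::euclidean_space itself \<Rightarrow> real \<Rightarrow> ennreal" where
  "same_side _ h = (emeasure unif_ball {y :: 'b coords. (1, 0) \<bullet> y > h})\<^sup>2 +
     (emeasure unif_ball {y :: 'b coords. (1, 0) \<bullet> y > - h})\<^sup>2"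

lemma same_side_measurable [measurable]: "same_side TYPE('b::euclidean_space) \<in> borel_measurable borel"
proof -
  interpret prob_space "unif_ball :: ('b coords) measure" by (rule prob_space_unif_ball)
  have m: "(\<lambda>h. emeasure unif_ball {y :: 'b coords. (1, 0) \<bullet> y > h}) \<in> borel_measurable borel"
  proof -
    have "(\<lambda>h. \<integral>\<^sup>+y. indicator {y :: 'b coords. (1, 0) \<bullet> y > h} y \<partial>unif_ball) \<in> borel_measurable borel"
      by measurable
    then show ?thesis by simp
  qed
  have "(\<lambda>h. emeasure unif_ball {y :: 'b coords. (1, 0) \<bullet> y > - h}) \<in> borel_measurable borel"
    using measurable_compose[OF borel_measurable_uminus[OF measurable_ident] m] by simp
  with m show ?thesis unfolding same_side_def[abs_def] by measurable
qed

lemma side_measurable [measurable]: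
  "side P \<in> borel_measurable borel"
  unfolding side_def[abs_def] by measurable

lemma side_halfspace:
  fixes P :: "'b::euclidean_space \<times> real"
  defines "\<nu> \<equiv> (1 / sqrt (1 + fst P \<bullet> fst P)) *\<^sub>R (1, - fst P, 0) :: 'b coords"
  shows "norm \<nu> = 1" and "side P y > 0 \<longleftrightarrow> \<nu> \<bullet> y > signed_distance P" and "side P y = 0 \<longleftrightarrow> \<nu> \<bullet> y = signed_distance P"
    and "side P y < 0 \<longleftrightarrow> - \<nu> \<bullet> y > - signed_distance P"
proof -
  let ?q = "sqrt (1 + fst P \<bullet> fst P)"
  have q: "?q > 0" by (simp add: add_pos_nonneg)
  have "norm (1 :: real, - fst P, 0 :: real) = ?q"
    by (simp add: norm_prod_def dot_square_norm)
  then show "norm \<nu> = 1" unfolding \<nu>_def norm_scaleR using q by simp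
  have "\<nu> \<bullet> y = (fst y - fst P \<bullet> fst (snd y)) / ?q"
    by (simp add: \<nu>_def inner_prod_def diff_divide_distrib)
  then have "\<nu> \<bullet> y - signed_distance P = side P y / ?q"
    by (simp add: side_def diff_divide_distrib)
  then have *: "side P y = ?q * (\<nu> \<bullet> y - signed_distance P)" using q by simp
  show "side P y > 0 \<longleftrightarrow> \<nu> \<bullet> y > signed_distance P" unfolding * using q by (simp add: zero_less_mult_iff)
  show "side P y = 0 \<longleftrightarrow> \<nu> \<bullet> y = signed_distance P" unfolding * using q by simp
  show "side P y < 0 \<longleftrightarrow> - \<nu> \<bullet> y > - signed_distance P" unfolding * using q by (simp add: mult_less_0_iff)
qed

lemma AE_side_nonzero: "AE y in unif_ball. side P y \<noteq> 0"
proof -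
  let ?\<nu> = "(1 / sqrt (1 + fst P \<bullet> fst P)) *\<^sub>R (1, - fst P, 0) :: real \<times> _ \<times> real"
  have "?\<nu> \<noteq> 0" using side_halfspace(1)[of P] by (metis norm_zero zero_neq_one)
  then show ?thesis unfolding side_halfspace(3) by (rule AE_unif_ball_hyperplane)
qed

lemma same_side_probability:
  fixes P :: "'b::euclidean_space \<times> real"
  shows "(\<integral>\<^sup>+y. \<integral>\<^sup>+y'. indicator {t. t > 0} (side P y * side P y') \<partial>unif_ball \<partial>unif_ball) = same_side TYPE('b) (signed_distance P)"
proof -
  let ?U = "unif_ball :: ('b coords) measure"
  let ?A = "{y. side P y > 0}" and ?B = "{y. side P y < 0}"
  let ?\<nu> = "(1 / sqrt (1 + fst P \<bullet> fst P)) *\<^sub>R (1, - fst P, 0) :: 'b coords"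
  have "(\<integral>\<^sup>+y. \<integral>\<^sup>+y'. indicator {t. t > 0} (side P y * side P y') \<partial>?U \<partial>?U)
    = (\<integral>\<^sup>+y. \<integral>\<^sup>+y'. indicator ?A y * indicator ?A y' + indicator ?B y * indicator ?B y' \<partial>?U \<partial>?U)"
    by (intro nn_integral_cong) (auto simp: indicator_def zero_less_mult_iff)
  also have "\<dots> = (emeasure ?U ?A)\<^sup>2 + (emeasure ?U ?B)\<^sup>2"
    by (simp add: nn_integral_add nn_integral_cmult nn_integral_multc power2_eq_square)
  also have "emeasure ?U ?A = emeasure ?U {y. (1, 0) \<bullet> y > signed_distance P}"
    unfolding side_halfspace(2) by (rule emeasure_halfspace_rotate) (simp only: side_halfspace(1), simp)
  also have "emeasure ?U ?B = emeasure ?U {y. (1, 0) \<bullet> y > - signed_distance P}"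
    unfolding side_halfspace(4) by (rule emeasure_halfspace_rotate) (simp only: norm_minus_cancel side_halfspace(1), simp)
  finally show ?thesis by (simp add: same_side_def)
qed

text \<open>The two sides have masses 1/2 - F and 1/2 + F, whose squares add up to 1/2 + 2
  F^2.\<close>

lemma same_side_real:
  fixes F :: "real \<Rightarrow> real"
  assumes F: "\<And>h. -1 \<le> h \<Longrightarrow> h \<le> 1 \<Longrightarrow> emeasure unif_ball {y :: 'b::euclidean_space coords. (1, 0) \<bullet> y > h} = ennreal (1 / 2 - F h)"
    and odd': "\<And>h. -1 \<le> h \<Longrightarrow> h \<le> 1 \<Longrightarrow> F (- h) = - F h" and h: "-1 \<le> h" "h \<le> 1"
  shows "same_side TYPE('b) h = ennreal (1 / 2 + 2 * (F h)\<^sup>2)"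
proof -
  interpret prob_space "unif_ball :: ('b coords) measure" by (rule prob_space_unif_ball)
  have odd: "F (- h) = - F h" using odd' h by blast
  define A where "A h = {y :: 'b coords. (1, 0) \<bullet> y > h}" for h
  have "emeasure unif_ball (A h) + emeasure unif_ball (A (-h)) \<ge> 1"
  proof -
    let ?B = "{y :: 'b coords. - ((1, 0)) \<bullet> y > - h}"
    have B: "emeasure unif_ball ?B = emeasure unif_ball (A (-h))"
      unfolding A_def by (rule emeasure_halfspace_rotate) simp
    have "AE y in unif_ball. (1, 0) \<bullet> (y :: 'b coords) \<noteq> h"
      by (rule AE_unif_ball_hyperplane) (simp add: zero_prod_def)
    then have "AE y in unif_ball. y \<in> A h \<union> ?B"
      by eventually_elim (auto simp: A_def)
    then have "emeasure unif_ball (A h \<union> ?B) = 1"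
      by (intro emeasure_eq_1_AE) (auto simp: A_def)
    moreover have "emeasure unif_ball (A h \<union> ?B) \<le> emeasure unif_ball (A h) + emeasure unif_ball ?B"
      by (rule emeasure_subadditive) (auto simp: A_def)
    ultimately have "1 \<le> emeasure unif_ball (A h) + emeasure unif_ball ?B" by (simp only:)
    then show ?thesis by (simp only: B)
  qed
  then have sum: "ennreal (1 / 2 - F h) + ennreal (1 / 2 + F h) \<ge> 1"
    using F[of h] F[of "- h"] h by (simp add: A_def odd)
  have le: "ennreal (1 / 2 - F h) \<le> 1" "ennreal (1 / 2 + F h) \<le> 1"
    using F[of h] F[of "- h"] h emeasure_le_1 by (metis A_def odd diff_minus_eq_add neg_le_iff_le minus_le_iff)+
  \<comment> \<open>\<open>ennreal\<close> truncates negative numbers, so positivity is a real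
    question. Both numbers are at most 1 and they add up to 1, hence neither is negative.\<close>
  have nonneg: "0 \<le> 1 / 2 - F h \<and> 0 \<le> 1 / 2 + F h"
  proof (rule ccontr)
    assume "\<not> ?thesis"
    then consider "1 / 2 - F h < 0" | "1 / 2 + F h < 0" by linarith
    then show False
      using le unfolding ennreal_le_1 by cases linarith+
  qed
  then show ?thesis
    using F[of h] F[of "- h"] h
    by (simp add: same_side_def odd ennreal_power flip: ennreal_plus) (simp add: power2_eq_square algebra_simps)
qed

lemma same_side_ball3:
  assumes "-1 \<le> h" "h \<le> 1"
  shows "same_side TYPE(real) h = ennreal (1 / 2 + 2 * ((3 * h - h ^ 3) / 4)\<^sup>2)"
proof (rule same_side_real[OF _ _ assms])
  fix h :: real assume h: "-1 \<le> h" "h \<le> 1"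
  show "emeasure ball3 {y. (1, 0) \<bullet> y > h} = ennreal (1 / 2 - (3 * h - h ^ 3) / 4)"
    by (rule emeasure_halfspace_ball3[OF _ h]) simp
  show "(3 * - h - (- h) ^ 3) / 4 = - ((3 * h - h ^ 3) / 4)"
    by (simp add: power3_eq_cube field_simps)
qed

lemma same_side_ball4:
  assumes "-1 \<le> h" "h \<le> 1"
  shows "same_side TYPE(real \<times> real) h =
    ennreal (1 / 2 + 2 * (cap_excess h / (3 * pi))\<^sup>2)"
proof (rule same_side_real[OF _ _ assms])
  fix h :: real assume h: "-1 \<le> h" "h \<le> 1"
  show "emeasure ball4 {y. (1, 0) \<bullet> y > h} = ennreal (1 / 2 - cap_excess h / (3 * pi))"
    by (rule emeasure_halfspace_ball4[OF _ h]) simp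
  show "(- h * (5 - 2 * (- h)\<^sup>2) * sqrt (1 - (- h)\<^sup>2) + 3 * arcsin (- h)) / (3 * pi) =
    - (cap_excess h / (3 * pi))"
    by (simp add: arcsin_minus[OF h] field_simps)
qed

text \<open>Eliminates the unknown constant: the second equation forces K = 1 / y, in particular
  that K is finite.\<close>

lemma ennreal_ratio:
  assumes "a = K * ennreal x" "1 = K * ennreal y" "y > 0" "x \<ge> 0"
  shows "a = ennreal (x / y)"
proof -
  have "K = K * ennreal y * ennreal (1 / y)"
    using assms(3) by (simp add: mult.assoc ennreal_mult'[symmetric])
  then have "K = ennreal (1 / y)" using assms(2) by simp
  then show ?thesis using assms by (simp add: ennreal_mult'[symmetric])
qed

lemma same_side_probability_3:
  "(\<integral>\<^sup>+y1. \<integral>\<^sup>+y2. \<integral>\<^sup>+y. \<integral>\<^sup>+y'. indicator {t. t > 0}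
      (side (line_through y1 y2) y *
       side (line_through y1 y2) y') \<partial>ball3 \<partial>ball3 \<partial>ball3 \<partial>ball3)
   = ennreal (1573 / 2560)"
proof -
  interpret prob_space ball3 by (rule prob_space_unif_ball)
  let ?w = "\<lambda>h. weight 5 h"
  obtain K where K: "\<And>\<phi>. \<phi> \<in> borel_measurable borel \<Longrightarrow>
    (\<integral>\<^sup>+y1. \<integral>\<^sup>+y2. \<phi> (signed_distance (line_through y1 y2)) \<partial>ball3 \<partial>ball3)
    = K * (\<integral>\<^sup>+h. \<phi> h * ?w h \<partial>lborel)"
    using height_law_2 by blast
  \<comment> \<open>The constant function 1 integrates to 1 over the two points, which normalises
    \<open>K\<close>.\<close>
  have one: "1 = K * ennreal (5 * pi / 16)"
    using K[of "\<lambda>_. 1"] nn_integral_weight_5 emeasure_space_1 by simp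
  have "(\<integral>\<^sup>+h. same_side TYPE(real) h * ?w h \<partial>lborel) =
      (\<integral>\<^sup>+h. ennreal (indicator {-1<..<1} h * ((1 / 2 + 2 * ((3 * h - h ^ 3) / 4)\<^sup>2) * sqrt (1 - h\<^sup>2) ^ 5)) \<partial>lborel)"
  proof (rule nn_integral_cong)
    fix h :: real
    show "same_side TYPE(real) h * ?w h = ennreal (indicator {-1<..<1} h * ((1 / 2 + 2 * ((3 * h - h ^ 3) / 4)\<^sup>2) * sqrt (1 - h\<^sup>2) ^ 5))"
      by (cases "h \<in> {-1<..<1}") (simp_all add: same_side_ball3 ennreal_mult'[symmetric] del: ennreal_plus)
  qed
  also have "\<dots> = ennreal (1573 * pi / 8192)"
    by (rule nn_integral_same_side_5)
  finally have "K * (\<integral>\<^sup>+h. same_side TYPE(real) h * ?w h \<partial>lborel) = K * ennreal (1573 * pi / 8192)"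
    by simp
  then have "K * (\<integral>\<^sup>+h. same_side TYPE(real) h * ?w h \<partial>lborel) = ennreal ((1573 * pi / 8192) / (5 * pi / 16))"
    using one by (rule ennreal_ratio) simp_all
  also have "(1573 * pi / 8192) / (5 * pi / 16) = 1573 / 2560" by simp
  finally show ?thesis
    unfolding same_side_probability using K[of "same_side TYPE(real)"] by simp
qed

lemma ennreal_linear_combination:
  "0 \<le> a \<Longrightarrow> 0 \<le> y \<Longrightarrow> 0 \<le> b \<Longrightarrow> 0 \<le> z \<Longrightarrow>
    ennreal (a * y + b * z) = ennreal a * ennreal y + ennreal b * ennreal z"
  by (simp add: ennreal_mult)

lemma nn_integral_same_side_11:
  "(\<integral>\<^sup>+h. ennreal (indicator {-1<..<1} h * ((1 / 2 + 2 * (cap_excess h / (3 * pi))\<^sup>2) * sqrt (1 - h\<^sup>2) ^ 11)) \<partial>lborel)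
   = ennreal (1 / 2 * (231 * pi / 1024) + 2 / (9 * pi\<^sup>2) * (- 18614167 / 22937600 * pi + 693 / 4096 * pi ^ 3))"
proof -
  let ?G = cap_excess
  let ?w = "\<lambda>h. weight 11 h"
  let ?v = "\<lambda>h. ennreal (indicator {-1<..<1} h * ((?G h)\<^sup>2 * sqrt (1 - h\<^sup>2) ^ 11))"
  have [measurable]: "?v \<in> borel_measurable borel"
  proof -
    have "continuous_on {-1<..<1} (\<lambda>h. (?G h)\<^sup>2 * sqrt (1 - h\<^sup>2) ^ 11)"
      by (auto intro!: continuous_intros)
    from borel_measurable_continuous_on_indicator[OF _ this]
    have "(\<lambda>h. indicator {-1<..<1} h * ((?G h)\<^sup>2 * sqrt (1 - h\<^sup>2) ^ 11)) \<in> borel_measurable borel" by simp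
    then show ?thesis by measurable
  qed
  have "(\<integral>\<^sup>+h. ennreal (indicator {-1<..<1} h * ((1 / 2 + 2 * (?G h / (3 * pi))\<^sup>2) * sqrt (1 - h\<^sup>2) ^ 11)) \<partial>lborel)
     = (\<integral>\<^sup>+h. ennreal (1 / 2) * ?w h + ennreal (2 / (9 * pi\<^sup>2)) * ?v h \<partial>lborel)"
  proof (rule nn_integral_cong)
    fix h :: real
    have eq: "(1 / 2 + 2 * (x / (3 * pi))\<^sup>2) * y = 1 / 2 * y + 2 / (9 * pi\<^sup>2) * (x\<^sup>2 * y)" for x y :: real
      by (simp add: field_simps power2_eq_square)
    show "ennreal (indicator {-1<..<1} h * ((1 / 2 + 2 * (?G h / (3 * pi))\<^sup>2) * sqrt (1 - h\<^sup>2) ^ 11))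
      = ennreal (1 / 2) * ?w h + ennreal (2 / (9 * pi\<^sup>2)) * ?v h"
    proof (cases "h \<in> {-1<..<1}")
      case True
      then have "\<bar>h\<bar> < 1" by auto
      then have h2: "h\<^sup>2 \<le> 1" using abs_square_less_1[of h] by simp
      have "indicator {-1<..<1} h = (1::real)" using True by simp
      then show ?thesis by (simp only: eq mult_1) (rule ennreal_linear_combination, simp, simp add: h2, simp, intro mult_nonneg_nonneg, rule zero_le_power2, rule zero_le_power, simp add: h2)
    qed simp
  qed
  also have "\<dots> = ennreal (1 / 2) * (\<integral>\<^sup>+h. ?w h \<partial>lborel) + ennreal (2 / (9 * pi\<^sup>2)) * (\<integral>\<^sup>+h. ?v h \<partial>lborel)"
    by (subst nn_integral_add) (measurable, simp_all add: nn_integral_cmult)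
  also have "\<dots> = ennreal (1 / 2) * ennreal (231 * pi / 1024) + ennreal (2 / (9 * pi\<^sup>2)) * ennreal (- 18614167 / 22937600 * pi + 693 / 4096 * pi ^ 3)"
    unfolding nn_integral_weight_11 nn_integral_cap_excess_square ..
  also have "\<dots> = ennreal (1 / 2 * (231 * pi / 1024) + 2 / (9 * pi\<^sup>2) * (- 18614167 / 22937600 * pi + 693 / 4096 * pi ^ 3))"
  proof -
    \<comment> \<open>\<open>ennreal\<close> splits over a sum only for nonnegative terms; pi > 3 is
      precise enough here, as 9 * 693 / 4096 exceeds 18614167 / 22937600.\<close>
    have "9 \<le> pi\<^sup>2" using pi_gt3 power_mono[of 3 pi 2] by simp
    then have "0 \<le> pi * (- 18614167 / 22937600 + 693 / 4096 * pi\<^sup>2)" by (intro mult_nonneg_nonneg) auto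
    then have "0 \<le> - 18614167 / 22937600 * pi + 693 / 4096 * pi ^ 3"
      by (simp add: power2_eq_square power3_eq_cube algebra_simps)
    then show ?thesis
      by (intro ennreal_linear_combination[symmetric]) simp_all
  qed
  finally show ?thesis .
qed

lemma same_side_probability_4:
  "(\<integral>\<^sup>+y1. \<integral>\<^sup>+y2. \<integral>\<^sup>+y3. \<integral>\<^sup>+y. \<integral>\<^sup>+y'. indicator {t. t > 0}
      (side (plane_through y1 y2 y3) y *
       side (plane_through y1 y2 y3) y')
       \<partial>ball4 \<partial>ball4 \<partial>ball4 \<partial>ball4 \<partial>ball4)
   = ennreal (2 / 3 - 1692197 / (2116800 * pi\<^sup>2))"
proof -
  interpret prob_space ball4 by (rule prob_space_unif_ball)
  let ?w = "\<lambda>h. weight 11 h"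
  let ?v = "1 / 2 * (231 * pi / 1024) + 2 / (9 * pi\<^sup>2) * (- 18614167 / 22937600 * pi + 693 / 4096 * pi ^ 3)"
  obtain K where K: "\<And>\<phi>. \<phi> \<in> borel_measurable borel \<Longrightarrow>
    (\<integral>\<^sup>+y1. \<integral>\<^sup>+y2. \<integral>\<^sup>+y3. \<phi> (signed_distance (plane_through y1 y2 y3))
       \<partial>ball4 \<partial>ball4 \<partial>ball4)
    = K * (\<integral>\<^sup>+h. \<phi> h * ?w h \<partial>lborel)"
    using height_law_3 by blast
  have one: "1 = K * ennreal (231 * pi / 1024)"
    using K[of "\<lambda>_. 1"] nn_integral_weight_11 emeasure_space_1 by simp
  have "(\<integral>\<^sup>+h. same_side TYPE(real \<times> real) h * ?w h \<partial>lborel) =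
      (\<integral>\<^sup>+h. ennreal (indicator {-1<..<1} h * ((1 / 2 + 2 * (cap_excess h / (3 * pi))\<^sup>2) * sqrt (1 - h\<^sup>2) ^ 11)) \<partial>lborel)"
  proof (rule nn_integral_cong)
    fix h :: real
    show "same_side TYPE(real \<times> real) h * ?w h =
      ennreal (indicator {-1<..<1} h * ((1 / 2 + 2 * (cap_excess h / (3 * pi))\<^sup>2) * sqrt (1 - h\<^sup>2) ^ 11))"
      by (cases "h \<in> {-1<..<1}") (simp_all add: same_side_ball4 ennreal_mult'[symmetric] del: ennreal_plus)
  qed
  also have "\<dots> = ennreal ?v"
    by (rule nn_integral_same_side_11)
  finally have "K * (\<integral>\<^sup>+h. same_side TYPE(real \<times> real) h * ?w h \<partial>lborel) = K * ennreal ?v"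
    by simp
  moreover have "?v \<ge> 0"
  proof -
    have "9 \<le> pi\<^sup>2" using pi_gt3 power_mono[of 3 pi 2] by simp
    then have "0 \<le> pi * (- 18614167 / 22937600 + 693 / 4096 * pi\<^sup>2)" by (intro mult_nonneg_nonneg) auto
    then have "0 \<le> - 18614167 / 22937600 * pi + 693 / 4096 * pi ^ 3"
      by (simp add: power2_eq_square power3_eq_cube algebra_simps)
    moreover have "0 \<le> 1 / 2 * (231 * pi / 1024) + 2 / (9 * pi\<^sup>2) * t" if "0 \<le> t" for t
      using that by simp
    ultimately show ?thesis by blast
  qed
  ultimately have "K * (\<integral>\<^sup>+h. same_side TYPE(real \<times> real) h * ?w h \<partial>lborel) = ennreal (?v / (231 * pi / 1024))"
    using one by (intro ennreal_ratio) simp_all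
  also have "?v / (231 * pi / 1024) = 2 / 3 - 1692197 / (2116800 * pi\<^sup>2)"
    by (simp add: field_simps power2_eq_square power3_eq_cube)
  finally show ?thesis
    unfolding same_side_probability using K[of "same_side TYPE(real \<times> real)"] by simp
qed

subsection \<open>Random simplices\<close>

lemma measurable_unif_ball_component:
  "i \<in> I \<Longrightarrow> (\<lambda>x. x i) \<in> borel_measurable (PiM I (\<lambda>_. unif_ball :: 'a::euclidean_space measure))"
proof -
  assume "i \<in> I"
  then have "(\<lambda>x. x i) \<in> measurable (PiM I (\<lambda>_. unif_ball)) (unif_ball :: 'a measure)"
    by (rule measurable_component_singleton)
  also have "measurable (PiM I (\<lambda>_. unif_ball)) (unif_ball :: 'a measure) = borel_measurable (PiM I (\<lambda>_. unif_ball))"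
    by (rule measurable_cong_sets) simp_all
  finally show ?thesis .
qed

lemma product_sigma_finite_unif_ball: "product_sigma_finite (\<lambda>_. unif_ball :: 'a::euclidean_space measure)"
  by (intro product_sigma_finite.intro prob_space_imp_sigma_finite prob_space_unif_ball)

context simplex_enum
begin

text \<open>The rows are made independent one after another: row \<open>j\<close> avoids the span of the earlier ones.\<close>

lemma AE_det_rows:
  fixes R :: "'n \<Rightarrow> real^'n" and x0 :: "real^'n"
  assumes "finite K" "K \<subseteq> {1..CARD('n)}"
    and "\<And>c. (\<Sum>j | p j \<notin> K. c j *\<^sub>R R j) = 0 \<Longrightarrow> (\<forall>j. p j \<notin> K \<longrightarrow> c j = 0)"
  shows "(\<integral>\<^sup>+x. indicator {0} (det (\<chi> j. if p j \<in> K then x (p j) - x0 else R j)) \<partial>(PiM K (\<lambda>_. unif_ball))) = 0"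
  using assms
proof (induction K arbitrary: R rule: finite_induct)
  interpret product_sigma_finite "\<lambda>_::nat. unif_ball :: (real^'n) measure"
    by (rule product_sigma_finite_unif_ball)
  case empty
  have "invertible ((\<chi> j. R j) :: real^'n^'n)"
  proof -
    have "\<exists>B. (\<chi> j. R j) ** B = mat (1::real)"
      unfolding matrix_right_invertible_independent_rows
      using empty by (simp add: row_eq_nth scalar_mult_eq_scaleR)
    then show ?thesis by (simp add: invertible_right_inverse)
  qed
  then show ?case
    by (simp add: invertible_det_nz)
next
  interpret product_sigma_finite "\<lambda>_::nat. unif_ball :: (real^'n) measure"
    by (rule product_sigma_finite_unif_ball)
  case (insert i K)
  then obtain m where m: "i = p m"
    using p by (metis bij_betw_imp_surj_on imageE insert_subset)
  let ?N = "{j. p j \<notin> insert i K}"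
  have N: "{j. p j \<notin> K} = insert m ?N" "m \<notin> ?N"
    using insert.hyps m inj_p by (auto dest: injD)
  let ?S = "span (R ` ?N)"
  let ?f = "\<lambda>x. indicator {0} (det (\<chi> j. if p j \<in> insert i K then x (p j) - x0 else R j)) :: ennreal"
  have mf: "?f \<in> borel_measurable (PiM (insert i K) (\<lambda>_. unif_ball))"
  proof -
    have "(\<lambda>x. det (\<chi> j. if p j \<in> insert i K then x (p j) - x0 else R j) :: real) \<in> borel_measurable (PiM (insert i K) (\<lambda>_. unif_ball))"
    proof (rule borel_measurable_det)
      fix a b
      show "(\<lambda>x. (\<chi> j. if p j \<in> insert i K then x (p j) - x0 else R j) $ a $ b) \<in> borel_measurable (PiM (insert i K) (\<lambda>_. unif_ball))"
      proof (cases "p a \<in> insert i K")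
        case True
        then have "(\<lambda>x. x (p a)) \<in> borel_measurable (PiM (insert i K) (\<lambda>_. unif_ball :: (real^'n) measure))"
          by (rule measurable_unif_ball_component)
        moreover have "(\<lambda>y. (y - x0) $ b) \<in> borel_measurable borel"
          by (intro borel_measurable_continuous_onI continuous_intros)
        ultimately show ?thesis using True by (simp add: measurable_compose del: vector_minus_component)
      qed simp
    qed
    then show ?thesis by measurable
  qed
  have "AE y in lborel. y \<notin> (+) x0 ` ?S"
  proof -
    \<comment> \<open>The fixed rows number fewer than d because row m is still free, so their span
      is a null set. It is shifted by \<open>x0\<close> since row m will be
      \<open>y - x0\<close>.\<close>
    have "dim ?S \<le> card (R ` ?N)" by (simp add: dim_le_card')
    also have "\<dots> \<le> card ?N" by (rule card_image_le) simp
    also have "\<dots> < CARD('n)" using N(2) by (intro psubset_card_mono) auto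
    finally have "negligible ?S" by (intro negligible_lowdim) simp
    then have "(+) x0 ` ?S \<in> null_sets lebesgue"
      using negligible_translation[of ?S x0] by (simp add: negligible_iff_null_sets)
    then have "AE y in lebesgue. y \<notin> (+) x0 ` ?S" by (rule AE_not_in)
    then show ?thesis by (simp add: AE_completion_iff)
  qed
  moreover have "(+) x0 ` ?S \<in> sets borel" by (intro borel_closed closed_translation closed_span)
  ultimately have "AE y in unif_ball. y \<notin> (+) x0 ` ?S" by (intro AE_unif_ballI) auto
  then have AE: "AE y in unif_ball. (\<integral>\<^sup>+x. ?f (x(i := y)) \<partial>(PiM K (\<lambda>_. unif_ball))) = 0"
  proof eventually_elim
    case (elim y)
    \<comment> \<open>Once point i is fixed outside the shifted span, its row joins the independent
      fixed rows and the induction hypothesis applies to the remaining points.\<close>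
    let ?R = "R(m := y - x0)"
    have y: "y - x0 \<notin> ?S"
      using elim by (metis add.commute diff_add_cancel image_eqI)
    have "(\<integral>\<^sup>+x. indicator {0} (det (\<chi> j. if p j \<in> K then x (p j) - x0 else ?R j)) \<partial>(PiM K (\<lambda>_. unif_ball))) = (0 :: ennreal)"
    proof (rule insert.IH)
      show "K \<subseteq> {1..CARD('n)}" using insert.prems by simp
      fix c assume "(\<Sum>j | p j \<notin> K. c j *\<^sub>R ?R j) = 0"
      moreover have "(\<Sum>j | p j \<notin> K. c j *\<^sub>R ?R j) = c m *\<^sub>R (y - x0) + (\<Sum>j\<in>?N. c j *\<^sub>R R j)"
        unfolding N(1) using N(2) by (subst sum.insert) (auto intro!: sum.cong)
      ultimately have s: "c m *\<^sub>R (y - x0) + (\<Sum>j\<in>?N. c j *\<^sub>R R j) = 0" by simp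
      have cm: "c m = 0"
      proof (rule ccontr)
        assume c: "c m \<noteq> 0"
        have "y - x0 = (- 1 / c m) *\<^sub>R (\<Sum>j\<in>?N. c j *\<^sub>R R j)"
        proof -
          have "c m *\<^sub>R (y - x0) = - (\<Sum>j\<in>?N. c j *\<^sub>R R j)" using s by (simp add: eq_neg_iff_add_eq_0)
          then have "(1 / c m) *\<^sub>R c m *\<^sub>R (y - x0) = (1 / c m) *\<^sub>R - (\<Sum>j\<in>?N. c j *\<^sub>R R j)" by simp
          then show ?thesis using c by simp
        qed
        also have "\<dots> \<in> ?S"
          by (intro span_scale span_sum span_base) auto
        finally show False using y by simp
      qed
      then have "(\<Sum>j\<in>?N. c j *\<^sub>R R j) = 0" using s by simp
      then have "\<forall>j. p j \<notin> insert i K \<longrightarrow> c j = 0" by (rule insert.prems(2))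
      moreover have "j = m \<or> p j \<notin> insert i K" if "p j \<notin> K" for j
        using that m inj_p by (auto dest: injD)
      ultimately show "\<forall>j. p j \<notin> K \<longrightarrow> c j = 0" using cm by blast
    qed
    moreover have "(\<chi> j. if p j \<in> insert i K then (x(i := y)) (p j) - x0 else R j) = (\<chi> j. if p j \<in> K then x (p j) - x0 else ?R j)" for x
      using insert.hyps m inj_p by (auto simp: vec_eq_iff dest: injD)
    ultimately show ?case by simp
  qed
  have "(\<integral>\<^sup>+x. ?f x \<partial>(PiM (insert i K) (\<lambda>_. unif_ball))) = (\<integral>\<^sup>+y. (\<integral>\<^sup>+x. ?f (x(i := y)) \<partial>(PiM K (\<lambda>_. unif_ball))) \<partial>unif_ball)"
    by (rule product_nn_integral_insert_rev[OF insert.hyps(1,2) mf])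
  also have "\<dots> = (\<integral>\<^sup>+y. 0 \<partial>(unif_ball :: (real^'n) measure))"
    by (rule nn_integral_cong_AE[OF AE])
  finally show ?case by simp
qed

lemma measurable_dircoef_PiM [measurable]:
  assumes "i \<in> {0..CARD('n)}"
  shows "(\<lambda>x. dircoef p x v i) \<in> borel_measurable (PiM {0..CARD('n)} (\<lambda>_. unif_ball))" (is ?A)
    and "(\<lambda>x. det (edge_matrix p x)) \<in> borel_measurable (PiM {0..CARD('n)} (\<lambda>_. unif_ball))" (is ?B)
proof -
  note * = measurable_unif_ball_component[of _ "{0..CARD('n)}"]
  show ?A ?B
    by (rule measurable_dircoef[OF * measurable_const assms]; simp)+
qed

lemma AE_det_edge_matrix:
  "AE x in PiM {0..CARD('n)} (\<lambda>_. unif_ball). det (edge_matrix p x) \<noteq> 0"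
proof -
  interpret product_sigma_finite "\<lambda>_::nat. unif_ball :: (real^'n) measure"
    by (rule product_sigma_finite_unif_ball)
  let ?f = "\<lambda>x. indicator {0} (det (edge_matrix p x)) :: ennreal"
  have I: "{0..CARD('n)} = insert 0 {1..CARD('n)}" by auto
  have [measurable]: "?f \<in> borel_measurable (PiM {0..CARD('n)} (\<lambda>_. unif_ball))"
    using measurable_dircoef_PiM(2)[of 0] by measurable
  have "(\<integral>\<^sup>+x. ?f x \<partial>(PiM {0..CARD('n)} (\<lambda>_. unif_ball))) =
    (\<integral>\<^sup>+y. (\<integral>\<^sup>+x. ?f (x(0 := y)) \<partial>(PiM {1..CARD('n)} (\<lambda>_. unif_ball))) \<partial>unif_ball)"
    unfolding I by (rule product_nn_integral_insert_rev) (simp, simp, unfold I[symmetric], measurable)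
  also have "\<dots> = (\<integral>\<^sup>+y. 0 \<partial>(unif_ball :: (real^'n) measure))"
  proof (rule nn_integral_cong)
    fix y :: "real^'n"
    have in1: "p j \<in> {1..CARD('n)}" for j using p by (auto simp: bij_betw_def)
    \<comment> \<open>With the base point fixed every row is still random, so the independence
      condition on fixed rows is vacuous.\<close>
    have "edge_matrix p (x(0 := y)) = (\<chi> j. if p j \<in> {1..CARD('n)} then x (p j) - y else 0)" for x
      using in1 by (simp add: edge_matrix_def vec_eq_iff del: atLeastAtMost_iff)
    then show "(\<integral>\<^sup>+x. ?f (x(0 := y)) \<partial>(PiM {1..CARD('n)} (\<lambda>_. unif_ball))) = 0"
      using AE_det_rows[of "{1..CARD('n)}" "\<lambda>_. 0" y] in1 by (simp del: atLeastAtMost_iff)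
  qed
  finally have "(\<integral>\<^sup>+x. ?f x \<partial>(PiM {0..CARD('n)} (\<lambda>_. unif_ball))) = 0" by simp
  then have "AE x in PiM {0..CARD('n)} (\<lambda>_. unif_ball). ?f x = 0"
    by (subst (asm) nn_integral_0_iff_AE) simp_all
  then show ?thesis by eventually_elim (simp add: indicator_def split: if_splits)
qed

text \<open>Applying \<nu> . x - \<beta> to the relation between the points and v kills v, as \<nu>
  is orthogonal to it, and all points but k and l. What is left is c_k s_k + c_l s_l = 0, so c_k and
  c_l have opposite signs exactly when s_k and s_l agree in sign.\<close>

lemma dircoef_sign_iff_same_side:
  fixes x :: "nat \<Rightarrow> real^'n"
  assumes det: "det (edge_matrix p x) \<noteq> 0" and kl: "k \<in> {0..CARD('n)}" "l \<in> {0..CARD('n)}" "k \<noteq> l"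
    and \<nu>v: "\<nu> \<bullet> v = 0" and plane: "\<And>j. j \<in> {0..CARD('n)} - {k, l} \<Longrightarrow> \<nu> \<bullet> x j = \<beta>"
    and k: "\<nu> \<bullet> x k \<noteq> \<beta>" and l: "\<nu> \<bullet> x l \<noteq> \<beta>"
    and gen: "\<And>c s. (\<Sum>j\<in>{0..CARD('n)} - {k, l}. c j) = 0 \<Longrightarrow>
      (\<Sum>j\<in>{0..CARD('n)} - {k, l}. c j *\<^sub>R x j) = s *\<^sub>R v \<Longrightarrow> s = 0"
  shows "dircoef p x v k \<noteq> 0"
    and "dircoef p x v k * dircoef p x v l < 0 \<longleftrightarrow> (\<nu> \<bullet> x k - \<beta>) * (\<nu> \<bullet> x l - \<beta>) > 0"
proof -
  let ?I = "{0..CARD('n)}" and ?c = "dircoef p x v"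
  have split: "(\<Sum>i\<in>?I. f i) = f k + (f l + (\<Sum>i\<in>?I - {k, l}. f i))" for f :: "nat \<Rightarrow> 'z::comm_monoid_add"
  proof -
    have "(\<Sum>i\<in>?I. f i) = f k + (\<Sum>i\<in>?I - {k}. f i)" using kl by (intro sum.remove) auto
    also have "(\<Sum>i\<in>?I - {k}. f i) = f l + (\<Sum>i\<in>?I - {k} - {l}. f i)" using kl by (intro sum.remove) auto
    also have "?I - {k} - {l} = ?I - {k, l}" by auto
    finally show ?thesis .
  qed
  have "(\<Sum>i\<in>?I. ?c i * (\<nu> \<bullet> x i - \<beta>)) = \<nu> \<bullet> (\<Sum>i\<in>?I. ?c i *\<^sub>R x i) - (\<Sum>i\<in>?I. ?c i) * \<beta>"
    by (simp add: inner_sum_right right_diff_distrib sum_subtractf sum_distrib_right)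
  also have "\<dots> = 0"
    by (simp add: sum_dircoef sum_dircoef_scaleR[OF det] \<nu>v)
  finally have eq: "?c k * (\<nu> \<bullet> x k - \<beta>) + ?c l * (\<nu> \<bullet> x l - \<beta>) = 0"
    unfolding split by (simp add: plane)
  show k0: "?c k \<noteq> 0"
  proof
    \<comment> \<open>If c_k vanished, c_l would too, and v would be parallel to the affine hull of
      the other d - 1 points, which \<open>gen\<close> excludes.\<close>
    assume ck: "?c k = 0"
    then have cl: "?c l = 0" using eq l by simp
    have "(\<Sum>j\<in>?I - {k, l}. ?c j) = 0" using sum_dircoef[of x v] unfolding split by (simp add: ck cl)
    moreover have "(\<Sum>j\<in>?I - {k, l}. ?c j *\<^sub>R x j) = det (edge_matrix p x) *\<^sub>R v"
      using sum_dircoef_scaleR[OF det, of v] unfolding split by (simp add: ck cl)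
    ultimately show False using gen det by blast
  qed
  define s t where "s = \<nu> \<bullet> x k - \<beta>" and "t = \<nu> \<bullet> x l - \<beta>"
  have st: "s \<noteq> 0" "t \<noteq> 0" using k l by (simp_all add: s_def t_def)
  define u where "u = s / t"
  have "?c l = - ?c k * u" unfolding u_def using eq st by (simp add: s_def[symmetric] t_def[symmetric] field_simps eq_neg_iff_add_eq_0)
  then have "?c k * ?c l = - ((?c k)\<^sup>2 * u)" by (simp add: power2_eq_square)
  then have "?c k * ?c l < 0 \<longleftrightarrow> 0 < u" using k0 by (simp add: zero_less_mult_iff)
  also have "\<dots> \<longleftrightarrow> 0 < s * t" by (simp add: u_def zero_less_divide_iff zero_less_mult_iff)
  finally show "?c k * ?c l < 0 \<longleftrightarrow> (\<nu> \<bullet> x k - \<beta>) * (\<nu> \<bullet> x l - \<beta>) > 0"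
    by (simp only: s_def t_def)
qed

end

text \<open>The head of the list is integrated outermost, so the list fixes the order of
  integration. The initial function is the only point of the empty product.\<close>

fun iterated_nn_integral :: "'a measure \<Rightarrow> nat list \<Rightarrow> ((nat \<Rightarrow> 'a) \<Rightarrow> ennreal) \<Rightarrow> ennreal" where
  "iterated_nn_integral M [] f = f (\<lambda>_. undefined)"
| "iterated_nn_integral M (i # is) f = (\<integral>\<^sup>+y. iterated_nn_integral M is (\<lambda>x. f (x(i := y))) \<partial>M)"

lemma nn_integral_PiM_iterated:
  assumes M: "product_sigma_finite (\<lambda>_::nat. M)" and "distinct is"
    and "f \<in> borel_measurable (PiM (set is) (\<lambda>_. M))"
  shows "(\<integral>\<^sup>+x. f x \<partial>(PiM (set is) (\<lambda>_. M))) = iterated_nn_integral M is f"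
  using assms(2,3)
proof (induction "is" arbitrary: f)
  case Nil
  then show ?case by (simp add: PiM_empty nn_integral_count_space_finite)
next
  case (Cons i "is")
  interpret product_sigma_finite "\<lambda>_::nat. M" by fact
  have "(\<integral>\<^sup>+x. f x \<partial>(PiM (set (i # is)) (\<lambda>_. M))) = (\<integral>\<^sup>+y. \<integral>\<^sup>+x. f (x(i := y)) \<partial>(PiM (set is) (\<lambda>_. M)) \<partial>M)"
    using Cons.prems by (simp add: product_nn_integral_insert_rev)
  also have "\<dots> = (\<integral>\<^sup>+y. iterated_nn_integral M is (\<lambda>x. f (x(i := y))) \<partial>M)"
  proof (rule nn_integral_cong)
    fix y assume y: "y \<in> space M"
    have "(\<lambda>x. x(i := y)) \<in> measurable (PiM (set is) (\<lambda>_. M)) (PiM (set (i # is)) (\<lambda>_. M))"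
      by (rule measurable_fun_upd[where J = "set is"]) (use y in auto)
    from measurable_compose[OF this Cons.prems(2)]
    show "(\<integral>\<^sup>+x. f (x(i := y)) \<partial>(PiM (set is) (\<lambda>_. M))) = iterated_nn_integral M is (\<lambda>x. f (x(i := y)))"
      using Cons.prems(1) by (intro Cons.IH) simp_all
  qed
  finally show ?case by simp
qed

lemma nn_integral_AE_0: "AE x in M. f x = 0 \<Longrightarrow> (\<integral>\<^sup>+x. f x \<partial>M) = 0"
  using nn_integral_cong_AE[of f "\<lambda>_. 0" M] by simp

text \<open>\<open>compose I g\<close> applies g to every point of the family and keeps the result
  extensional on I, as the product space demands.\<close>

lemma distr_PiM_unif_ball_isometry:
  fixes g :: "'c::euclidean_space \<Rightarrow> 'a::euclidean_space"
  assumes lin: "linear g" and iso: "\<And>x. norm (g x) = norm x" and dim: "DIM('c) = DIM('a)" and I: "finite I"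
  shows "distr (PiM I (\<lambda>_. unif_ball)) (PiM I (\<lambda>_. unif_ball)) (compose I g) = PiM I (\<lambda>_. unif_ball)" (is ?distr)
    and "compose I g \<in> measurable (PiM I (\<lambda>_. unif_ball)) (PiM I (\<lambda>_. unif_ball))" (is ?measurable)
proof -
  have "g \<in> borel_measurable borel"
    by (rule borel_measurable_linear[OF lin])
  also have "measurable borel borel = measurable (unif_ball :: 'c measure) (unif_ball :: 'a measure)"
    by (rule measurable_cong_sets) simp_all
  finally have g: "g \<in> measurable (unif_ball :: 'c measure) (unif_ball :: 'a measure)" .
  have "distr unif_ball (unif_ball :: 'a measure) g = distr unif_ball borel g"
    by (rule distr_cong) simp_all
  also have "\<dots> = unif_ball" by (rule distr_uniform_ball_isometry[OF lin iso dim])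
  finally have d: "distr unif_ball (unif_ball :: 'a measure) g = unif_ball" .
  show ?distr
    by (subst distr_PiM_finite_prob_space[OF I])
      (auto intro!: product_prob_spaceI prob_space_unif_ball simp: g d)
  show ?measurable
    unfolding compose_def
    by (intro measurable_restrict) (rule measurable_compose[OF _ g], rule measurable_component_singleton)
qed

lemma line_coeffs_side:
  assumes "x1 \<noteq> x2"
  shows "side (line_coeffs (x1, x2) (z1, z2)) (z1, x1, w) = 0" (is ?A) "side (line_coeffs (x1, x2) (z1, z2)) (z2, x2, w) = 0" (is ?B)
proof -
  define a where "a = (z2 - z1) / (x2 - x1)"
  have "a * (x2 - x1) = z2 - z1" using assms by (simp add: a_def)
  then have a: "z2 - a * x2 = z1 - a * x1" by (simp add: algebra_simps)
  have h: "line_coeffs (x1, x2) (z1, z2) = (a, z1 - a * x1)"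
    by (simp add: line_coeffs_def Let_def a_def)
  show ?A ?B
    unfolding h by (simp_all add: side_def a)
qed

lemma plane_coeffs_side:
  assumes D: "det3 (x1, x2, x3) \<noteq> 0"
  shows "side (plane_coeffs (x1, x2, x3) (z1, z2, z3)) (z1, x1, w) = 0" (is ?A) "side (plane_coeffs (x1, x2, x3) (z1, z2, z3)) (z2, x2, w) = 0" (is ?B)
    "side (plane_coeffs (x1, x2, x3) (z1, z2, z3)) (z3, x3, w) = 0" (is ?C)
proof -
  define u u' s t where "u = x2 - x1" and "u' = x3 - x1" and "s = z2 - z1" and "t = z3 - z1"
  define D where "D = fst u * snd u' - fst u' * snd u"
  define a where "a = ((s * snd u' - t * snd u) / D, (fst u * t - fst u' * s) / D)"
  have D0: "D \<noteq> 0" using assms by (simp add: det3_def D_def u_def u'_def)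
  have h: "plane_coeffs (x1, x2, x3) (z1, z2, z3) = (a, z1 - a \<bullet> x1)"
    by (simp add: plane_coeffs_def Let_def det3_def a_def D_def u_def u'_def s_def t_def)
  have "a \<bullet> u = (s * snd u' - t * snd u) / D * fst u + (fst u * t - fst u' * s) / D * snd u"
    by (simp add: a_def inner_prod_def)
  also have "\<dots> = s * D / D" unfolding times_divide_eq_left add_divide_distrib[symmetric] by (simp add: D_def algebra_simps)
  finally have au: "a \<bullet> u = s" using D0 by simp
  have "a \<bullet> u' = (s * snd u' - t * snd u) / D * fst u' + (fst u * t - fst u' * s) / D * snd u'"
    by (simp add: a_def inner_prod_def)
  also have "\<dots> = t * D / D" unfolding times_divide_eq_left add_divide_distrib[symmetric] by (simp add: D_def algebra_simps)
  finally have au': "a \<bullet> u' = t" using D0 by simp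
  show ?A ?B ?C
    unfolding h using au au' by (simp_all add: side_def u_def u'_def s_def t_def inner_diff_right)
qed

lemma det3_independent:
  assumes D: "det3 (x1, x2, x3) \<noteq> 0" and s: "c1 + c2 + c3 = 0" "c1 *\<^sub>R x1 + c2 *\<^sub>R x2 + c3 *\<^sub>R x3 = 0"
  shows "c1 = 0" "c2 = 0" "c3 = 0"
proof -
  have c1: "c1 = - c2 - c3" using s(1) by simp
  have 1: "c2 * (fst x2 - fst x1) + c3 * (fst x3 - fst x1) = 0"
    using arg_cong[OF s(2), of fst] by (simp add: c1 algebra_simps)
  have 2: "c2 * (snd x2 - snd x1) + c3 * (snd x3 - snd x1) = 0"
    using arg_cong[OF s(2), of snd] by (simp add: c1 algebra_simps)
  have "c2 * det3 (x1, x2, x3) = 0" "c3 * det3 (x1, x2, x3) = 0"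
    unfolding det3_def fst_conv snd_conv fst_diff snd_diff using 1 2 by algebra+
  then show "c1 = 0" "c2 = 0" "c3 = 0" using D c1 by auto
qed

section \<open>Coefficient signs expressed through sides of hyperplanes\<close>

context simplex_enum
begin

text \<open>The isometry g sends the w-axis to the direction of v, so the image of (1, -a, 0) is a
  normal orthogonal to v. The genericity condition concerns only the x-parts, which for d = 3 and d
  = 4 are two reals or three points of the plane.\<close>

lemma dircoef_sign_coordinates:
  fixes g :: "'b::euclidean_space coords \<Rightarrow> real^'n" and P :: "'b \<times> real"
  assumes g: "linear g" "\<And>y. norm (g y) = norm y" "g (0, 0, 1) = sgn v" and v: "v \<noteq> 0"
    and kl: "k \<in> {0..CARD('n)}" "l \<in> {0..CARD('n)}" "k \<noteq> l"
    and det: "det (edge_matrix p (compose {0..CARD('n)} g y)) \<noteq> 0"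
    and plane: "\<And>j. j \<in> {0..CARD('n)} - {k, l} \<Longrightarrow> side P (y j) = 0"
    and k: "side P (y k) \<noteq> 0" and l: "side P (y l) \<noteq> 0"
    and gen: "\<And>c. (\<Sum>j\<in>{0..CARD('n)} - {k, l}. c j) = 0 \<Longrightarrow>
      (\<Sum>j\<in>{0..CARD('n)} - {k, l}. c j *\<^sub>R fst (snd (y j))) = 0 \<Longrightarrow> (\<forall>j\<in>{0..CARD('n)} - {k, l}. c j = 0)"
  shows "dircoef p (compose {0..CARD('n)} g y) v k \<noteq> 0"
    and "dircoef p (compose {0..CARD('n)} g y) v k * dircoef p (compose {0..CARD('n)} g y) v l < 0
      \<longleftrightarrow> side P (y k) * side P (y l) > 0"
proof -
  let ?x = "compose {0..CARD('n)} g y"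
  define \<nu> where "\<nu> = g (1, - fst P, 0)"
  have x: "?x i = g (y i)" if "i \<in> {0..CARD('n)}" for i
    using that by (simp add: compose_def)
  have v': "v = norm v *\<^sub>R g (0, 0, 1)" using v by (simp add: g(3) sgn_div_norm)
  have \<nu>v: "\<nu> \<bullet> v = 0"
    by (subst v') (simp add: \<nu>_def isometry_inner[OF g(1,2)])
  have \<nu>x: "\<nu> \<bullet> ?x i - snd P = side P (y i)" if "i \<in> {0..CARD('n)}" for i
    by (simp add: x[OF that] \<nu>_def isometry_inner[OF g(1,2)] inner_prod_def side_def)
  have gen': "s = 0"
    if c: "(\<Sum>j\<in>{0..CARD('n)} - {k, l}. c j) = 0" "(\<Sum>j\<in>{0..CARD('n)} - {k, l}. c j *\<^sub>R ?x j) = s *\<^sub>R v" for c s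
  proof -
    let ?J = "{0..CARD('n)} - {k, l}"
    have "(\<Sum>j\<in>?J. c j *\<^sub>R ?x j) = g (\<Sum>j\<in>?J. c j *\<^sub>R y j)"
      by (simp add: linear_sum[OF g(1)] linear_cmul[OF g(1)] x)
    then have "g ((\<Sum>j\<in>?J. c j *\<^sub>R y j) - (s * norm v) *\<^sub>R (0, 0, 1)) = 0"
      using c(2) v' by (simp add: linear_diff[OF g(1)] linear_cmul[OF g(1)] del: scaleR_Pair) (metis scaleR_scaleR)
    then have "norm ((\<Sum>j\<in>?J. c j *\<^sub>R y j) - (s * norm v) *\<^sub>R (0, 0, 1)) = 0"
      by (subst g(2)[symmetric]) (simp only: norm_zero)
    then have "(\<Sum>j\<in>?J. c j *\<^sub>R y j) - (s * norm v) *\<^sub>R (0, 0, 1) = 0"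
      by (simp only: norm_eq_zero)
    \<comment> \<open>The x-part of the w-axis is 0, so a combination of the points parallel to that
      axis is a relation between the x-parts.\<close>
    then have "fst (snd ((\<Sum>j\<in>?J. c j *\<^sub>R y j) - (s * norm v) *\<^sub>R (0, 0, 1))) = 0"
      by (simp only: snd_zero fst_zero)
    then have "(\<Sum>j\<in>?J. c j *\<^sub>R fst (snd (y j))) = 0"
      by (simp add: fst_sum snd_sum)
    then have "\<forall>j\<in>?J. c j = 0" by (rule gen[OF c(1)])
    then have "s *\<^sub>R v = 0" using c(2) by simp
    then show ?thesis using v by simp
  qed
  have pl: "\<nu> \<bullet> ?x j = snd P" if "j \<in> {0..CARD('n)} - {k, l}" for j
    using \<nu>x[of j] plane[OF that] that by simp
  have kl': "\<nu> \<bullet> ?x k \<noteq> snd P" "\<nu> \<bullet> ?x l \<noteq> snd P"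
    using \<nu>x[OF kl(1)] \<nu>x[OF kl(2)] k l by auto
  note * = dircoef_sign_iff_same_side[OF det kl \<nu>v pl kl' gen']
  show "dircoef p ?x v k \<noteq> 0" by (rule *(1))
  show "dircoef p ?x v k * dircoef p ?x v l < 0 \<longleftrightarrow> side P (y k) * side P (y l) > 0"
    using *(2) unfolding \<nu>x[OF kl(1)] \<nu>x[OF kl(2)] .
qed

end

context simplex_enum
begin

text \<open>\<open>P\<close> chooses the hyperplane from the points themselves. Its requirements
  need to hold only almost surely, since the coefficients of a hyperplane through degenerate points
  are junk.\<close>

lemma opposite_sign_transfer:
  fixes P :: "(nat \<Rightarrow> 'b::euclidean_space coords) \<Rightarrow> 'b \<times> real"
  assumes dim: "DIM('b) + 2 = CARD('n)" and v: "v \<noteq> 0"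
    and kl: "k \<in> {0..CARD('n)}" "l \<in> {0..CARD('n)}" "k \<noteq> l"
    and good: "AE y in PiM {0..CARD('n)} (\<lambda>_. unif_ball).
      (\<forall>j\<in>{0..CARD('n)} - {k, l}. side (P y) (y j) = 0) \<and> side (P y) (y k) \<noteq> 0 \<and> side (P y) (y l) \<noteq> 0 \<and>
      (\<forall>c. (\<Sum>j\<in>{0..CARD('n)} - {k, l}. c j) = 0 \<longrightarrow>
        (\<Sum>j\<in>{0..CARD('n)} - {k, l}. c j *\<^sub>R fst (snd (y j))) = 0 \<longrightarrow> (\<forall>j\<in>{0..CARD('n)} - {k, l}. c j = 0))"
    and prob: "(\<integral>\<^sup>+y. indicator {t. t > 0} (side (P y) (y k) * side (P y) (y l)) \<partial>(PiM {0..CARD('n)} (\<lambda>_. unif_ball))) = r"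
  shows "AE x in PiM {0..CARD('n)} (\<lambda>_. unif_ball). dircoef p x v k \<noteq> 0"
    and "(\<integral>\<^sup>+x. indicator {t. t < 0} (dircoef p x v k * dircoef p x v l) \<partial>(PiM {0..CARD('n)} (\<lambda>_. unif_ball))) = r"
proof -
  let ?I = "{0..CARD('n)}"
  let ?U = "PiM ?I (\<lambda>_. unif_ball :: (real^'n) measure)" and ?V = "PiM ?I (\<lambda>_. unif_ball :: ('b coords) measure)"
  have dim': "DIM('b coords) = DIM(real^'n)" using dim by simp
  have "norm (0 :: real, 0 :: 'b, 1 :: real) = norm (sgn v)" using v by (simp add: norm_sgn)
  then obtain g :: "'b coords \<Rightarrow> real^'n" where g: "linear g" "\<And>y. norm (g y) = norm y" "surj g" "g (0, 0, 1) = sgn v"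
    by (rule isometry_exists[OF dim']) blast
  note distr = distr_PiM_unif_ball_isometry[OF g(1,2) dim' finite_atLeastAtMost[of 0 "CARD('n)"]]
  have [measurable]: "(\<lambda>x. dircoef p x v k) \<in> borel_measurable ?U" "(\<lambda>x. dircoef p x v l) \<in> borel_measurable ?U"
    "(\<lambda>x. det (edge_matrix p x)) \<in> borel_measurable ?U"
    using kl by (auto intro!: measurable_dircoef_PiM)
  have AE_V: "AE y in ?V. Q (compose ?I g y)" if "AE x in ?U. Q x" and [measurable]: "Measurable.pred ?U Q" for Q
  proof -
    have "AE x in distr ?V ?U (compose ?I g). Q x" unfolding distr(1) by (rule that(1))
    then show ?thesis using distr(2) by (subst (asm) AE_distr_iff) simp_all
  qed
  have "AE y in ?V. det (edge_matrix p (compose ?I g y)) \<noteq> 0"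
    by (rule AE_V[OF AE_det_edge_matrix]) measurable
  with good have *: "AE y in ?V. dircoef p (compose ?I g y) v k \<noteq> 0 \<and>
     (dircoef p (compose ?I g y) v k * dircoef p (compose ?I g y) v l < 0 \<longleftrightarrow> side (P y) (y k) * side (P y) (y l) > 0)"
  proof eventually_elim
    case (elim y)
    note ** = dircoef_sign_coordinates[OF g(1,2,4) v kl, of y "P y"]
    show ?case by (intro conjI **) (use elim in blast)+
  qed
  have "AE x in distr ?V ?U (compose ?I g). dircoef p x v k \<noteq> 0"
    by (subst AE_distr_iff) (use distr(2) * in \<open>auto\<close>)
  then show "AE x in ?U. dircoef p x v k \<noteq> 0" by (simp only: distr(1))
  have "(\<integral>\<^sup>+x. indicator {t. t < 0} (dircoef p x v k * dircoef p x v l) \<partial>?U)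
    = (\<integral>\<^sup>+x. indicator {t. t < 0} (dircoef p x v k * dircoef p x v l) \<partial>distr ?V ?U (compose ?I g))"
    by (simp only: distr(1))
  also have "\<dots> = (\<integral>\<^sup>+y. indicator {t. t < 0} (dircoef p (compose ?I g y) v k * dircoef p (compose ?I g y) v l) \<partial>?V)"
    by (rule nn_integral_distr[OF distr(2)]) measurable
  also have "\<dots> = (\<integral>\<^sup>+y. indicator {t. t > 0} (side (P y) (y k) * side (P y) (y l)) \<partial>?V)"
    by (rule nn_integral_cong_AE) (use * in eventually_elim, simp add: indicator_def)
  finally show "(\<integral>\<^sup>+x. indicator {t. t < 0} (dircoef p x v k * dircoef p x v l) \<partial>?U) = r"
    by (simp add: prob)
qed

lemma opposite_sign_probability_3:
  assumes card: "CARD('n) = 3" and v: "v \<noteq> 0"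
    and kl: "k \<in> {0..CARD('n)}" "l \<in> {0..CARD('n)}" "k \<noteq> l"
  shows "AE x in PiM {0..CARD('n)} (\<lambda>_. unif_ball). dircoef p x v k \<noteq> 0" (is ?AE)
    and "(\<integral>\<^sup>+x. indicator {t. t < 0} (dircoef p x v k * dircoef p x v l) \<partial>(PiM {0..CARD('n)} (\<lambda>_. unif_ball))) = ennreal (1573 / 2560)" (is ?prob)
proof -
  let ?J = "{0..CARD('n)} - {k, l}"
  have "card (?J) = 2"
    using kl by (subst card_Diff_subset) (auto simp: card)
  then obtain i j where ij: "?J = {i, j}" "i \<noteq> j"
    by (auto simp: card_2_iff)
  then have neq: "i \<noteq> k" "i \<noteq> l" "j \<noteq> k" "j \<noteq> l" by auto
  have "{0..CARD('n)} = (?J) \<union> {k, l}" using kl by blast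
  also have "\<dots> = set [i, j, k, l]" unfolding ij(1) by auto
  finally have I: "{0..CARD('n)} = set [i, j, k, l]" .
  have d: "distinct [i, j, k, l]" using kl(3) ij(2) neq by simp
  let ?V = "PiM {0..CARD('n)} (\<lambda>_. ball3)"
  let ?P = "\<lambda>y :: nat \<Rightarrow> real \<times> real \<times> real. line_through (y i) (y j)"
  have V: "?V = PiM (set [i, j, k, l]) (\<lambda>_. ball3)" by (simp only: I)
  have [measurable]: "(\<lambda>y. y i) \<in> borel_measurable ?V" "(\<lambda>y. y j) \<in> borel_measurable ?V"
      "(\<lambda>y. y k) \<in> borel_measurable ?V" "(\<lambda>y. y l) \<in> borel_measurable ?V"
    by (rule measurable_unif_ball_component; simp add: I)+
  have iter: "(\<integral>\<^sup>+y. f y \<partial>?V) = iterated_nn_integral ball3 [i, j, k, l] f" if "f \<in> borel_measurable ?V" for f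
    unfolding V by (rule nn_integral_PiM_iterated[OF product_sigma_finite_unif_ball d]) (use that in \<open>simp only: V\<close>)
  have mP[measurable]: "(\<lambda>y. side (?P y) (y k)) \<in> borel_measurable ?V" "(\<lambda>y. side (?P y) (y l)) \<in> borel_measurable ?V"
    unfolding line_coeffs_def Let_def side_def by measurable
  \<comment> \<open>One product encodes all genericity conditions: it is nonzero exactly when the
    x-parts of points i and j differ and neither k nor l lies on their hyperplane.\<close>
  let ?h = "\<lambda>y. (fst (snd (y i)) - fst (snd (y j))) * (side (?P y) (y k) * side (?P y) (y l))"
  let ?g = "\<lambda>y. indicator {0} (?h y) :: ennreal"
  have mh: "?h \<in> borel_measurable ?V"
    by (intro borel_measurable_times mP) (measurable)
  have mb: "?g \<in> borel_measurable ?V"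
    by (rule measurable_compose[OF mh]) simp
  have "(\<integral>\<^sup>+y. ?g y \<partial>?V) = iterated_nn_integral ball3 [i, j, k, l] ?g"
    by (rule iter[OF mb])
  also have "\<dots> = 0"
    unfolding iterated_nn_integral.simps
  proof (rule nn_integral_AE_0, rule AE_I2, rule nn_integral_AE_0)
    fix y1 :: "real \<times> real \<times> real"
    have "AE y2 in ball3. (0, 1, 0) \<bullet> y2 \<noteq> fst (snd y1)"
      by (rule AE_unif_ball_hyperplane) (simp add: zero_prod_def)
    then show "AE y2 in ball3. (\<integral>\<^sup>+y3. \<integral>\<^sup>+y4. ?g ((\<lambda>_. undefined)(l := y4, k := y3, j := y2, i := y1)) \<partial>ball3 \<partial>ball3) = 0"
    proof eventually_elim
      case (elim y2)
      let ?Q = "line_through y1 y2"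
      have x: "fst (snd y1) \<noteq> fst (snd y2)" using elim by (simp add: inner_prod_def)
      show ?case
      proof (rule nn_integral_AE_0)
        show "AE y3 in ball3. (\<integral>\<^sup>+y4. ?g ((\<lambda>_. undefined)(l := y4, k := y3, j := y2, i := y1)) \<partial>ball3) = 0"
          using AE_side_nonzero[of ?Q]
        proof eventually_elim
          case (elim y3)
          show ?case
            by (rule nn_integral_AE_0, use AE_side_nonzero[of ?Q] in eventually_elim)
              (use elim x kl(3) ij(2) neq in \<open>simp add: indicator_def\<close>)
        qed
      qed
    qed
  qed
  finally have "AE y in ?V. ?g y = 0"
    using mb by (subst (asm) nn_integral_0_iff_AE) auto
  then have ok: "AE y in ?V. ?h y \<noteq> 0"
    by eventually_elim (simp add: indicator_def split: if_splits)
  have good: "AE y in ?V.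
      (\<forall>j\<in>?J. side (?P y) (y j) = 0) \<and> side (?P y) (y k) \<noteq> 0 \<and> side (?P y) (y l) \<noteq> 0 \<and>
      (\<forall>c. (\<Sum>j\<in>?J. c j) = 0 \<longrightarrow>
        (\<Sum>j\<in>?J. c j *\<^sub>R fst (snd (y j))) = 0 \<longrightarrow> (\<forall>j\<in>?J. c j = 0))"
    using ok
  proof eventually_elim
    case (elim y)
    then have x: "fst (snd (y i)) \<noteq> fst (snd (y j))" by simp
    have "side (?P y) (y i) = 0" "side (?P y) (y j) = 0"
      using line_coeffs_side[OF x, of "fst (y i)" "fst (y j)"] by (metis prod.collapse)+
    moreover have "c i = 0 \<and> c j = 0" if "c i + c j = 0" "c i * fst (snd (y i)) + c j * fst (snd (y j)) = 0" for c :: "nat \<Rightarrow> real"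
    proof -
      have cj: "c j = - c i" using that(1) by simp
      then have "c i * (fst (snd (y i)) - fst (snd (y j))) = 0" using that(2) by (simp add: algebra_simps)
      then show ?thesis using x cj by simp
    qed
    ultimately show ?case using elim ij by simp
  qed
  let ?f = "\<lambda>y. indicator {t. t > 0} (side (?P y) (y k) * side (?P y) (y l)) :: ennreal"
  have prob: "(\<integral>\<^sup>+y. ?f y \<partial>?V) = ennreal (1573 / 2560)"
  proof -
    have "(\<integral>\<^sup>+y. ?f y \<partial>?V)
      = iterated_nn_integral ball3 [i, j, k, l] ?f"
      by (rule iter, rule measurable_compose[OF borel_measurable_times[OF mP]]) simp
    also have "\<dots> = (\<integral>\<^sup>+y1. \<integral>\<^sup>+y2. \<integral>\<^sup>+y. \<integral>\<^sup>+y'. indicator {t. t > 0}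
      (side (line_through y1 y2) y * side (line_through y1 y2) y') \<partial>ball3 \<partial>ball3 \<partial>ball3 \<partial>ball3)"
      using kl(3) ij(2) neq by simp
    finally show ?thesis by (simp only: same_side_probability_3)
  qed
  have dim: "DIM(real) + 2 = CARD('n)" by (simp add: card)
  show ?AE ?prob
    by (rule opposite_sign_transfer[OF dim v kl good prob])+
qed

lemma opposite_sign_probability_4:
  assumes card: "CARD('n) = 4" and v: "v \<noteq> 0"
    and kl: "k \<in> {0..CARD('n)}" "l \<in> {0..CARD('n)}" "k \<noteq> l"
  shows "AE x in PiM {0..CARD('n)} (\<lambda>_. unif_ball). dircoef p x v k \<noteq> 0" (is ?AE)
    and "(\<integral>\<^sup>+x. indicator {t. t < 0} (dircoef p x v k * dircoef p x v l) \<partial>(PiM {0..CARD('n)} (\<lambda>_. unif_ball)))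
      = ennreal (2 / 3 - 1692197 / (2116800 * pi\<^sup>2))" (is ?prob)
proof -
  let ?J = "{0..CARD('n)} - {k, l}"
  have "card (?J) = 3"
    using kl by (subst card_Diff_subset) (auto simp: card)
  then obtain i j m where ij: "?J = {i, j, m}" "i \<noteq> j" "i \<noteq> m" "j \<noteq> m"
    by (auto simp: card_3_iff)
  then have neq: "i \<noteq> k" "i \<noteq> l" "j \<noteq> k" "j \<noteq> l" "m \<noteq> k" "m \<noteq> l" by auto
  have "{0..CARD('n)} = (?J) \<union> {k, l}" using kl by blast
  also have "\<dots> = set [i, j, m, k, l]" unfolding ij(1) by auto
  finally have I: "{0..CARD('n)} = set [i, j, m, k, l]" .
  have d: "distinct [i, j, m, k, l]" using kl(3) ij(2-) neq by simp
  let ?V = "PiM {0..CARD('n)} (\<lambda>_. ball4)"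
  let ?x = "\<lambda>y :: nat \<Rightarrow> (real \<times> real) coords. (fst (snd (y i)), fst (snd (y j)), fst (snd (y m)))"
  let ?P = "\<lambda>y. plane_coeffs (?x y) (fst (y i), fst (y j), fst (y m))"
  have V: "?V = PiM (set [i, j, m, k, l]) (\<lambda>_. ball4)" by (simp only: I)
  have [measurable]: "(\<lambda>y. y i) \<in> borel_measurable ?V" "(\<lambda>y. y j) \<in> borel_measurable ?V" "(\<lambda>y. y m) \<in> borel_measurable ?V"
      "(\<lambda>y. y k) \<in> borel_measurable ?V" "(\<lambda>y. y l) \<in> borel_measurable ?V"
    by (rule measurable_unif_ball_component; simp add: I)+
  have iter: "(\<integral>\<^sup>+y. f y \<partial>?V) = iterated_nn_integral ball4 [i, j, m, k, l] f" if "f \<in> borel_measurable ?V" for f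
    unfolding V by (rule nn_integral_PiM_iterated[OF product_sigma_finite_unif_ball d]) (use that in \<open>simp only: V\<close>)
  have mP[measurable]: "(\<lambda>y. side (?P y) (y k)) \<in> borel_measurable ?V" "(\<lambda>y. side (?P y) (y l)) \<in> borel_measurable ?V"
    unfolding plane_coeffs_def Let_def side_def by measurable
  let ?h = "\<lambda>y. det3 (?x y) * (side (?P y) (y k) * side (?P y) (y l))"
  let ?g = "\<lambda>y. indicator {0} (?h y) :: ennreal"
  have mh: "?h \<in> borel_measurable ?V"
    by (intro borel_measurable_times mP) (measurable)
  have mb: "?g \<in> borel_measurable ?V"
    by (rule measurable_compose[OF mh]) simp
  have "(\<integral>\<^sup>+y. ?g y \<partial>?V) = iterated_nn_integral ball4 [i, j, m, k, l] ?g"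
    by (rule iter[OF mb])
  also have "\<dots> = 0"
    unfolding iterated_nn_integral.simps
  proof (rule nn_integral_AE_0, rule AE_I2, rule nn_integral_AE_0)
    fix y1 :: "(real \<times> real) coords"
    have "AE y2 in ball4. (0, (1, 0), 0) \<bullet> y2 \<noteq> fst (fst (snd y1))"
      by (rule AE_unif_ball_hyperplane) (simp add: zero_prod_def)
    then show "AE y2 in ball4. (\<integral>\<^sup>+y5. \<integral>\<^sup>+y3. \<integral>\<^sup>+y4. ?g ((\<lambda>_. undefined)(l := y4, k := y3, m := y5, j := y2, i := y1)) \<partial>ball4 \<partial>ball4 \<partial>ball4) = 0"
    proof eventually_elim
      case (elim y2)
      define u where "u = fst (snd y2) - fst (snd y1)"
      have u: "fst u \<noteq> 0" using elim by (simp add: inner_prod_def u_def)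
      \<comment> \<open>For two fixed points \<open>det3\<close> is affine in the third, with normal
        (-snd u, fst u); this is nonzero because fst u is, so almost every third point is
        generic.\<close>
      have det: "det3 (fst (snd y1), fst (snd y2), fst (snd y5)) = (0, (- snd u, fst u), 0) \<bullet> y5 - (fst u * snd (fst (snd y1)) - snd u * fst (fst (snd y1)))"
        for y5 :: "(real \<times> real) coords"
        by (simp add: det3_def inner_prod_def u_def algebra_simps)
      have "AE y5 in ball4. (0, (- snd u, fst u), 0) \<bullet> y5 \<noteq> fst u * snd (fst (snd y1)) - snd u * fst (fst (snd y1))"
        by (rule AE_unif_ball_hyperplane) (use u in \<open>simp add: zero_prod_def\<close>)
      then have "AE y5 in ball4. det3 (fst (snd y1), fst (snd y2), fst (snd y5)) \<noteq> 0"
        unfolding det by eventually_elim simp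
      then have "AE y5 in ball4. (\<integral>\<^sup>+y3. \<integral>\<^sup>+y4. ?g ((\<lambda>_. undefined)(l := y4, k := y3, m := y5, j := y2, i := y1)) \<partial>ball4 \<partial>ball4) = 0"
      proof eventually_elim
        case (elim y5)
        let ?Q = "plane_through y1 y2 y5"
        show ?case
        proof (rule nn_integral_AE_0)
          show "AE y3 in ball4. (\<integral>\<^sup>+y4. ?g ((\<lambda>_. undefined)(l := y4, k := y3, m := y5, j := y2, i := y1)) \<partial>ball4) = 0"
            using AE_side_nonzero[of ?Q]
          proof eventually_elim
            case y3: (elim y3)
            show ?case
              by (rule nn_integral_AE_0, use AE_side_nonzero[of ?Q] in eventually_elim)
                (use elim y3 kl(3) ij(2-) neq in \<open>simp add: indicator_def\<close>)
          qed
        qed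
      qed
      then show ?case by (rule nn_integral_AE_0)
    qed
  qed
  finally have "AE y in ?V. ?g y = 0"
    using mb by (subst (asm) nn_integral_0_iff_AE) auto
  then have ok: "AE y in ?V. ?h y \<noteq> 0"
    by eventually_elim (simp add: indicator_def split: if_splits)
  have good: "AE y in ?V.
      (\<forall>j\<in>?J. side (?P y) (y j) = 0) \<and> side (?P y) (y k) \<noteq> 0 \<and> side (?P y) (y l) \<noteq> 0 \<and>
      (\<forall>c. (\<Sum>j\<in>?J. c j) = 0 \<longrightarrow>
        (\<Sum>j\<in>?J. c j *\<^sub>R fst (snd (y j))) = 0 \<longrightarrow> (\<forall>j\<in>?J. c j = 0))"
    using ok
  proof eventually_elim
    case (elim y)
    then have x: "det3 (?x y) \<noteq> 0" by simp
    have "side (?P y) (y i) = 0" "side (?P y) (y j) = 0" "side (?P y) (y m) = 0"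
      using plane_coeffs_side[OF x, of "fst (y i)" "fst (y j)" "fst (y m)"] by (metis prod.collapse)+
    moreover have "c i = 0 \<and> c j = 0 \<and> c m = 0"
      if "c i + (c j + c m) = 0" "c i *\<^sub>R fst (snd (y i)) + (c j *\<^sub>R fst (snd (y j)) + c m *\<^sub>R fst (snd (y m))) = 0" for c :: "nat \<Rightarrow> real"
      using det3_independent[OF x, of "c i" "c j" "c m"] that by (simp add: add.assoc)
    ultimately show ?case using elim ij by simp
  qed
  let ?f = "\<lambda>y. indicator {t. t > 0} (side (?P y) (y k) * side (?P y) (y l)) :: ennreal"
  have prob: "(\<integral>\<^sup>+y. ?f y \<partial>?V) = ennreal (2 / 3 - 1692197 / (2116800 * pi\<^sup>2))"
  proof -
    have "(\<integral>\<^sup>+y. ?f y \<partial>?V)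
      = iterated_nn_integral ball4 [i, j, m, k, l] ?f"
      by (rule iter, rule measurable_compose[OF borel_measurable_times[OF mP]]) simp
    also have "\<dots> = (\<integral>\<^sup>+y1. \<integral>\<^sup>+y2. \<integral>\<^sup>+y3. \<integral>\<^sup>+y. \<integral>\<^sup>+y'. indicator {t. t > 0}
      (side (plane_through y1 y2 y3) y *
       side (plane_through y1 y2 y3) y')
       \<partial>ball4 \<partial>ball4 \<partial>ball4 \<partial>ball4 \<partial>ball4)"
      using kl(3) ij(2-) neq by simp
    finally show ?thesis by (simp only: same_side_probability_4)
  qed
  have dim: "DIM(real \<times> real) + 2 = CARD('n)" by (simp add: card)
  show ?AE ?prob
    by (rule opposite_sign_transfer[OF dim v kl good prob])+
qed

end

subsection \<open>The expected angle sum\<close>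

text \<open>If \<open>N\<close> of the \<open>d + 1\<close> signs are negative, the double sum is \<open>2 * N * (d + 1 - N)\<close>.\<close>

lemma sign_count:
  fixes c :: "nat \<Rightarrow> real" and I :: "nat set" and \<alpha> C :: ennreal
  assumes nz: "\<And>i. i \<in> I \<Longrightarrow> c i \<noteq> 0" and s: "(\<Sum>i\<in>I. c i) = 0" and D: "D \<noteq> 0" and "finite I" "I \<noteq> {}"
    and count: "\<And>b. \<exists>i\<in>I. b i \<Longrightarrow> \<exists>i\<in>I. \<not> b i \<Longrightarrow>
      \<alpha> * ((\<Sum>i\<in>I. of_bool (\<forall>j\<in>I - {i}. b j)) + (\<Sum>i\<in>I. of_bool (\<forall>j\<in>I - {i}. \<not> b j))) +
      (\<Sum>k\<in>I. \<Sum>l\<in>I. of_bool (b k \<noteq> b l)) = C"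
  shows "\<alpha> * ((\<Sum>i\<in>I. of_bool (\<forall>j\<in>I - {i}. 0 \<le> c j * D)) + (\<Sum>i\<in>I. of_bool (\<forall>j\<in>I - {i}. 0 \<le> - c j * D))) +
    (\<Sum>k\<in>I. \<Sum>l\<in>I. of_bool (c k * c l < 0)) = C"
proof -
  define b where "b i \<longleftrightarrow> 0 < c i * D" for i
  have sgn: "(0 \<le> t \<longleftrightarrow> 0 < t) \<and> (0 \<le> - t \<longleftrightarrow> \<not> 0 < t)" if "t \<noteq> 0" for t :: real
    using that by auto
  have nz': "c i * D \<noteq> 0" if "i \<in> I" for i using nz[OF that] D by simp
  have 1: "0 \<le> c i * D \<longleftrightarrow> b i" "0 \<le> - c i * D \<longleftrightarrow> \<not> b i" if "i \<in> I" for i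
    using sgn[OF nz'[OF that]] unfolding b_def mult_minus_left by blast+
  have 2: "c k * c l < 0 \<longleftrightarrow> b k \<noteq> b l" if "k \<in> I" "l \<in> I" for k l
    using nz[OF that(1)] nz[OF that(2)] D by (auto simp: b_def mult_less_0_iff zero_less_mult_iff)
  have sum: "(\<Sum>i\<in>I. c i * D) = 0" using s by (simp add: sum_distrib_right[symmetric])
  \<comment> \<open>The coefficients are nonzero and add up to 0, so both signs occur; this rules
    out the patterns without an isolated sign or a split.\<close>
  have ex: "\<exists>i\<in>I. b i"
  proof (rule ccontr)
    assume "\<not> ?thesis"
    then have "(\<Sum>i\<in>I. - (c i * D)) > 0"
      using nz' assms(4,5) by (intro sum_pos) (auto simp: b_def not_less less_le simp del: mult_eq_0_iff)
    then show False using sum by (simp add: sum_negf)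
  qed
  have ex': "\<exists>i\<in>I. \<not> b i"
  proof (rule ccontr)
    assume "\<not> ?thesis"
    then have "(\<Sum>i\<in>I. c i * D) > 0" using assms(4,5) by (intro sum_pos) (auto simp: b_def)
    then show False using sum by simp
  qed
  have "(\<Sum>i\<in>I. of_bool (\<forall>j\<in>I - {i}. 0 \<le> c j * D)) = (\<Sum>i\<in>I. of_bool (\<forall>j\<in>I - {i}. b j) :: ennreal)"
    "(\<Sum>i\<in>I. of_bool (\<forall>j\<in>I - {i}. 0 \<le> - c j * D)) = (\<Sum>i\<in>I. of_bool (\<forall>j\<in>I - {i}. \<not> b j) :: ennreal)"
    "(\<Sum>k\<in>I. \<Sum>l\<in>I. of_bool (c k * c l < 0)) = (\<Sum>k\<in>I. \<Sum>l\<in>I. of_bool (b k \<noteq> b l) :: ennreal)"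
    by (intro sum.cong refl arg_cong[where f = of_bool] ball_cong; use 1 2 in blast)+
  then show ?thesis using count[OF ex ex'] by (simp only:)
qed

text \<open>The double sum is 6 when one sign is isolated (N = 1 or 3) and 8 when N = 2; the weight
  2 on isolated signs makes up the difference.\<close>

lemma sign_count_3:
  fixes c :: "nat \<Rightarrow> real"
  assumes nz: "\<And>i. i \<in> {0..3} \<Longrightarrow> c i \<noteq> 0" and s: "(\<Sum>i\<in>{0..3}. c i) = 0" and D: "D \<noteq> 0"
  shows "2 * ((\<Sum>i\<in>{0..3}. of_bool (\<forall>j\<in>{0..3} - {i}. 0 \<le> c j * D)) +
      (\<Sum>i\<in>{0..3}. of_bool (\<forall>j\<in>{0..3} - {i}. 0 \<le> - c j * D))) +
    (\<Sum>k\<in>{0..3}. \<Sum>l\<in>{0..3}. of_bool (c k * c l < 0)) = (8 :: ennreal)"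
proof (rule sign_count[OF nz s D], assumption, simp, simp)
  have I: "{0..3} = {0::nat, 1, 2, 3}" by auto
  fix b :: "nat \<Rightarrow> bool" assume b: "\<exists>i\<in>{0..3}. b i" "\<exists>i\<in>{0..3}. \<not> b i"
  show "2 * ((\<Sum>i\<in>{0..3}. of_bool (\<forall>j\<in>{0..3} - {i}. b j)) + (\<Sum>i\<in>{0..3}. of_bool (\<forall>j\<in>{0..3} - {i}. \<not> b j))) +
    (\<Sum>k\<in>{0..3}. \<Sum>l\<in>{0..3}. of_bool (b k \<noteq> b l)) = (8 :: ennreal)"
    using b unfolding I
    by (cases "b 0"; cases "b 1"; cases "b 2"; cases "b 3") (simp_all add: insert_Diff_if del: sum_of_bool_eq)
qed

text \<open>The double sum is 8 when one sign is isolated (N = 1 or 4) and 12 when N = 2 or 3,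
  whence the weight 4.\<close>

lemma sign_count_4:
  fixes c :: "nat \<Rightarrow> real"
  assumes nz: "\<And>i. i \<in> {0..4} \<Longrightarrow> c i \<noteq> 0" and s: "(\<Sum>i\<in>{0..4}. c i) = 0" and D: "D \<noteq> 0"
  shows "4 * ((\<Sum>i\<in>{0..4}. of_bool (\<forall>j\<in>{0..4} - {i}. 0 \<le> c j * D)) +
      (\<Sum>i\<in>{0..4}. of_bool (\<forall>j\<in>{0..4} - {i}. 0 \<le> - c j * D))) +
    (\<Sum>k\<in>{0..4}. \<Sum>l\<in>{0..4}. of_bool (c k * c l < 0)) = (12 :: ennreal)"
proof (rule sign_count[OF nz s D], assumption, simp, simp)
  have I: "{0..4} = {0::nat, 1, 2, 3, 4}" by auto
  fix b :: "nat \<Rightarrow> bool" assume b: "\<exists>i\<in>{0..4}. b i" "\<exists>i\<in>{0..4}. \<not> b i"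
  show "4 * ((\<Sum>i\<in>{0..4}. of_bool (\<forall>j\<in>{0..4} - {i}. b j)) + (\<Sum>i\<in>{0..4}. of_bool (\<forall>j\<in>{0..4} - {i}. \<not> b j))) +
    (\<Sum>k\<in>{0..4}. \<Sum>l\<in>{0..4}. of_bool (b k \<noteq> b l)) = (12 :: ennreal)"
    using b unfolding I
    by (cases "b 0"; cases "b 1"; cases "b 2"; cases "b 3"; cases "b 4") (simp_all add: insert_Diff_if del: sum_of_bool_eq)
qed

lemma nn_integral_unif_ball_reflect:
  assumes [measurable]: "f \<in> borel_measurable borel"
  shows "(\<integral>\<^sup>+v. f (- v) \<partial>unif_ball) = (\<integral>\<^sup>+v. f v \<partial>(unif_ball :: 'a::euclidean_space measure))"
proof -
  have "distr unif_ball borel uminus = (unif_ball :: 'a measure)"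
    by (rule distr_uniform_ball_isometry) (auto intro!: linearI)
  then have "(\<integral>\<^sup>+v. f v \<partial>(unif_ball :: 'a measure)) = (\<integral>\<^sup>+v. f v \<partial>distr unif_ball borel uminus)"
    by simp
  also have "\<dots> = (\<integral>\<^sup>+v. f (- v) \<partial>unif_ball)"
    by (rule nn_integral_distr) measurable
  finally show ?thesis ..
qed

section \<open>Averaging the sign count over direction and points\<close>

context simplex_enum
begin

text \<open>The number of vertices from which v points into the simplex, set to 0 for degenerate
  configurations so that its average over v is the angle sum at every x.\<close>

definition vertex_count :: "(nat \<Rightarrow> real^'n) \<Rightarrow> real^'n \<Rightarrow> ennreal" where
  "vertex_count x v = of_bool (det (edge_matrix p x) \<noteq> 0) *
    (\<Sum>i\<in>{0..CARD('n)}. of_bool (\<forall>j\<in>{0..CARD('n)} - {i}. 0 \<le> dircoef p x v j * det (edge_matrix p x)))"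

lemma measurable_vertex_count:
  "(\<lambda>(v, x). vertex_count x v) \<in> borel_measurable (unif_ball \<Otimes>\<^sub>M PiM {0..CARD('n)} (\<lambda>_. unif_ball))"
proof -
  let ?M = "(unif_ball :: (real^'n) measure) \<Otimes>\<^sub>M PiM {0..CARD('n)} (\<lambda>_. unif_ball)"
  have *: "(\<lambda>y. snd y i) \<in> borel_measurable ?M" if "i \<in> {0..CARD('n)}" for i
    by (rule measurable_compose[OF measurable_snd measurable_unif_ball_component[OF that]])
  have "fst \<in> measurable ?M (unif_ball :: (real^'n) measure)" by (rule measurable_fst)
  also have "measurable ?M (unif_ball :: (real^'n) measure) = borel_measurable ?M"
    by (rule measurable_cong_sets) simp_all
  finally have f: "fst \<in> borel_measurable ?M" .
  have [measurable]: "(\<lambda>y. dircoef p (snd y) (fst y) i) \<in> borel_measurable ?M" if "i \<in> {0..CARD('n)}" for i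
    by (rule measurable_dircoef(1)[OF * f that])
  have [measurable]: "(\<lambda>y. det (edge_matrix p (snd y))) \<in> borel_measurable ?M"
    by (rule measurable_dircoef(2)[where i = 0, OF * f]) auto
  show ?thesis
    unfolding vertex_count_def split_beta of_bool_def
    by measurable
qed

lemma vertex_angle_sum_eq_nn_integral:
  "ennreal (vertex_angle_sum (convex hull (x ` {0..CARD('n)}))) = (\<integral>\<^sup>+v. vertex_count x v \<partial>unif_ball)"
proof (cases "det (edge_matrix p x) = 0")
  case True
  then show ?thesis by (simp add: vertex_angle_sum_simplex vertex_count_def)
next
  case False
  interpret prob_space "unif_ball :: (real^'n) measure" by (rule prob_space_unif_ball)
  let ?A = "\<lambda>i. {v. \<forall>j\<in>{0..CARD('n)} - {i}. 0 \<le> dircoef p x v j * det (edge_matrix p x)}"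
  have [measurable]: "(\<lambda>v. dircoef p x v j) \<in> borel_measurable borel" if "j \<in> {0..CARD('n)} - {i}" for i j
    by (rule measurable_dircoef(1)) (use that in auto)
  have A: "?A i \<in> sets unif_ball" for i
  proof -
    have "?A i \<in> sets borel" by measurable
    then show ?thesis by simp
  qed
  have "ennreal (vertex_angle_sum (convex hull (x ` {0..CARD('n)}))) = (\<Sum>i\<in>{0..CARD('n)}. emeasure unif_ball (?A i))"
    using False by (simp add: vertex_angle_sum_simplex emeasure_eq_measure)
  also have "\<dots> = (\<integral>\<^sup>+v. (\<Sum>i\<in>{0..CARD('n)}. indicator (?A i) v) \<partial>unif_ball)"
    by (subst nn_integral_sum) (use A in auto)
  also have "\<dots> = (\<integral>\<^sup>+v. vertex_count x v \<partial>unif_ball)"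
    using False by (intro nn_integral_cong) (simp add: vertex_count_def indicator_def of_bool_def)
  finally show ?thesis .
qed

text \<open>Replacing v by -v flips all signs, so the two inner sums of the count are the vertex
  counts of v and -v, with equal averages: hence 2 \<alpha>. The double sum contributes r for each
  of the d (d + 1) ordered pairs of distinct indices. The equation stays additive because
  subtraction in \<open>ennreal\<close> is truncated.\<close>

lemma expected_vertex_angle_sum:
  fixes \<alpha> C r :: ennreal and q :: real
  assumes count: "\<And>c D. (\<And>i. i \<in> {0..CARD('n)} \<Longrightarrow> c i \<noteq> 0) \<Longrightarrow> (\<Sum>i\<in>{0..CARD('n)}. c i) = (0::real) \<Longrightarrow> D \<noteq> 0 \<Longrightarrow>
      \<alpha> * ((\<Sum>i\<in>{0..CARD('n)}. of_bool (\<forall>j\<in>{0..CARD('n)} - {i}. 0 \<le> c j * D)) +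
      (\<Sum>i\<in>{0..CARD('n)}. of_bool (\<forall>j\<in>{0..CARD('n)} - {i}. 0 \<le> - c j * D))) +
      (\<Sum>k\<in>{0..CARD('n)}. \<Sum>l\<in>{0..CARD('n)}. of_bool (c k * c l < 0)) = C"
    and nz: "\<And>v k l. v \<noteq> 0 \<Longrightarrow> k \<in> {0..CARD('n)} \<Longrightarrow> l \<in> {0..CARD('n)} \<Longrightarrow> k \<noteq> l \<Longrightarrow>
      AE x in PiM {0..CARD('n)} (\<lambda>_. unif_ball). dircoef p x v k \<noteq> 0"
    and opp: "\<And>v k l. v \<noteq> 0 \<Longrightarrow> k \<in> {0..CARD('n)} \<Longrightarrow> l \<in> {0..CARD('n)} \<Longrightarrow> k \<noteq> l \<Longrightarrow>
      (\<integral>\<^sup>+x. indicator {t. t < 0} (dircoef p x v k * dircoef p x v l) \<partial>(PiM {0..CARD('n)} (\<lambda>_. unif_ball))) = r"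
  shows "2 * \<alpha> * (\<integral>\<^sup>+x. ennreal (vertex_angle_sum (convex hull (x ` {0..CARD('n)}))) \<partial>(PiM {0..CARD('n)} (\<lambda>_. unif_ball :: (real^'n) measure)))
      + of_nat (CARD('n) * (CARD('n) + 1)) * r = C"
    and "(\<lambda>x. vertex_angle_sum (convex hull (x ` {0..CARD('n)}))) \<in> borel_measurable (PiM {0..CARD('n)} (\<lambda>_. unif_ball :: (real^'n) measure))"
proof -
  let ?I = "{0..CARD('n)}"
  let ?U = "unif_ball :: (real^'n) measure"
  let ?P = "PiM ?I (\<lambda>_. ?U)"
  let ?N = "\<lambda>v x. \<Sum>k\<in>?I. \<Sum>l\<in>?I. indicator {t. t < 0} (dircoef p x v k * dircoef p x v l) :: ennreal"
  interpret U: prob_space ?U by (rule prob_space_unif_ball)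
  interpret P: prob_space ?P by (intro prob_space_PiM prob_space_unif_ball)
  interpret UP: pair_sigma_finite ?U ?P ..
  have UB: "measurable ?U borel = measurable borel (borel :: ennreal measure)"
    by (rule measurable_cong_sets) simp_all
  have meas: "(\<lambda>x. \<integral>\<^sup>+v. vertex_count x v \<partial>?U) \<in> borel_measurable ?P"
    using U.borel_measurable_nn_integral_fst[OF measurable_pair_swap[OF measurable_vertex_count]] by simp
  have "(\<lambda>x. enn2real (\<integral>\<^sup>+v. vertex_count x v \<partial>?U)) \<in> borel_measurable ?P"
    using meas by measurable
  moreover have "vertex_angle_sum S = enn2real (ennreal (vertex_angle_sum S))" for S :: "(real^'n) set"
    by (simp add: vertex_angle_sum_def solid_angle_def sum_nonneg)
  then have "(\<lambda>x. vertex_angle_sum (convex hull (x ` ?I))) = (\<lambda>x. enn2real (\<integral>\<^sup>+v. vertex_count x v \<partial>?U))"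
    by (simp only: vertex_angle_sum_eq_nn_integral[symmetric] flip: fun_eq_iff)
  ultimately show "(\<lambda>x. vertex_angle_sum (convex hull (x ` ?I))) \<in> borel_measurable ?P"
    by (simp only:)
  have mv: "(\<lambda>x. vertex_count x v) \<in> borel_measurable ?P" for v
    using measurable_compose[OF measurable_Pair1'[of v ?U ?P] measurable_vertex_count] by simp
  have mF: "(\<lambda>v. \<integral>\<^sup>+x. vertex_count x v \<partial>?P) \<in> borel_measurable borel"
    using P.borel_measurable_nn_integral_fst[OF measurable_vertex_count] by (simp add: UB)
  have mN: "(\<lambda>x. indicator {t. t < 0} (dircoef p x v k * dircoef p x v l) :: ennreal) \<in> borel_measurable ?P"
    if "k \<in> ?I" "l \<in> ?I" for v k l
    by (rule measurable_compose[OF borel_measurable_times[OF measurable_dircoef_PiM(1)[OF that(1)] measurable_dircoef_PiM(1)[OF that(2)]]]) simp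
  have mN': "(\<lambda>x. ?N v x) \<in> borel_measurable ?P" for v
    by (intro borel_measurable_sum mN)
  have self: "(\<integral>\<^sup>+x. indicator {t. t < 0} (dircoef p x v k * dircoef p x v k) \<partial>?P) = (0 :: ennreal)" for v k
    by (simp add: indicator_def not_less)
  have intN: "(\<integral>\<^sup>+x. ?N v x \<partial>?P) = of_nat (CARD('n) * (CARD('n) + 1)) * r" if v: "v \<noteq> 0" for v
  proof -
    have "(\<integral>\<^sup>+x. ?N v x \<partial>?P) = (\<Sum>k\<in>?I. \<Sum>l\<in>?I. \<integral>\<^sup>+x. indicator {t. t < 0} (dircoef p x v k * dircoef p x v l) \<partial>?P)"
      by (subst nn_integral_sum, intro borel_measurable_sum mN, assumption+)
        (intro sum.cong refl nn_integral_sum mN, assumption+)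
    also have "\<dots> = (\<Sum>k\<in>?I. of_nat (CARD('n)) * r)"
    proof (rule sum.cong[OF refl])
      fix k assume k: "k \<in> ?I"
      have "(\<Sum>l\<in>?I. \<integral>\<^sup>+x. indicator {t. t < 0} (dircoef p x v k * dircoef p x v l) \<partial>?P)
        = (\<Sum>l\<in>?I - {k}. \<integral>\<^sup>+x. indicator {t. t < 0} (dircoef p x v k * dircoef p x v l) \<partial>?P)"
        by (subst sum.remove[OF _ k]) (simp_all only: finite_atLeastAtMost self add_0)
      also have "\<dots> = (\<Sum>l\<in>?I - {k}. r)"
        using opp[OF v k] by (intro sum.cong refl) auto
      finally show "(\<Sum>l\<in>?I. \<integral>\<^sup>+x. indicator {t. t < 0} (dircoef p x v k * dircoef p x v l) \<partial>?P) = of_nat (CARD('n)) * r"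
        using k by (simp add: card_Diff_singleton)
    qed
    also have "\<dots> = of_nat (CARD('n) * (CARD('n) + 1)) * r"
      by (simp add: algebra_simps)
    finally show ?thesis .
  qed
  have AEv: "AE v in ?U. v \<noteq> 0"
    using AE_lborel_singleton[of "0 :: real^'n"] by (intro AE_unif_ballI) auto
  have key: "\<alpha> * ((\<integral>\<^sup>+x. vertex_count x v \<partial>?P) + (\<integral>\<^sup>+x. vertex_count x (- v) \<partial>?P))
      + of_nat (CARD('n) * (CARD('n) + 1)) * r = C" if v: "v \<noteq> 0" for v
  proof -
    have "AE x in ?P. dircoef p x v k \<noteq> 0" if "k \<in> ?I" for k
      \<comment> \<open>\<open>nz\<close> speaks about a pair; any index different from k serves as
        its partner.\<close>
      by (rule nz[OF v that, of "if k = 0 then 1 else 0"]) (use that in \<open>auto simp: Suc_le_eq\<close>)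
    then have "AE x in ?P. \<forall>k\<in>?I. dircoef p x v k \<noteq> 0"
      by (intro AE_finite_allI) auto
    then have eq: "AE x in ?P. \<alpha> * (vertex_count x v + vertex_count x (- v)) + ?N v x = C"
      using AE_det_edge_matrix
    proof eventually_elim
      case (elim x)
      then have "\<alpha> * ((\<Sum>i\<in>?I. of_bool (\<forall>j\<in>?I - {i}. 0 \<le> dircoef p x v j * det (edge_matrix p x))) +
         (\<Sum>i\<in>?I. of_bool (\<forall>j\<in>?I - {i}. 0 \<le> - dircoef p x v j * det (edge_matrix p x)))) +
         (\<Sum>k\<in>?I. \<Sum>l\<in>?I. of_bool (dircoef p x v k * dircoef p x v l < 0)) = C"
        by (intro count sum_dircoef) auto
      moreover have "?N v x = (\<Sum>k\<in>?I. \<Sum>l\<in>?I. of_bool (dircoef p x v k * dircoef p x v l < 0))"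
        by (intro sum.cong refl) (simp add: indicator_def)
      ultimately show ?case
        using elim by (simp only: vertex_count_def dircoef_minus) simp
    qed
    have "(\<integral>\<^sup>+x. \<alpha> * (vertex_count x v + vertex_count x (- v)) + ?N v x \<partial>?P) = (\<integral>\<^sup>+x. C \<partial>?P)"
      by (rule nn_integral_cong_AE[OF eq])
    also have "\<dots> = C" using P.emeasure_space_1 by simp
    also have "(\<integral>\<^sup>+x. \<alpha> * (vertex_count x v + vertex_count x (- v)) + ?N v x \<partial>?P)
      = \<alpha> * ((\<integral>\<^sup>+x. vertex_count x v \<partial>?P) + (\<integral>\<^sup>+x. vertex_count x (- v) \<partial>?P)) + (\<integral>\<^sup>+x. ?N v x \<partial>?P)"
      using mv mN' by (subst nn_integral_add) (simp_all add: nn_integral_cmult nn_integral_add)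
    finally show ?thesis by (simp only: intN[OF v])
  qed
  have "(\<integral>\<^sup>+v. \<alpha> * ((\<integral>\<^sup>+x. vertex_count x v \<partial>?P) + (\<integral>\<^sup>+x. vertex_count x (- v) \<partial>?P))
      + of_nat (CARD('n) * (CARD('n) + 1)) * r \<partial>?U) = (\<integral>\<^sup>+v. C \<partial>?U)"
    by (rule nn_integral_cong_AE) (use AEv in eventually_elim, rule key)
  also have "\<dots> = C" using U.emeasure_space_1 by simp
  finally have tot: "(\<integral>\<^sup>+v. \<alpha> * ((\<integral>\<^sup>+x. vertex_count x v \<partial>?P) + (\<integral>\<^sup>+x. vertex_count x (- v) \<partial>?P))
      + of_nat (CARD('n) * (CARD('n) + 1)) * r \<partial>?U) = C" .
  have mF': "(\<lambda>v. \<integral>\<^sup>+x. vertex_count x (- v) \<partial>?P) \<in> borel_measurable borel"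
    by (rule measurable_compose[OF borel_measurable_uminus[OF measurable_ident] mF, simplified])
  let ?A = "\<integral>\<^sup>+v. \<integral>\<^sup>+x. vertex_count x v \<partial>?P \<partial>?U"
  have "C = \<alpha> * (?A + (\<integral>\<^sup>+v. \<integral>\<^sup>+x. vertex_count x (- v) \<partial>?P \<partial>?U)) + of_nat (CARD('n) * (CARD('n) + 1)) * r"
    unfolding tot[symmetric] using mF mF' U.emeasure_space_1
    by (subst nn_integral_add) (simp_all add: UB nn_integral_cmult nn_integral_add del: of_nat_mult)
  also have "(\<integral>\<^sup>+v. \<integral>\<^sup>+x. vertex_count x (- v) \<partial>?P \<partial>?U) = ?A"
    by (rule nn_integral_unif_ball_reflect[OF mF])
  also have "?A = (\<integral>\<^sup>+x. \<integral>\<^sup>+v. vertex_count x v \<partial>?U \<partial>?P)"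
    \<comment> \<open>Up to here v was fixed and the points random; the exchange brings back the
      angle sum of a fixed simplex.\<close>
    by (rule UP.Fubini'[symmetric]) (rule measurable_vertex_count)
  also have "\<alpha> * ((\<integral>\<^sup>+x. \<integral>\<^sup>+v. vertex_count x v \<partial>?U \<partial>?P) + (\<integral>\<^sup>+x. \<integral>\<^sup>+v. vertex_count x v \<partial>?U \<partial>?P))
    = 2 * \<alpha> * (\<integral>\<^sup>+x. \<integral>\<^sup>+v. vertex_count x v \<partial>?U \<partial>?P)"
    by (simp add: mult_2 distrib_left distrib_right mult_ac)
  finally show "2 * \<alpha> * (\<integral>\<^sup>+x. ennreal (vertex_angle_sum (convex hull (x ` ?I))) \<partial>?P)
      + of_nat (CARD('n) * (CARD('n) + 1)) * r = C"
    by (simp only: vertex_angle_sum_eq_nn_integral)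
qed

end

text \<open>A cannot be infinite, since a > 0 and the right-hand side is finite; so the equation can
  be solved in the reals.\<close>

lemma enn2real_solve_linear:
  assumes eq: "ennreal a * A + ennreal s = ennreal C" and "a > 0" "s \<ge> 0" "C \<ge> 0"
  shows "enn2real A = (C - s) / a"
proof (cases A)
  case (real t)
  then have "ennreal (a * t + s) = ennreal C"
    using eq assms by (simp add: ennreal_mult)
  then have "a * t + s = C"
    using real assms by (subst (asm) ennreal_inj) auto
  then show ?thesis using real assms by (simp add: field_simps)
next
  case top
  then show ?thesis using eq assms by (simp add: ennreal_mult_top)
qed

theorem theorem1p2:
  fixes M :: "'w measure" and X :: "nat \<Rightarrow> 'w \<Rightarrow> real^'d"
  assumes "CARD('d) \<in> {3, 4}"
    and "prob_space M"
    and "prob_space.indep_vars M (\<lambda>_. borel) X {0..CARD('d)}"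
    and "\<And>i. i \<in> {0..CARD('d)} \<Longrightarrow>
           distr M borel (X i) = uniform_measure lborel (cball 0 1)"
  shows "integral\<^sup>L M (\<lambda>\<omega>. vertex_angle_sum (convex hull ((\<lambda>i. X i \<omega>) ` {0..CARD('d)}))) =
    (if CARD('d) = 3 then 401 / 2560 else 1692197 / (846720 * pi\<^sup>2) - 1 / 6)"
proof -
  interpret prob_space M by fact
  let ?I = "{0..CARD('d)}"
  let ?P = "PiM ?I (\<lambda>_. unif_ball :: (real^'d) measure)"
  let ?G = "\<lambda>x :: nat \<Rightarrow> real^'d. vertex_angle_sum (convex hull (x ` ?I))"
  let ?T = "\<lambda>\<omega>. \<lambda>i\<in>?I. X i \<omega>"
  let ?A = "\<integral>\<^sup>+x. ennreal (?G x) \<partial>?P"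
  obtain p :: "'d \<Rightarrow> nat" where "bij_betw p UNIV {1..CARD('d)}"
    using finite_same_card_bij[of "UNIV :: 'd set" "{1..CARD('d)}"] by auto
  then interpret simplex_enum p by unfold_locales
  have rv: "random_variable borel (X i)" if "i \<in> ?I" for i
    using assms(3) that by (simp add: indep_vars_def)
  have T: "?T \<in> measurable M (PiM ?I (\<lambda>_. borel))"
    by (intro measurable_restrict rv)
  \<comment> \<open>Independence says that the joint law is the product of the marginals.
    \<open>?T\<close> is restricted to \<open>?I\<close> to be a point of the product space, which
    leaves the convex hull unchanged.\<close>
  have "distr M (PiM ?I (\<lambda>_. borel)) ?T = PiM ?I (\<lambda>i. distr M borel (X i))"
    using assms(3) by (subst (asm) indep_vars_iff_distr_eq_PiM') (auto intro: rv)
  also have "\<dots> = ?P"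
    by (rule PiM_cong) (simp_all add: assms(4))
  finally have distr: "distr M (PiM ?I (\<lambda>_. borel)) ?T = ?P" .
  have sets: "measurable ?P borel = measurable (PiM ?I (\<lambda>_. borel)) (borel :: real measure)"
    by (intro measurable_cong_sets sets_PiM_cong) simp_all
  have nonneg: "0 \<le> ?G x" for x
    by (simp add: vertex_angle_sum_def solid_angle_def sum_nonneg)
  have integral: "integral\<^sup>L M (\<lambda>\<omega>. vertex_angle_sum (convex hull ((\<lambda>i. X i \<omega>) ` ?I))) = enn2real ?A"
    if G: "?G \<in> borel_measurable ?P"
  proof -
    have "integral\<^sup>L M (\<lambda>\<omega>. vertex_angle_sum (convex hull ((\<lambda>i. X i \<omega>) ` ?I))) = integral\<^sup>L M (\<lambda>\<omega>. ?G (?T \<omega>))"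
      by simp
    also have "\<dots> = integral\<^sup>L (distr M (PiM ?I (\<lambda>_. borel)) ?T) ?G"
      using G unfolding sets by (rule integral_distr[OF T, symmetric])
    also have "\<dots> = enn2real ?A"
      unfolding distr using G nonneg by (intro integral_eq_nn_integral) auto
    finally show ?thesis .
  qed
  show ?thesis
  proof (cases "CARD('d) = 3")
    case True
    have count: "2 * ((\<Sum>i\<in>?I. of_bool (\<forall>j\<in>?I - {i}. 0 \<le> c j * D)) +
      (\<Sum>i\<in>?I. of_bool (\<forall>j\<in>?I - {i}. 0 \<le> - c j * D))) +
      (\<Sum>k\<in>?I. \<Sum>l\<in>?I. of_bool (c k * c l < 0)) = (8 :: ennreal)"
      if "\<And>i. i \<in> ?I \<Longrightarrow> c i \<noteq> 0" "(\<Sum>i\<in>?I. c i) = (0::real)" "D \<noteq> 0" for c D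
      using that unfolding True by (rule sign_count_3)
    have E: "2 * 2 * ?A + of_nat (CARD('d) * (CARD('d) + 1)) * ennreal (1573 / 2560) = 8" "?G \<in> borel_measurable ?P"
      by (rule expected_vertex_angle_sum[where \<alpha> = 2 and C = 8 and r = "ennreal (1573 / 2560)"],
        fact count, fact opposite_sign_probability_3(1)[OF True], fact opposite_sign_probability_3(2)[OF True])+
    have "of_nat (CARD('d) * (CARD('d) + 1)) = (12 :: ennreal)" by (simp add: True)
    moreover have "ennreal (12 * t) = 12 * ennreal t" for t
      by (simp add: ennreal_mult')
    ultimately have "ennreal 4 * ?A + ennreal (12 * (1573 / 2560)) = ennreal 8"
      using E(1) by (simp only: ennreal_numeral) simp
    then have "enn2real ?A = (8 - 12 * (1573 / 2560)) / 4"
      by (rule enn2real_solve_linear) simp_all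
    then show ?thesis using integral[OF E(2)] True by simp
  next
    case False
    then have card: "CARD('d) = 4" using assms(1) by simp
    let ?r = "2 / 3 - 1692197 / (2116800 * pi\<^sup>2)"
    have count: "4 * ((\<Sum>i\<in>?I. of_bool (\<forall>j\<in>?I - {i}. 0 \<le> c j * D)) +
      (\<Sum>i\<in>?I. of_bool (\<forall>j\<in>?I - {i}. 0 \<le> - c j * D))) +
      (\<Sum>k\<in>?I. \<Sum>l\<in>?I. of_bool (c k * c l < 0)) = (12 :: ennreal)"
      if "\<And>i. i \<in> ?I \<Longrightarrow> c i \<noteq> 0" "(\<Sum>i\<in>?I. c i) = (0::real)" "D \<noteq> 0" for c D
      using that unfolding card by (rule sign_count_4)
    have r: "?r \<ge> 0"
    proof -
      \<comment> \<open>The crude bound on pi makes the pair probability visibly nonnegative, so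
        that \<open>ennreal\<close> does not truncate it.\<close>
      have "9 \<le> pi\<^sup>2" using pi_gt3 power_mono[of 3 pi 2] by simp
      then show ?thesis by (simp add: field_simps)
    qed
    have E: "2 * 4 * ?A + of_nat (CARD('d) * (CARD('d) + 1)) * ennreal ?r = 12" "?G \<in> borel_measurable ?P"
      by (rule expected_vertex_angle_sum[where \<alpha> = 4 and C = 12 and r = "ennreal ?r"],
        fact count, fact opposite_sign_probability_4(1)[OF card], fact opposite_sign_probability_4(2)[OF card])+
    have "of_nat (CARD('d) * (CARD('d) + 1)) = (20 :: ennreal)" by (simp add: card)
    moreover have "ennreal (20 * t) = 20 * ennreal t" for t
      by (simp add: ennreal_mult')
    ultimately have "ennreal 8 * ?A + ennreal (20 * ?r) = ennreal 12"
      using E(1) by (simp only: ennreal_numeral) simp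
    then have "enn2real ?A = (12 - 20 * ?r) / 8"
      using r by (intro enn2real_solve_linear) simp_all
    also have "\<dots> = 1692197 / (846720 * pi\<^sup>2) - 1 / 6"
      by (simp add: field_simps)
    finally show ?thesis using integral[OF E(2)] False by simp
  qed
qed

end
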